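(* Let $\mathcal C$ be a braided monoidal category with braiding $\Phi$ and let $H\in\mathcal C$ be a Hopf algebra with bijective antipode such that $\Phi_{H,X}=\Phi_{X,H}^{-1}$ for all $X\in\mathcal C$. The categories $\mathcal Z^{\mathcal C}_r({}_H\mathcal C)$ and ${}_H\mathcal{YD}(\mathcal C)^{H^{op}}$ are isomorphic as braided monoidal categories.
   Context: $\mathcal C$ is taken strict; an object name also denotes its identity morphism and composition is written by juxtaposition. $H$ has multiplication $\nabla$, comultiplication $\Delta$, counit $\varepsilon$. ${}_H\mathcal C$ is the monoidal category of left $H$-modules in $\mathcal C$. Right center: for a monoidal category $\mathcal D$, objects of $\mathcal Z_r(\mathcal D)$ are pairs $(V,c_{-,V})$, $V\in\mathcal D$, with natural isomorphisms $c_{X,V}:X\otimes V\to V\otimes X$ ($X\in\mathcal D$) such that $c_{X\otimes Y,V}=(c_{X,V}\otimes Y)(X\otimes c_{Y,V})$; a morphism $(V,c_{-,V})\to(W,c_{-,W})$ is a morphism $f:V\to W$ with $(f\otimes X)c_{X,V}=c_{X,W}(X\otimes f)$ for all $X$; the tensor product is $(V\otimes W,c_{-,V\otimes W})$ with $c_{X,V\otimes W}=(V\otimes c_{X,W})(c_{X,V}\otimes W)$ and the braiding is $c_{V,W}$. $\mathcal Z_r^{\mathcal C}({}_H\mathcal C)$ is the subcategory of $\mathcal Z_r({}_H\mathcal C)$ of those objects $(V,c_{-,V})$ such that $c_{X,V}=\Phi_{X,V}$ for every $X\in\mathcal C$ regarded as an $H$-module with trivial action $\varepsilon\otimes X$ (with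 all morphisms of $\mathcal Z_r({}_H\mathcal C)$ between them). A left-right Yetter-Drinfel'd module over $H$ is a left $H$-module $(M,\mu_M)$ and right $H$-comodule $(M,\rho_M)$ in $\mathcal C$ with $(M\otimes\nabla)(\rho_M\otimes H)\Phi_{M,H}^{-1}(H\otimes\mu_M)(\Delta\otimes M)=(\mu_M\otimes\nabla)(H\otimes\Phi_{H,M}\otimes H)(\Delta\otimes\rho_M)$. ${}_H\mathcal{YD}(\mathcal C)^{H^{op}}$ is the category of these with left $H$-linear, right $H$-colinear morphisms; $M\otimes N$ carries the action $(\mu_M\otimes\mu_N)(H\otimes\Phi_{H,M}\otimes N)(\Delta\otimes M\otimes N)$ and the coaction $(M\otimes N\otimes\nabla\Phi_{H,H})(M\otimes\Phi_{H,N}\otimes H)(\rho_M\otimes\rho_N)$; the braiding is $\Phi^{1+}_{M,N}=(N\otimes\mu_M)(\rho_N\otimes M)\Phi_{M,N}$. *)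

theory Defs
  imports "HOL-Library.FuncSet"
begin

section \<open>Strict monoidal categories\<close>

record ('o, 'a) strict_moncat =
  Obj :: "'o set"
  Arr :: "'a set"
  Dom :: "'a \<Rightarrow> 'o"
  Cod :: "'a \<Rightarrow> 'o"
  Ide :: "'o \<Rightarrow> 'a" ("\<iota>\<index>")
  Comp :: "'a \<Rightarrow> 'a \<Rightarrow> 'a" (infixr "\<cdot>\<index>" 55)
  TensO :: "'o \<Rightarrow> 'o \<Rightarrow> 'o" (infixr "\<odot>\<index>" 70)
  TensA :: "'a \<Rightarrow> 'a \<Rightarrow> 'a" (infixr "\<otimes>\<index>" 70)
  Unit :: "'o" ("\<one>\<index>")

definition Hom :: "('o, 'a, 'z) strict_moncat_scheme \<Rightarrow> 'o \<Rightarrow> 'o \<Rightarrow> 'a set" ("Hom\<index>")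
  where "Hom\<^bsub>C\<^esub> X Y = {f \<in> Arr C. Dom C f = X \<and> Cod C f = Y}"

definition inverse_arrows :: "('o, 'a, 'z) strict_moncat_scheme \<Rightarrow> 'a \<Rightarrow> 'a \<Rightarrow> bool"
  where "inverse_arrows C f g \<longleftrightarrow>
    f \<in> Arr C \<and> g \<in> Hom\<^bsub>C\<^esub> (Cod C f) (Dom C f) \<and>
    g \<cdot>\<^bsub>C\<^esub> f = \<iota>\<^bsub>C\<^esub> (Dom C f) \<and> f \<cdot>\<^bsub>C\<^esub> g = \<iota>\<^bsub>C\<^esub> (Cod C f)"

definition is_iso :: "('o, 'a, 'z) strict_moncat_scheme \<Rightarrow> 'a \<Rightarrow> bool"
  where "is_iso C f \<longleftrightarrow> (\<exists>g. inverse_arrows C f g)"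

definition inv_arrow :: "('o, 'a, 'z) strict_moncat_scheme \<Rightarrow> 'a \<Rightarrow> 'a"
  where "inv_arrow C f = (THE g. inverse_arrows C f g)"

locale strict_monoidal_category =
  fixes C :: "('o, 'a, 'z) strict_moncat_scheme" (structure)
  assumes dom_obj: "f \<in> Arr C \<Longrightarrow> Dom C f \<in> Obj C"
    and cod_obj: "f \<in> Arr C \<Longrightarrow> Cod C f \<in> Obj C"
    and ide_hom: "X \<in> Obj C \<Longrightarrow> \<iota> X \<in> Hom X X"
    and comp_hom: "\<lbrakk>f \<in> Hom X Y; g \<in> Hom Y Z\<rbrakk> \<Longrightarrow> g \<cdot> f \<in> Hom X Z"
    and comp_ide: "f \<in> Hom X Y \<Longrightarrow> f \<cdot> \<iota> X = f"
    and ide_comp: "f \<in> Hom X Y \<Longrightarrow> \<iota> Y \<cdot> f = f"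
    and comp_assoc: "\<lbrakk>f \<in> Hom X Y; g \<in> Hom Y Z; h \<in> Hom Z W\<rbrakk> \<Longrightarrow> (h \<cdot> g) \<cdot> f = h \<cdot> (g \<cdot> f)"
    and tensor_obj: "\<lbrakk>X \<in> Obj C; Y \<in> Obj C\<rbrakk> \<Longrightarrow> X \<odot> Y \<in> Obj C"
    and tensor_hom: "\<lbrakk>f \<in> Hom X Y; g \<in> Hom X' Y'\<rbrakk> \<Longrightarrow> f \<otimes> g \<in> Hom (X \<odot> X') (Y \<odot> Y')"
    and tensor_ide: "\<lbrakk>X \<in> Obj C; Y \<in> Obj C\<rbrakk> \<Longrightarrow> \<iota> X \<otimes> \<iota> Y = \<iota> (X \<odot> Y)"
    and interchange: "\<lbrakk>f \<in> Hom X Y; g \<in> Hom Y Z; f' \<in> Hom X' Y'; g' \<in> Hom Y' Z'\<rbrakk>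
      \<Longrightarrow> (g \<cdot> f) \<otimes> (g' \<cdot> f') = (g \<otimes> g') \<cdot> (f \<otimes> f')"
    and unit_obj: "\<one> \<in> Obj C"
    and tensor_obj_assoc: "\<lbrakk>X \<in> Obj C; Y \<in> Obj C; Z \<in> Obj C\<rbrakk> \<Longrightarrow> (X \<odot> Y) \<odot> Z = X \<odot> (Y \<odot> Z)"
    and tensor_arr_assoc: "\<lbrakk>f \<in> Arr C; g \<in> Arr C; h \<in> Arr C\<rbrakk> \<Longrightarrow> (f \<otimes> g) \<otimes> h = f \<otimes> (g \<otimes> h)"
    and unit_tensor_obj: "X \<in> Obj C \<Longrightarrow> \<one> \<odot> X = X"
    and tensor_unit_obj: "X \<in> Obj C \<Longrightarrow> X \<odot> \<one> = X"
    and unit_tensor_arr: "f \<in> Arr C \<Longrightarrow> \<iota> \<one> \<otimes> f = f"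
    and tensor_unit_arr: "f \<in> Arr C \<Longrightarrow> f \<otimes> \<iota> \<one> = f"

locale braided_category = strict_monoidal_category C
  for C :: "('o, 'a, 'z) strict_moncat_scheme" (structure) +
  fixes \<Phi> :: "'o \<Rightarrow> 'o \<Rightarrow> 'a"
  assumes braid_hom: "\<lbrakk>X \<in> Obj C; Y \<in> Obj C\<rbrakk> \<Longrightarrow> \<Phi> X Y \<in> Hom (X \<odot> Y) (Y \<odot> X)"
    and braid_iso: "\<lbrakk>X \<in> Obj C; Y \<in> Obj C\<rbrakk> \<Longrightarrow> is_iso C (\<Phi> X Y)"
    and braid_natural: "\<lbrakk>f \<in> Hom X X'; g \<in> Hom Y Y'\<rbrakk>
      \<Longrightarrow> (g \<otimes> f) \<cdot> \<Phi> X Y = \<Phi> X' Y' \<cdot> (f \<otimes> g)"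
    and hexagon_left: "\<lbrakk>X \<in> Obj C; Y \<in> Obj C; Z \<in> Obj C\<rbrakk>
      \<Longrightarrow> \<Phi> (X \<odot> Y) Z = (\<Phi> X Z \<otimes> \<iota> Y) \<cdot> (\<iota> X \<otimes> \<Phi> Y Z)"
    and hexagon_right: "\<lbrakk>X \<in> Obj C; Y \<in> Obj C; Z \<in> Obj C\<rbrakk>
      \<Longrightarrow> \<Phi> X (Y \<odot> Z) = (\<iota> Y \<otimes> \<Phi> X Z) \<cdot> (\<Phi> X Y \<otimes> \<iota> Z)"

locale strict_braided_functor =
  fixes C :: "('o, 'a, 'z) strict_moncat_scheme" and \<Phi> :: "'o \<Rightarrow> 'o \<Rightarrow> 'a"
    and D :: "('p, 'b, 'y) strict_moncat_scheme" and \<Psi> :: "'p \<Rightarrow> 'p \<Rightarrow> 'b"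
    and Fo :: "'o \<Rightarrow> 'p" and Fa :: "'a \<Rightarrow> 'b"
  assumes map_obj: "X \<in> Obj C \<Longrightarrow> Fo X \<in> Obj D"
    and map_hom: "f \<in> Hom\<^bsub>C\<^esub> X Y \<Longrightarrow> Fa f \<in> Hom\<^bsub>D\<^esub> (Fo X) (Fo Y)"
    and map_ide: "X \<in> Obj C \<Longrightarrow> Fa (\<iota>\<^bsub>C\<^esub> X) = \<iota>\<^bsub>D\<^esub> (Fo X)"
    and map_comp: "\<lbrakk>f \<in> Hom\<^bsub>C\<^esub> X Y; g \<in> Hom\<^bsub>C\<^esub> Y Z\<rbrakk> \<Longrightarrow> Fa (g \<cdot>\<^bsub>C\<^esub> f) = Fa g \<cdot>\<^bsub>D\<^esub> Fa f"
    and map_unit: "Fo \<one>\<^bsub>C\<^esub> = \<one>\<^bsub>D\<^esub>"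
    and map_tensor_obj: "\<lbrakk>X \<in> Obj C; Y \<in> Obj C\<rbrakk> \<Longrightarrow> Fo (X \<odot>\<^bsub>C\<^esub> Y) = Fo X \<odot>\<^bsub>D\<^esub> Fo Y"
    and map_tensor_arr: "\<lbrakk>f \<in> Arr C; g \<in> Arr C\<rbrakk> \<Longrightarrow> Fa (f \<otimes>\<^bsub>C\<^esub> g) = Fa f \<otimes>\<^bsub>D\<^esub> Fa g"
    and map_braiding: "\<lbrakk>X \<in> Obj C; Y \<in> Obj C\<rbrakk> \<Longrightarrow> Fa (\<Phi> X Y) = \<Psi> (Fo X) (Fo Y)"

text \<open>
  All categories considered here are strict, so an isomorphism of braided monoidal categories is
  taken to preserve tensor products, units and braidings on the nose.
\<close>
definition isomorphic_braided_categories ::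
    "('o, 'a, 'z) strict_moncat_scheme \<Rightarrow> ('o \<Rightarrow> 'o \<Rightarrow> 'a) \<Rightarrow>
     ('p, 'b, 'y) strict_moncat_scheme \<Rightarrow> ('p \<Rightarrow> 'p \<Rightarrow> 'b) \<Rightarrow> bool"
  where "isomorphic_braided_categories C \<Phi> D \<Psi> \<longleftrightarrow>
    braided_category C \<Phi> \<and> braided_category D \<Psi> \<and>
    (\<exists>Fo Fa Go Ga.
      strict_braided_functor C \<Phi> D \<Psi> Fo Fa \<and> strict_braided_functor D \<Psi> C \<Phi> Go Ga \<and>
      (\<forall>X \<in> Obj C. Go (Fo X) = X) \<and> (\<forall>f \<in> Arr C. Ga (Fa f) = f) \<and>
      (\<forall>Y \<in> Obj D. Fo (Go Y) = Y) \<and> (\<forall>g \<in> Arr D. Fa (Ga g) = g))"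

text \<open>
  The category of objects of \<open>C\<close> with extra structure: \<open>U\<close> sends a structured object to its
  underlying object, \<open>objs\<close> is the set of structured objects, and \<open>homs P Q\<close> is the set of arrows
  of \<open>C\<close> that are morphisms from \<open>P\<close> to \<open>Q\<close>. An arrow is stored with its source and target, which
  the underlying arrow does not determine. Composition and tensor product of arrows are those of
  \<open>C\<close>; the tensor product of objects and the unit object are given.
\<close>
definition structured_category ::
    "('o, 'a, 'z) strict_moncat_scheme \<Rightarrow> ('p \<Rightarrow> 'o) \<Rightarrow> 'p set \<Rightarrow> ('p \<Rightarrow> 'p \<Rightarrow> 'a set) \<Rightarrow>
     ('p \<Rightarrow> 'p \<Rightarrow> 'p) \<Rightarrow> 'p \<Rightarrow> ('p, 'p \<times> 'a \<times> 'p) strict_moncat"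
  where "structured_category C U objs homs tens unit = \<lparr>
    Obj = objs,
    Arr = {(P, f, Q). P \<in> objs \<and> Q \<in> objs \<and> f \<in> homs P Q},
    Dom = (\<lambda>(P, f, Q). P),
    Cod = (\<lambda>(P, f, Q). Q),
    Ide = (\<lambda>P. (P, \<iota>\<^bsub>C\<^esub> (U P), P)),
    Comp = (\<lambda>(Q', g, R) (P, f, Q). (P, g \<cdot>\<^bsub>C\<^esub> f, R)),
    TensO = tens,
    TensA = (\<lambda>(P, f, Q) (P', f', Q'). (tens P P', f \<otimes>\<^bsub>C\<^esub> f', tens Q Q')),
    Unit = unit \<rparr>"

definition full_subcategory ::
    "('o, 'a, 'z) strict_moncat_scheme \<Rightarrow> 'o set \<Rightarrow> ('o, 'a, 'z) strict_moncat_scheme"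
  where "full_subcategory C S =
    C\<lparr>Obj := S, Arr := {f \<in> Arr C. Dom C f \<in> S \<and> Cod C f \<in> S}\<rparr>"


section \<open>The right center\<close>

text \<open>
  The half-braiding \<open>c\<^sub>X\<^sub>,\<^sub>V\<close> is \<open>c X\<close>. It is required to be extensional so that two
  half-braidings agreeing on all objects of \<open>D\<close> are equal. No unit axiom is imposed:
  \<open>c \<one> = \<iota> V\<close> follows from the hexagon and invertibility.
\<close>

context
  fixes D :: "('o, 'a, 'z) strict_moncat_scheme" (structure)
begin

definition half_braiding :: "'o \<Rightarrow> ('o \<Rightarrow> 'a) \<Rightarrow> bool"
  where "half_braiding V c \<longleftrightarrow>
    c \<in> extensional (Obj D) \<and>
    (\<forall>X \<in> Obj D. c X \<in> Hom (X \<odot> V) (V \<odot> X) \<and> is_iso D (c X)) \<and>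
    (\<forall>X \<in> Obj D. \<forall>Y \<in> Obj D. \<forall>f \<in> Hom X Y. (\<iota> V \<otimes> f) \<cdot> c X = c Y \<cdot> (f \<otimes> \<iota> V)) \<and>
    (\<forall>X \<in> Obj D. \<forall>Y \<in> Obj D. c (X \<odot> Y) = (c X \<otimes> \<iota> Y) \<cdot> (\<iota> X \<otimes> c Y))"

definition center_hom :: "'o \<times> ('o \<Rightarrow> 'a) \<Rightarrow> 'o \<times> ('o \<Rightarrow> 'a) \<Rightarrow> 'a set"
  where "center_hom = (\<lambda>(V, c) (W, d).
    {f \<in> Hom V W. \<forall>X \<in> Obj D. (f \<otimes> \<iota> X) \<cdot> c X = d X \<cdot> (\<iota> X \<otimes> f)})"

definition center_tensor :: "'o \<times> ('o \<Rightarrow> 'a) \<Rightarrow> 'o \<times> ('o \<Rightarrow> 'a) \<Rightarrow> 'o \<times> ('o \<Rightarrow> 'a)"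
  where "center_tensor = (\<lambda>(V, c) (W, d).
    (V \<odot> W, \<lambda>X \<in> Obj D. (\<iota> V \<otimes> d X) \<cdot> (c X \<otimes> \<iota> W)))"

definition right_center ::
    "('o \<times> ('o \<Rightarrow> 'a), ('o \<times> ('o \<Rightarrow> 'a)) \<times> 'a \<times> ('o \<times> ('o \<Rightarrow> 'a))) strict_moncat"
  where "right_center = structured_category D fst
    {(V, c). V \<in> Obj D \<and> half_braiding V c} center_hom center_tensor (\<one>, \<lambda>X \<in> Obj D. \<iota> X)"

definition center_braiding ::
    "'o \<times> ('o \<Rightarrow> 'a) \<Rightarrow> 'o \<times> ('o \<Rightarrow> 'a) \<Rightarrow> ('o \<times> ('o \<Rightarrow> 'a)) \<times> 'a \<times> ('o \<times> ('o \<Rightarrow> 'a))"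
  where "center_braiding = (\<lambda>(V, c) (W, d).
    (center_tensor (V, c) (W, d), d V, center_tensor (W, d) (V, c)))"

end


section \<open>Hopf algebras in braided categories\<close>

locale hopf_algebra = braided_category C \<Phi>
  for C :: "('o, 'a, 'z) strict_moncat_scheme" (structure) and \<Phi> :: "'o \<Rightarrow> 'o \<Rightarrow> 'a" +
  fixes H :: 'o and mult :: 'a ("\<nabla>") and \<eta> \<Delta> \<epsilon> S :: 'a
  assumes H_obj: "H \<in> Obj C"
    and mult_hom: "\<nabla> \<in> Hom (H \<odot> H) H"
    and unit_hom: "\<eta> \<in> Hom \<one> H"
    and comult_hom: "\<Delta> \<in> Hom H (H \<odot> H)"
    and counit_hom: "\<epsilon> \<in> Hom H \<one>"
    and antipode_hom: "S \<in> Hom H H"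
    and mult_assoc: "\<nabla> \<cdot> (\<nabla> \<otimes> \<iota> H) = \<nabla> \<cdot> (\<iota> H \<otimes> \<nabla>)"
    and mult_unit: "\<nabla> \<cdot> (\<eta> \<otimes> \<iota> H) = \<iota> H" "\<nabla> \<cdot> (\<iota> H \<otimes> \<eta>) = \<iota> H"
    and comult_coassoc: "(\<Delta> \<otimes> \<iota> H) \<cdot> \<Delta> = (\<iota> H \<otimes> \<Delta>) \<cdot> \<Delta>"
    and comult_counit: "(\<epsilon> \<otimes> \<iota> H) \<cdot> \<Delta> = \<iota> H" "(\<iota> H \<otimes> \<epsilon>) \<cdot> \<Delta> = \<iota> H"
    and comult_mult: "\<Delta> \<cdot> \<nabla> = (\<nabla> \<otimes> \<nabla>) \<cdot> (\<iota> H \<otimes> \<Phi> H H \<otimes> \<iota> H) \<cdot> (\<Delta> \<otimes> \<Delta>)"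
    and comult_unit: "\<Delta> \<cdot> \<eta> = \<eta> \<otimes> \<eta>"
    and counit_mult: "\<epsilon> \<cdot> \<nabla> = \<epsilon> \<otimes> \<epsilon>"
    and counit_unit: "\<epsilon> \<cdot> \<eta> = \<iota> \<one>"
    and antipode_left: "\<nabla> \<cdot> (S \<otimes> \<iota> H) \<cdot> \<Delta> = \<eta> \<cdot> \<epsilon>"
    and antipode_right: "\<nabla> \<cdot> (\<iota> H \<otimes> S) \<cdot> \<Delta> = \<eta> \<cdot> \<epsilon>"


section \<open>Modules and Yetter-Drinfel'd modules\<close>

type_synonym ('o, 'a) module_object = "'o \<times> 'a"
type_synonym ('o, 'a) module_arrow = "('o, 'a) module_object \<times> 'a \<times> ('o, 'a) module_object"
type_synonym ('o, 'a) center_object = "('o, 'a) module_object \<times> (('o, 'a) module_object \<Rightarrow> ('o, 'a) module_arrow)"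
type_synonym ('o, 'a) center_arrow =
  "('o, 'a) center_object \<times> ('o, 'a) module_arrow \<times> ('o, 'a) center_object"
type_synonym ('o, 'a) yd_module = "'o \<times> 'a \<times> 'a"
type_synonym ('o, 'a) yd_arrow = "('o, 'a) yd_module \<times> 'a \<times> ('o, 'a) yd_module"

context
  fixes C :: "('o, 'a, 'z) strict_moncat_scheme" (structure)
    and \<Phi> :: "'o \<Rightarrow> 'o \<Rightarrow> 'a"
    and H :: 'o and mult :: 'a ("\<nabla>") and \<eta> \<Delta> \<epsilon> :: 'a
begin

definition left_module :: "'o \<Rightarrow> 'a \<Rightarrow> bool"
  where "left_module M \<mu> \<longleftrightarrow>
    M \<in> Obj C \<and> \<mu> \<in> Hom (H \<odot> M) M \<and>
    \<mu> \<cdot> (\<iota> H \<otimes> \<mu>) = \<mu> \<cdot> (\<nabla> \<otimes> \<iota> M) \<and> \<mu> \<cdot> (\<eta> \<otimes> \<iota> M) = \<iota> M"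

definition left_linear :: "'a \<Rightarrow> 'a \<Rightarrow> 'a \<Rightarrow> bool"
  where "left_linear \<mu> \<nu> f \<longleftrightarrow> f \<cdot> \<mu> = \<nu> \<cdot> (\<iota> H \<otimes> f)"

definition tensor_action :: "'o \<Rightarrow> 'a \<Rightarrow> 'o \<Rightarrow> 'a \<Rightarrow> 'a"
  where "tensor_action M \<mu> N \<nu> =
    (\<mu> \<otimes> \<nu>) \<cdot> (\<iota> H \<otimes> \<Phi> H M \<otimes> \<iota> N) \<cdot> (\<Delta> \<otimes> \<iota> M \<otimes> \<iota> N)"

definition module_category :: "(('o, 'a) module_object, ('o, 'a) module_arrow) strict_moncat"
  where "module_category = structured_category C fst
    {(M, \<mu>). left_module M \<mu>}
    (\<lambda>(M, \<mu>) (N, \<nu>). {f \<in> Hom M N. left_linear \<mu> \<nu> f})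
    (\<lambda>(M, \<mu>) (N, \<nu>). (M \<odot> N, tensor_action M \<mu> N \<nu>))
    (\<one>, \<epsilon>)"

definition trivial_module :: "'o \<Rightarrow> ('o, 'a) module_object"
  where "trivial_module X = (X, \<epsilon> \<otimes> \<iota> X)"

text \<open>
  The condition \<open>c\<^sub>X\<^sub>,\<^sub>V = \<Phi>\<^sub>X\<^sub>,\<^sub>V\<close> is an equation between morphisms of \<open>H\<close>-modules, hence the
  source and target of \<open>\<Phi> X (fst V)\<close> are spelled out.
\<close>
definition relative_center :: "(('o, 'a) center_object, ('o, 'a) center_arrow) strict_moncat"
  where "relative_center = full_subcategory (right_center module_category)
    {(V, c). (V, c) \<in> Obj (right_center module_category) \<and>
      (\<forall>X \<in> Obj C. c (trivial_module X) =
        (trivial_module X \<odot>\<^bsub>module_category\<^esub> V, \<Phi> X (fst V), V \<odot>\<^bsub>module_category\<^esub> trivial_module X))}"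

definition right_comodule :: "'o \<Rightarrow> 'a \<Rightarrow> bool"
  where "right_comodule M \<rho> \<longleftrightarrow>
    M \<in> Obj C \<and> \<rho> \<in> Hom M (M \<odot> H) \<and>
    (\<rho> \<otimes> \<iota> H) \<cdot> \<rho> = (\<iota> M \<otimes> \<Delta>) \<cdot> \<rho> \<and> (\<iota> M \<otimes> \<epsilon>) \<cdot> \<rho> = \<iota> M"

definition right_colinear :: "'a \<Rightarrow> 'a \<Rightarrow> 'a \<Rightarrow> bool"
  where "right_colinear \<rho> \<sigma> f \<longleftrightarrow> \<sigma> \<cdot> f = (f \<otimes> \<iota> H) \<cdot> \<rho>"

definition yetter_drinfeld_module :: "'o \<Rightarrow> 'a \<Rightarrow> 'a \<Rightarrow> bool"
  where "yetter_drinfeld_module M \<mu> \<rho> \<longleftrightarrow>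
    left_module M \<mu> \<and> right_comodule M \<rho> \<and>
    (\<iota> M \<otimes> \<nabla>) \<cdot> (\<rho> \<otimes> \<iota> H) \<cdot> inv_arrow C (\<Phi> M H) \<cdot> (\<iota> H \<otimes> \<mu>) \<cdot> (\<Delta> \<otimes> \<iota> M)
      = (\<mu> \<otimes> \<nabla>) \<cdot> (\<iota> H \<otimes> \<Phi> H M \<otimes> \<iota> H) \<cdot> (\<Delta> \<otimes> \<rho>)"

definition tensor_coaction :: "'o \<Rightarrow> 'a \<Rightarrow> 'o \<Rightarrow> 'a \<Rightarrow> 'a"
  where "tensor_coaction M \<rho> N \<sigma> =
    (\<iota> M \<otimes> \<iota> N \<otimes> (\<nabla> \<cdot> \<Phi> H H)) \<cdot> (\<iota> M \<otimes> \<Phi> H N \<otimes> \<iota> H) \<cdot> (\<rho> \<otimes> \<sigma>)"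

definition yd_tensor :: "('o, 'a) yd_module \<Rightarrow> ('o, 'a) yd_module \<Rightarrow> ('o, 'a) yd_module"
  where "yd_tensor = (\<lambda>(M, \<mu>, \<rho>) (N, \<nu>, \<sigma>).
    (M \<odot> N, tensor_action M \<mu> N \<nu>, tensor_coaction M \<rho> N \<sigma>))"

definition yd_category :: "(('o, 'a) yd_module, ('o, 'a) yd_arrow) strict_moncat"
  where "yd_category = structured_category C fst
    {(M, \<mu>, \<rho>). yetter_drinfeld_module M \<mu> \<rho>}
    (\<lambda>(M, \<mu>, \<rho>) (N, \<nu>, \<sigma>). {f \<in> Hom M N. left_linear \<mu> \<nu> f \<and> right_colinear \<rho> \<sigma> f})
    yd_tensor
    (\<one>, \<epsilon>, \<eta>)"

definition yd_braiding :: "('o, 'a) yd_module \<Rightarrow> ('o, 'a) yd_module \<Rightarrow> ('o, 'a) yd_arrow"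
  where "yd_braiding = (\<lambda>(M, \<mu>, \<rho>) (N, \<nu>, \<sigma>).
    (yd_tensor (M, \<mu>, \<rho>) (N, \<nu>, \<sigma>),
     (\<iota> N \<otimes> \<mu>) \<cdot> (\<sigma> \<otimes> \<iota> M) \<cdot> \<Phi> M N,
     yd_tensor (N, \<nu>, \<sigma>) (M, \<mu>, \<rho>)))"

end

end

theory Submission
  imports Defs
begin

text \<open>
  For an object \<open>(V, c)\<close> of the relative center, evaluating \<open>c\<close> on the regular module and composing with
  the unit of \<open>H\<close> gives a coaction \<open>\<rho> = c\<^sub>H (\<eta> \<otimes> V)\<close>. The action \<open>H \<otimes> X \<rightarrow> X\<close> is \<open>H\<close>-linear from the
  regular module tensored with the trivial module \<open>X\<close>, so naturality and \<open>c = \<Phi>\<close> on trivial modules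
  force \<open>c\<^sub>X = (V \<otimes> \<nu>\<^sub>X)(\<rho> \<otimes> X) \<Phi>\<^sub>X\<^sub>,\<^sub>V\<close>. Conversely this formula defines a half-braiding: its
  multiplicativity is coassociativity of \<open>\<rho>\<close> (this uses \<open>\<Phi>\<^sub>H\<^sub>,\<^sub>X = \<Phi>\<^sub>X\<^sub>,\<^sub>H\<^sup>-\<^sup>1\<close>), its inverse comes from the
  antipode, and its linearity for all \<open>X\<close> is equivalent to linearity for \<open>X = H\<close>, which is the
  Yetter-Drinfel'd condition.
\<close>

section \<open>Calculus in strict monoidal categories\<close>

text \<open>Both sides of the isomorphism must be braided categories. For Yetter-Drinfel'd modules
  this comes by transport: the right center is braided for formal reasons, the relative center is
  closed under its tensor product, and the bijection carries the laws over. The one computation with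
  the tensor coaction compares it with \<open>c\<close> on a tensor product; there the coaction leg
  of the second factor multiplies that of the first from the left, whence the opposite
  multiplication. The regular module suffices as a test object because its product with a trivial
  module on \<open>X\<close> is free on \<open>X\<close>, and the unit splits the action of that
  free module onto \<open>X\<close>. The hypothesis on \<open>\<Phi>\<close> is also needed for
  linearity: moving \<open>X\<close> past a coaction creates a crossing with \<open>H\<close>, which
  must be inverse to the crossing built into the diagonal action. The calculations are string
  diagrams written as terms. Formulas such as \<open>h_1 m \<otimes> h_2\<close> in the comments are
  Sweedler shorthand for diagrams, with crossings suppressed.\<close>

context strict_monoidal_category
begin

text \<open>Simp can compute the boundary of a composite through \<open>Dom\<close> and
  \<open>Cod\<close>, but it cannot guess the middle object in axioms phrased with
  \<open>Hom\<close>; hence the calculus is restated in terms of the former.\<close>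

lemma hom_iff: "f \<in> Hom X Y \<longleftrightarrow> f \<in> Arr C \<and> Dom C f = X \<and> Cod C f = Y"
  by (simp add: Hom_def)

lemma arr_ide [simp]: "X \<in> Obj C \<Longrightarrow> \<iota> X \<in> Arr C"
  and dom_ide [simp]: "X \<in> Obj C \<Longrightarrow> Dom C (\<iota> X) = X"
  and cod_ide [simp]: "X \<in> Obj C \<Longrightarrow> Cod C (\<iota> X) = X"
  using ide_hom by (auto simp: hom_iff)

lemma arr_comp [simp]: "\<lbrakk>f \<in> Arr C; g \<in> Arr C; Dom C g = Cod C f\<rbrakk> \<Longrightarrow> g \<cdot> f \<in> Arr C"
  and dom_comp [simp]: "\<lbrakk>f \<in> Arr C; g \<in> Arr C; Dom C g = Cod C f\<rbrakk> \<Longrightarrow> Dom C (g \<cdot> f) = Dom C f"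
  and cod_comp [simp]: "\<lbrakk>f \<in> Arr C; g \<in> Arr C; Dom C g = Cod C f\<rbrakk> \<Longrightarrow> Cod C (g \<cdot> f) = Cod C g"
  using comp_hom by (auto simp: hom_iff)

lemma arr_tensor [simp]: "\<lbrakk>f \<in> Arr C; g \<in> Arr C\<rbrakk> \<Longrightarrow> f \<otimes> g \<in> Arr C"
  and dom_tensor [simp]: "\<lbrakk>f \<in> Arr C; g \<in> Arr C\<rbrakk> \<Longrightarrow> Dom C (f \<otimes> g) = Dom C f \<odot> Dom C g"
  and cod_tensor [simp]: "\<lbrakk>f \<in> Arr C; g \<in> Arr C\<rbrakk> \<Longrightarrow> Cod C (f \<otimes> g) = Cod C f \<odot> Cod C g"
  using tensor_hom by (auto simp: hom_iff)

lemmas obj_simps [simp] = dom_obj cod_obj tensor_obj unit_obj tensor_obj_assoc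
  unit_tensor_obj tensor_unit_obj unit_tensor_arr tensor_unit_arr tensor_arr_assoc

lemma comp_assoc_arr [simp]:
  "\<lbrakk>f \<in> Arr C; g \<in> Arr C; h \<in> Arr C; Dom C g = Cod C f; Dom C h = Cod C g\<rbrakk>
    \<Longrightarrow> (h \<cdot> g) \<cdot> f = h \<cdot> g \<cdot> f"
  using comp_assoc by (auto simp: hom_iff)

text \<open>Reversing \<open>tensor_ide\<close> fixes a normal form in which every strand carries
  its own identity, so that interchange applies at any cut. The price is that the identity laws
  below must cover tensor products of up to four identities.\<close>

lemma ide_tensor [simp]: "\<lbrakk>X \<in> Obj C; Y \<in> Obj C\<rbrakk> \<Longrightarrow> \<iota> (X \<odot> Y) = \<iota> X \<otimes> \<iota> Y"
  by (simp add: tensor_ide)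

lemma comp_ide_arr [simp]:
  "\<lbrakk>f \<in> Arr C; Dom C f = X\<rbrakk> \<Longrightarrow> f \<cdot> \<iota> X = f"
  "\<lbrakk>f \<in> Arr C; X \<in> Obj C; Y \<in> Obj C; Dom C f = X \<odot> Y\<rbrakk> \<Longrightarrow> f \<cdot> (\<iota> X \<otimes> \<iota> Y) = f"
  "\<lbrakk>f \<in> Arr C; X \<in> Obj C; Y \<in> Obj C; Z \<in> Obj C; Dom C f = X \<odot> Y \<odot> Z\<rbrakk>
    \<Longrightarrow> f \<cdot> (\<iota> X \<otimes> \<iota> Y \<otimes> \<iota> Z) = f"
  "\<lbrakk>f \<in> Arr C; X \<in> Obj C; Y \<in> Obj C; Z \<in> Obj C; W \<in> Obj C; Dom C f = X \<odot> Y \<odot> Z \<odot> W\<rbrakk>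
    \<Longrightarrow> f \<cdot> (\<iota> X \<otimes> \<iota> Y \<otimes> \<iota> Z \<otimes> \<iota> W) = f"
  using comp_ide by (auto simp: hom_iff tensor_ide simp del: ide_tensor) metis+

lemma ide_comp_arr [simp]:
  "\<lbrakk>f \<in> Arr C; Cod C f = X\<rbrakk> \<Longrightarrow> \<iota> X \<cdot> f = f"
  "\<lbrakk>f \<in> Arr C; X \<in> Obj C; Y \<in> Obj C; Cod C f = X \<odot> Y\<rbrakk> \<Longrightarrow> (\<iota> X \<otimes> \<iota> Y) \<cdot> f = f"
  "\<lbrakk>f \<in> Arr C; X \<in> Obj C; Y \<in> Obj C; Z \<in> Obj C; Cod C f = X \<odot> Y \<odot> Z\<rbrakk>
    \<Longrightarrow> (\<iota> X \<otimes> \<iota> Y \<otimes> \<iota> Z) \<cdot> f = f"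
  "\<lbrakk>f \<in> Arr C; X \<in> Obj C; Y \<in> Obj C; Z \<in> Obj C; W \<in> Obj C; Cod C f = X \<odot> Y \<odot> Z \<odot> W\<rbrakk>
    \<Longrightarrow> (\<iota> X \<otimes> \<iota> Y \<otimes> \<iota> Z \<otimes> \<iota> W) \<cdot> f = f"
  using ide_comp by (auto simp: hom_iff tensor_ide simp del: ide_tensor) metis+

lemma comp_tensor:
  "\<lbrakk>f \<in> Arr C; g \<in> Arr C; f' \<in> Arr C; g' \<in> Arr C; Dom C g = Cod C f; Dom C g' = Cod C f'\<rbrakk>
    \<Longrightarrow> (g \<otimes> g') \<cdot> (f \<otimes> f') = (g \<cdot> f) \<otimes> (g' \<cdot> f')"
  using interchange by (auto simp: hom_iff)

text \<open>Right-associated tensor products hide the cuts that \<open>comp_tensor\<close> needs; the following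
  variants cut after two factors on one of the two sides.\<close>

lemma comp_tensor_left2:
  "\<lbrakk>f \<in> Arr C; a \<in> Arr C; b \<in> Arr C; f' \<in> Arr C; g' \<in> Arr C;
    Dom C a \<odot> Dom C b = Cod C f; Dom C g' = Cod C f'\<rbrakk>
    \<Longrightarrow> (a \<otimes> b \<otimes> g') \<cdot> (f \<otimes> f') = ((a \<otimes> b) \<cdot> f) \<otimes> (g' \<cdot> f')"
  using comp_tensor[of f "a \<otimes> b" f' g'] by simp

lemma comp_tensor_right2:
  "\<lbrakk>g \<in> Arr C; a \<in> Arr C; b \<in> Arr C; f' \<in> Arr C; g' \<in> Arr C;
    Dom C g = Cod C a \<odot> Cod C b; Dom C g' = Cod C f'\<rbrakk>
    \<Longrightarrow> (g \<otimes> g') \<cdot> (a \<otimes> b \<otimes> f') = (g \<cdot> (a \<otimes> b)) \<otimes> (g' \<cdot> f')"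
  using comp_tensor[of "a \<otimes> b" g f' g'] by simp

lemmas merge_tensors = comp_tensor comp_tensor_left2 comp_tensor_right2

text \<open>Compositions are normalised to the right, so an equation for \<open>g \<cdot> f\<close>
  no longer matches once an arrow \<open>h\<close> precedes \<open>f\<close>. This closes the
  equation under such tails; many numbered facts of the later proofs are rewrite rules of this
  kind.\<close>

lemma comp_reduce:
  "\<lbrakk>g \<cdot> f = k; h \<in> Arr C; f \<in> Arr C; g \<in> Arr C; Dom C g = Cod C f; Dom C f = Cod C h\<rbrakk>
    \<Longrightarrow> g \<cdot> f \<cdot> h = k \<cdot> h"
  using comp_assoc_arr by metis

lemma whisker_left:
  "\<lbrakk>X \<in> Obj C; f \<in> Arr C; g \<in> Arr C; Dom C g = Cod C f\<rbrakk>
    \<Longrightarrow> \<iota> X \<otimes> (g \<cdot> f) = (\<iota> X \<otimes> g) \<cdot> (\<iota> X \<otimes> f)"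
  by (simp add: comp_tensor)

lemma whisker_right:
  "\<lbrakk>X \<in> Obj C; f \<in> Arr C; g \<in> Arr C; Dom C g = Cod C f\<rbrakk>
    \<Longrightarrow> (g \<cdot> f) \<otimes> \<iota> X = (g \<otimes> \<iota> X) \<cdot> (f \<otimes> \<iota> X)"
  by (simp add: comp_tensor)

text \<open>Arrows on disjoint strands commute. The four boundary objects are separate variables, so
  that an instance with boundary \<open>\<one>\<close> or a tensor product can be given in
  simplified form.\<close>

lemma slide:
  "\<lbrakk>f \<in> Arr C; g \<in> Arr C; Dom C f = X; Cod C f = Y; Dom C g = Z; Cod C g = W\<rbrakk>
    \<Longrightarrow> (\<iota> Y \<otimes> g) \<cdot> (f \<otimes> \<iota> Z) = (f \<otimes> \<iota> W) \<cdot> (\<iota> X \<otimes> g)"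
  by (auto simp: comp_tensor)

section \<open>Inverses and isomorphisms\<close>

lemma inverse_arrows_unique:
  assumes "inverse_arrows C f g" "inverse_arrows C f h"
  shows "g = h"
proof -
  have g: "f \<in> Hom (Dom C f) (Cod C f)" "g \<in> Hom (Cod C f) (Dom C f)" "g \<cdot> f = \<iota> (Dom C f)"
    "f \<cdot> g = \<iota> (Cod C f)"
    and h: "h \<in> Hom (Cod C f) (Dom C f)" "h \<cdot> f = \<iota> (Dom C f)"
    using assms by (auto simp: inverse_arrows_def hom_iff)
  have "g = (h \<cdot> f) \<cdot> g" using g h by (simp add: ide_comp del: comp_assoc_arr)
  also have "\<dots> = h \<cdot> f \<cdot> g" using comp_assoc[OF g(2,1) h(1)] .
  also have "\<dots> = h" using g h by (simp add: comp_ide)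
  finally show ?thesis .
qed

lemma inverse_arrows_inv: "is_iso C f \<Longrightarrow> inverse_arrows C f (inv_arrow C f)"
  unfolding is_iso_def inv_arrow_def by (metis theI inverse_arrows_unique)

lemma is_isoI:
  "\<lbrakk>f \<in> Hom X Y; g \<in> Hom Y X; g \<cdot> f = \<iota> X; f \<cdot> g = \<iota> Y\<rbrakk> \<Longrightarrow> is_iso C f"
  by (auto simp: is_iso_def inverse_arrows_def hom_iff)

lemma is_isoE:
  assumes "is_iso C f" "f \<in> Hom X Y"
  obtains g where "g \<in> Hom Y X" "g \<cdot> f = \<iota> X" "f \<cdot> g = \<iota> Y"
  using assms by (auto simp: is_iso_def inverse_arrows_def hom_iff)

lemma is_iso_ide: "X \<in> Obj C \<Longrightarrow> is_iso C (\<iota> X)"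
  by (rule is_isoI[of _ X X "\<iota> X"]) (auto simp: hom_iff)

lemma is_iso_comp:
  assumes "is_iso C f" "is_iso C g" "f \<in> Hom X Y" "g \<in> Hom Y Z"
  shows "is_iso C (g \<cdot> f)"
proof -
  obtain f' where f': "f' \<in> Hom Y X" "f' \<cdot> f = \<iota> X" "f \<cdot> f' = \<iota> Y"
    using assms is_isoE by blast
  obtain g' where g': "g' \<in> Hom Z Y" "g' \<cdot> g = \<iota> Y" "g \<cdot> g' = \<iota> Z"
    using assms is_isoE by blast
  have "(f' \<cdot> g') \<cdot> (g \<cdot> f) = f' \<cdot> ((g' \<cdot> g) \<cdot> f)" "(g \<cdot> f) \<cdot> (f' \<cdot> g') = g \<cdot> ((f \<cdot> f') \<cdot> g')"
    using assms f'(1) g'(1) by (auto simp: hom_iff)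
  then show ?thesis
    using assms f' g' by (intro is_isoI[of _ X Z "f' \<cdot> g'"]) (auto simp: hom_iff)
qed

lemma is_iso_tensor:
  assumes "is_iso C f" "is_iso C g" "f \<in> Hom X Y" "g \<in> Hom Z W"
  shows "is_iso C (f \<otimes> g)"
proof -
  obtain f' where f': "f' \<in> Hom Y X" "f' \<cdot> f = \<iota> X" "f \<cdot> f' = \<iota> Y"
    using assms is_isoE by blast
  obtain g' where g': "g' \<in> Hom W Z" "g' \<cdot> g = \<iota> Z" "g \<cdot> g' = \<iota> W"
    using assms is_isoE by blast
  show ?thesis
    using assms f' g'
    by (intro is_isoI[of _ "X \<odot> Z" "Y \<odot> W" "f' \<otimes> g'"]) (auto simp: hom_iff comp_tensor)
qed

text \<open>One factor cancels against the inverse. This yields unit laws from hexagons: at the unit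
  object a hexagon reads \<open>f = f \<cdot> f\<close>.\<close>

lemma idempotent_iso_ide:
  assumes "is_iso C f" "f \<in> Hom X X" "f \<cdot> f = f"
  shows "f = \<iota> X"
proof -
  obtain g where g: "g \<in> Hom X X" "g \<cdot> f = \<iota> X" "f \<cdot> g = \<iota> X"
    using assms is_isoE by blast
  have "f = (g \<cdot> f) \<cdot> f" using assms g by (simp add: ide_comp del: comp_assoc_arr)
  also have "\<dots> = g \<cdot> f \<cdot> f" using comp_assoc[OF assms(2,2) g(1)] .
  also have "\<dots> = \<iota> X" using assms(3) g(2) by simp
  finally show ?thesis .
qed

end

context braided_category
begin

lemma arr_braid [simp]: "\<lbrakk>X \<in> Obj C; Y \<in> Obj C\<rbrakk> \<Longrightarrow> \<Phi> X Y \<in> Arr C"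
  and dom_braid [simp]: "\<lbrakk>X \<in> Obj C; Y \<in> Obj C\<rbrakk> \<Longrightarrow> Dom C (\<Phi> X Y) = X \<odot> Y"
  and cod_braid [simp]: "\<lbrakk>X \<in> Obj C; Y \<in> Obj C\<rbrakk> \<Longrightarrow> Cod C (\<Phi> X Y) = Y \<odot> X"
  using braid_hom by (auto simp: hom_iff)

lemma braid_unit_right [simp]: "X \<in> Obj C \<Longrightarrow> \<Phi> X \<one> = \<iota> X"
  using hexagon_right[of X \<one> \<one>]
  by (intro idempotent_iso_ide) (auto simp: braid_iso hom_iff)

lemma braid_unit_left [simp]: "X \<in> Obj C \<Longrightarrow> \<Phi> \<one> X = \<iota> X"
  using hexagon_left[of \<one> \<one> X]
  by (intro idempotent_iso_ide) (auto simp: braid_iso hom_iff)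

lemma braid_natural_right:
  "\<lbrakk>X \<in> Obj C; f \<in> Arr C; Dom C f = Y; Cod C f = Z\<rbrakk>
    \<Longrightarrow> (f \<otimes> \<iota> X) \<cdot> \<Phi> X Y = \<Phi> X Z \<cdot> (\<iota> X \<otimes> f)"
  by (rule braid_natural) (auto simp: hom_iff)

lemma braid_natural_left:
  "\<lbrakk>X \<in> Obj C; f \<in> Arr C; Dom C f = Y; Cod C f = Z\<rbrakk>
    \<Longrightarrow> (\<iota> X \<otimes> f) \<cdot> \<Phi> Y X = \<Phi> Z X \<cdot> (f \<otimes> \<iota> X)"
  by (rule braid_natural) (auto simp: hom_iff)

end

section \<open>Categories of objects with structure\<close>

lemma Hom_structured_category [simp]:
  "x \<in> Hom\<^bsub>structured_category C U objs homs tens unit\<^esub> P Q \<longleftrightarrow>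
    (\<exists>f. x = (P, f, Q) \<and> P \<in> objs \<and> Q \<in> objs \<and> f \<in> homs P Q)"
  by (auto simp: structured_category_def Hom_def)

lemma structured_category_simps [simp]:
  "Obj (structured_category C U objs homs tens unit) = objs"
  "(P, f, Q) \<in> Arr (structured_category C U objs homs tens unit) \<longleftrightarrow>
    P \<in> objs \<and> Q \<in> objs \<and> f \<in> homs P Q"
  "Dom (structured_category C U objs homs tens unit) (P, f, Q) = P"
  "Cod (structured_category C U objs homs tens unit) (P, f, Q) = Q"
  "Ide (structured_category C U objs homs tens unit) P = (P, \<iota>\<^bsub>C\<^esub> (U P), P)"
  "(Q', g, R) \<cdot>\<^bsub>structured_category C U objs homs tens unit\<^esub> (P, f, Q) = (P, g \<cdot>\<^bsub>C\<^esub> f, R)"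
  "TensO (structured_category C U objs homs tens unit) = tens"
  "(P, f, Q) \<otimes>\<^bsub>structured_category C U objs homs tens unit\<^esub> (P', f', Q') =
    (tens P P', f \<otimes>\<^bsub>C\<^esub> f', tens Q Q')"
  "\<one>\<^bsub>structured_category C U objs homs tens unit\<^esub> = unit"
  by (auto simp: structured_category_def)

lemma Arr_structured_categoryE:
  assumes "x \<in> Arr (structured_category C U objs homs tens unit)"
  obtains P f Q where "x = (P, f, Q)" "P \<in> objs" "Q \<in> objs" "f \<in> homs P Q"
  using assms by (auto simp: structured_category_def)

text \<open>Equations between arrows are inherited from \<open>C\<close>, since an arrow is its
  underlying arrow with its endpoints. To be supplied are closure of \<open>objs\<close> and
  \<open>homs\<close> and the strict laws for \<open>tens\<close>, which are equations between
  structured objects.\<close>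

lemma (in strict_monoidal_category) strict_monoidal_structured_category:
  assumes U: "\<And>P. P \<in> objs \<Longrightarrow> U P \<in> Obj C"
    and homs: "\<And>P Q f. \<lbrakk>P \<in> objs; Q \<in> objs; f \<in> homs P Q\<rbrakk> \<Longrightarrow> f \<in> Hom (U P) (U Q)"
    and ide: "\<And>P. P \<in> objs \<Longrightarrow> \<iota> (U P) \<in> homs P P"
    and comp: "\<And>P Q R f g. \<lbrakk>P \<in> objs; Q \<in> objs; R \<in> objs; f \<in> homs P Q; g \<in> homs Q R\<rbrakk>
      \<Longrightarrow> g \<cdot> f \<in> homs P R"
    and tens: "\<And>P Q. \<lbrakk>P \<in> objs; Q \<in> objs\<rbrakk> \<Longrightarrow> tens P Q \<in> objs"
    and U_tens: "\<And>P Q. \<lbrakk>P \<in> objs; Q \<in> objs\<rbrakk> \<Longrightarrow> U (tens P Q) = U P \<odot> U Q"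
    and tens_homs: "\<And>P Q P' Q' f g.
      \<lbrakk>P \<in> objs; Q \<in> objs; P' \<in> objs; Q' \<in> objs; f \<in> homs P Q; g \<in> homs P' Q'\<rbrakk>
      \<Longrightarrow> f \<otimes> g \<in> homs (tens P P') (tens Q Q')"
    and assoc: "\<And>P Q R. \<lbrakk>P \<in> objs; Q \<in> objs; R \<in> objs\<rbrakk>
      \<Longrightarrow> tens (tens P Q) R = tens P (tens Q R)"
    and unit: "unit \<in> objs" "U unit = \<one>"
    and unit_tens: "\<And>P. P \<in> objs \<Longrightarrow> tens unit P = P"
    and tens_unit: "\<And>P. P \<in> objs \<Longrightarrow> tens P unit = P"
  shows "strict_monoidal_category (structured_category C U objs homs tens unit)" (is "_ ?S")
proof -
  have homsD: "f \<in> Arr C" "Dom C f = U P" "Cod C f = U Q"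
    if "P \<in> objs" "Q \<in> objs" "f \<in> homs P Q" for P Q f
    using homs[OF that] by (auto simp: hom_iff)
  show ?thesis
    by unfold_locales
      (auto simp: homsD U ide comp tens U_tens tens_homs assoc unit unit_tens tens_unit comp_tensor
        elim!: Arr_structured_categoryE)
qed

lemma (in strict_monoidal_category) is_iso_structured_category:
  assumes "f \<in> homs P Q" "g \<in> homs Q P" "P \<in> objs" "Q \<in> objs"
    and "g \<cdot> f = \<iota> (U P)" "f \<cdot> g = \<iota> (U Q)"
  shows "is_iso (structured_category C U objs homs tens unit) (P, f, Q)"
  unfolding is_iso_def inverse_arrows_def
  using assms by (intro exI[of _ "(Q, g, P)"]) simp

section \<open>The right center\<close>

context strict_monoidal_category
begin

lemma half_braidingD:
  assumes "half_braiding C V c" "X \<in> Obj C"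
  shows "c X \<in> Arr C" "Dom C (c X) = X \<odot> V" "Cod C (c X) = V \<odot> X" "is_iso C (c X)"
  using assms by (simp_all add: half_braiding_def hom_iff)

lemma half_braiding_natural:
  assumes "half_braiding C V c" "f \<in> Arr C" "Dom C f = X" "Cod C f = Y"
  shows "(\<iota> V \<otimes> f) \<cdot> c X = c Y \<cdot> (f \<otimes> \<iota> V)"
  using assms dom_obj[of f] cod_obj[of f] by (simp add: half_braiding_def hom_iff)

lemma half_braiding_tensor:
  assumes "half_braiding C V c" "X \<in> Obj C" "Y \<in> Obj C"
  shows "c (X \<odot> Y) = (c X \<otimes> \<iota> Y) \<cdot> (\<iota> X \<otimes> c Y)"
  using assms by (simp add: half_braiding_def)

text \<open>Naturality and invertibility pass through the two factors one after the other.
  Multiplicativity needs an interchange of \<open>c X\<close> with \<open>d Y\<close>, which act on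
  disjoint strands.\<close>

lemma half_braiding_center_tensor:
  assumes c: "half_braiding C V c" and d: "half_braiding C W d" and V: "V \<in> Obj C" and W: "W \<in> Obj C"
  shows "half_braiding C (V \<odot> W) (\<lambda>X \<in> Obj C. (\<iota> V \<otimes> d X) \<cdot> (c X \<otimes> \<iota> W))"
  unfolding half_braiding_def
proof (intro conjI ballI)
  note [simp] = half_braidingD[OF c] half_braidingD[OF d] V W
  fix X assume X [simp]: "X \<in> Obj C"
  show "(\<lambda>X \<in> Obj C. (\<iota> V \<otimes> d X) \<cdot> (c X \<otimes> \<iota> W)) X \<in> Hom (X \<odot> V \<odot> W) ((V \<odot> W) \<odot> X)"
    by (simp add: hom_iff)
  show "is_iso C ((\<lambda>X \<in> Obj C. (\<iota> V \<otimes> d X) \<cdot> (c X \<otimes> \<iota> W)) X)"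
    by (simp add: hom_iff is_iso_ide is_iso_comp[of _ _ "X \<odot> V \<odot> W" "V \<odot> X \<odot> W" "V \<odot> W \<odot> X"]
        is_iso_tensor[of "c X" _ "X \<odot> V" "V \<odot> X" W W] is_iso_tensor[of _ "d X" V V "X \<odot> W" "W \<odot> X"])
  fix Y assume Y [simp]: "Y \<in> Obj C"
  have "c (X \<odot> Y) \<otimes> \<iota> W = (c X \<otimes> \<iota> Y \<otimes> \<iota> W) \<cdot> (\<iota> X \<otimes> c Y \<otimes> \<iota> W)"
    "\<iota> V \<otimes> d (X \<odot> Y) = (\<iota> V \<otimes> d X \<otimes> \<iota> Y) \<cdot> (\<iota> V \<otimes> \<iota> X \<otimes> d Y)"
    by (simp_all add: half_braiding_tensor[OF c] half_braiding_tensor[OF d] whisker_left whisker_right)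
  moreover have "(\<iota> V \<otimes> \<iota> X \<otimes> d Y) \<cdot> (c X \<otimes> \<iota> Y \<otimes> \<iota> W) = (c X \<otimes> \<iota> W \<otimes> \<iota> Y) \<cdot> (\<iota> X \<otimes> \<iota> V \<otimes> d Y)"
    by (simp add: comp_tensor_left2 comp_tensor_right2)
  note comp_reduce[OF this]
  ultimately show "(\<lambda>X \<in> Obj C. (\<iota> V \<otimes> d X) \<cdot> (c X \<otimes> \<iota> W)) (X \<odot> Y) =
      ((\<lambda>X \<in> Obj C. (\<iota> V \<otimes> d X) \<cdot> (c X \<otimes> \<iota> W)) X \<otimes> \<iota> Y) \<cdot>
      (\<iota> X \<otimes> (\<lambda>X \<in> Obj C. (\<iota> V \<otimes> d X) \<cdot> (c X \<otimes> \<iota> W)) Y)"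
    by (simp add: whisker_left whisker_right)
next
  note [simp] = half_braidingD[OF c] half_braidingD[OF d] V W
  fix X Y f assume X [simp]: "X \<in> Obj C" and Y [simp]: "Y \<in> Obj C" and "f \<in> Hom X Y"
  then have f [simp]: "f \<in> Arr C" "Dom C f = X" "Cod C f = Y" by (auto simp: hom_iff)
  have "(\<iota> V \<otimes> \<iota> W \<otimes> f) \<cdot> (\<iota> V \<otimes> d X) = (\<iota> V \<otimes> d Y) \<cdot> (\<iota> V \<otimes> f \<otimes> \<iota> W)"
    by (simp add: comp_tensor half_braiding_natural[OF d])
  note comp_reduce[OF this]
  moreover have "(\<iota> V \<otimes> f \<otimes> \<iota> W) \<cdot> (c X \<otimes> \<iota> W) = (c Y \<otimes> \<iota> W) \<cdot> (f \<otimes> \<iota> V \<otimes> \<iota> W)"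
    using half_braiding_natural[OF c f] by (simp add: comp_tensor_left2 comp_tensor_right2)
  ultimately show "(\<iota> (V \<odot> W) \<otimes> f) \<cdot> (\<lambda>X \<in> Obj C. (\<iota> V \<otimes> d X) \<cdot> (c X \<otimes> \<iota> W)) X =
      (\<lambda>X \<in> Obj C. (\<iota> V \<otimes> d X) \<cdot> (c X \<otimes> \<iota> W)) Y \<cdot> (f \<otimes> \<iota> (V \<odot> W))"
    by simp
qed simp

lemma center_tensor_hom:
  assumes c: "half_braiding C V c" and d: "half_braiding C W d"
    and c': "half_braiding C V' c'" and d': "half_braiding C W' d'"
    and [simp]: "V \<in> Obj C" "W \<in> Obj C" "V' \<in> Obj C" "W' \<in> Obj C"
    and f: "f \<in> center_hom C (V, c) (V', c')" and g: "g \<in> center_hom C (W, d) (W', d')"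
  shows "f \<otimes> g \<in> center_hom C (center_tensor C (V, c) (W, d)) (center_tensor C (V', c') (W', d'))"
proof -
  note [simp] = half_braidingD[OF c] half_braidingD[OF d] half_braidingD[OF c'] half_braidingD[OF d']
  have [simp]: "f \<in> Arr C" "Dom C f = V" "Cod C f = V'" "g \<in> Arr C" "Dom C g = W" "Cod C g = W'"
    using f g by (auto simp: center_hom_def hom_iff)
  have "(f \<otimes> g \<otimes> \<iota> X) \<cdot> (\<iota> V \<otimes> d X) \<cdot> (c X \<otimes> \<iota> W)
      = (\<iota> V' \<otimes> d' X) \<cdot> (c' X \<otimes> \<iota> W') \<cdot> (\<iota> X \<otimes> f \<otimes> g)" if [simp]: "X \<in> Obj C" for X
  proof -
    have "(f \<otimes> g \<otimes> \<iota> X) \<cdot> (\<iota> V \<otimes> d X) = (\<iota> V' \<otimes> d' X) \<cdot> (f \<otimes> \<iota> X \<otimes> g)"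
      using g by (simp add: comp_tensor center_hom_def)
    note comp_reduce[OF this]
    moreover have "(f \<otimes> \<iota> X \<otimes> g) \<cdot> (c X \<otimes> \<iota> W) = (c' X \<otimes> \<iota> W') \<cdot> (\<iota> X \<otimes> f \<otimes> g)"
      using f by (simp add: comp_tensor_left2 comp_tensor_right2 center_hom_def)
    ultimately show ?thesis by simp
  qed
  then show ?thesis by (simp add: center_hom_def center_tensor_def hom_iff)
qed

lemma center_tensor_assoc:
  assumes c: "half_braiding C V c" and d: "half_braiding C W d" and e: "half_braiding C U e"
    and [simp]: "V \<in> Obj C" "W \<in> Obj C" "U \<in> Obj C"
  shows "center_tensor C (center_tensor C (V, c) (W, d)) (U, e) =
    center_tensor C (V, c) (center_tensor C (W, d) (U, e))"
  by (auto simp: center_tensor_def half_braidingD[OF c] half_braidingD[OF d] half_braidingD[OF e]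
      whisker_left whisker_right intro!: restrict_ext)

text \<open>The equations are literal because half-braidings are extensional: on
  \<open>Obj C\<close> only identities are composed with \<open>c\<close>, and elsewhere both sides
  are \<open>undefined\<close>.\<close>

lemma center_unit_tensor:
  assumes "half_braiding C V c" "V \<in> Obj C"
  shows "center_tensor C (\<one>, \<lambda>X \<in> Obj C. \<iota> X) (V, c) = (V, c)"
    "center_tensor C (V, c) (\<one>, \<lambda>X \<in> Obj C. \<iota> X) = (V, c)"
proof -
  have "c \<in> extensional (Obj C)" using assms by (simp add: half_braiding_def)
  then have "(\<lambda>X \<in> Obj C. c X) = c" by (simp add: extensional_restrict)
  moreover have "(\<lambda>X \<in> Obj C. (\<iota> \<one> \<otimes> c X) \<cdot> ((\<lambda>X \<in> Obj C. \<iota> X) X \<otimes> \<iota> V)) = (\<lambda>X \<in> Obj C. c X)"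
    "(\<lambda>X \<in> Obj C. (\<iota> V \<otimes> (\<lambda>X \<in> Obj C. \<iota> X) X) \<cdot> (c X \<otimes> \<iota> \<one>)) = (\<lambda>X \<in> Obj C. c X)"
    by (rule restrict_ext; simp add: half_braidingD[OF assms(1)] assms(2))+
  ultimately show "center_tensor C (\<one>, \<lambda>X \<in> Obj C. \<iota> X) (V, c) = (V, c)"
    "center_tensor C (V, c) (\<one>, \<lambda>X \<in> Obj C. \<iota> X) = (V, c)"
    using assms(2) by (simp_all add: center_tensor_def)
qed

text \<open>A Yang-Baxter argument: \<open>d\<close> is natural with respect to the arrow
  \<open>c X\<close>, and multiplicativity expands its components at \<open>X \<odot> V\<close> and
  \<open>V \<odot> X\<close>.\<close>

lemma center_braiding_hom:
  assumes c: "half_braiding C V c" and d: "half_braiding C W d" and [simp]: "V \<in> Obj C" "W \<in> Obj C"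
  shows "d V \<in> center_hom C (center_tensor C (V, c) (W, d)) (center_tensor C (W, d) (V, c))"
proof -
  note [simp] = half_braidingD[OF c] half_braidingD[OF d]
  have "(d V \<otimes> \<iota> X) \<cdot> (\<iota> V \<otimes> d X) \<cdot> (c X \<otimes> \<iota> W) = (\<iota> W \<otimes> c X) \<cdot> (d X \<otimes> \<iota> V) \<cdot> (\<iota> X \<otimes> d V)"
    if [simp]: "X \<in> Obj C" for X
    using half_braiding_natural[OF d, of "c X" "X \<odot> V" "V \<odot> X"] by (simp add: half_braiding_tensor[OF d])
  then show ?thesis by (simp add: center_hom_def center_tensor_def hom_iff)
qed

text \<open>The square of \<open>f\<close> is conjugated by the inverse. Applied to the braiding of
  the center, this makes the inverse in \<open>C\<close> an inverse in the center.\<close>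

lemma center_hom_inverse:
  assumes c: "half_braiding C V c" and d: "half_braiding C W d" and [simp]: "V \<in> Obj C" "W \<in> Obj C"
    and f: "f \<in> center_hom C (V, c) (W, d)" and g: "g \<in> Hom W V" "g \<cdot> f = \<iota> V" "f \<cdot> g = \<iota> W"
  shows "g \<in> center_hom C (W, d) (V, c)"
proof -
  note [simp] = half_braidingD[OF c] half_braidingD[OF d]
  have [simp]: "f \<in> Arr C" "Dom C f = V" "Cod C f = W" "g \<in> Arr C" "Dom C g = W" "Cod C g = V"
    using f g by (auto simp: center_hom_def hom_iff)
  have "(g \<otimes> \<iota> X) \<cdot> d X = c X \<cdot> (\<iota> X \<otimes> g)" if [simp]: "X \<in> Obj C" for X
  proof -
    have "(g \<otimes> \<iota> X) \<cdot> d X = (g \<otimes> \<iota> X) \<cdot> (d X \<cdot> (\<iota> X \<otimes> f)) \<cdot> (\<iota> X \<otimes> g)"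
      by (simp add: comp_tensor g)
    also have "\<dots> = (g \<otimes> \<iota> X) \<cdot> ((f \<otimes> \<iota> X) \<cdot> c X) \<cdot> (\<iota> X \<otimes> g)"
      using f by (simp add: center_hom_def del: comp_assoc_arr)
    also have "\<dots> = ((g \<otimes> \<iota> X) \<cdot> (f \<otimes> \<iota> X)) \<cdot> c X \<cdot> (\<iota> X \<otimes> g)"
      by simp
    also have "\<dots> = c X \<cdot> (\<iota> X \<otimes> g)"
      by (simp add: comp_tensor g del: comp_assoc_arr)
    finally show ?thesis .
  qed
  then show ?thesis by (simp add: center_hom_def hom_iff)
qed

lemma center_homD:
  assumes "f \<in> center_hom C (V, c) (W, d)"
  shows "f \<in> Arr C" "Dom C f = V" "Cod C f = W"
    "X \<in> Obj C \<Longrightarrow> (f \<otimes> \<iota> X) \<cdot> c X = d X \<cdot> (\<iota> X \<otimes> f)"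
  using assms by (auto simp: center_hom_def hom_iff)

lemma center_hom_comp:
  assumes c: "half_braiding C V c" and d: "half_braiding C W d" and e: "half_braiding C U e"
    and [simp]: "V \<in> Obj C" "W \<in> Obj C" "U \<in> Obj C"
    and f: "f \<in> center_hom C (V, c) (W, d)" and g: "g \<in> center_hom C (W, d) (U, e)"
  shows "g \<cdot> f \<in> center_hom C (V, c) (U, e)"
proof -
  note [simp] = half_braidingD[OF c] half_braidingD[OF d] half_braidingD[OF e] center_homD[OF f] center_homD[OF g]
  have "((g \<cdot> f) \<otimes> \<iota> X) \<cdot> c X = e X \<cdot> (\<iota> X \<otimes> (g \<cdot> f))" if [simp]: "X \<in> Obj C" for X
    by (simp add: whisker_left whisker_right comp_reduce[OF center_homD(4)[OF g]])
  then show ?thesis by (simp add: center_hom_def hom_iff)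
qed

lemma braided_right_center: "braided_category (right_center C) (center_braiding C)"
proof -
  let ?objs = "{(V, c). V \<in> Obj C \<and> half_braiding C V c}"
  have unit: "half_braiding C \<one> (\<lambda>X \<in> Obj C. \<iota> X)"
    by (simp add: half_braiding_def hom_iff is_iso_ide)
  have ide: "\<iota> V \<in> center_hom C (V, c) (V, c)" if "half_braiding C V c" "V \<in> Obj C" for V c
    using that by (simp add: center_hom_def hom_iff half_braidingD)
  have tens: "center_tensor C P Q \<in> ?objs" if "P \<in> ?objs" "Q \<in> ?objs" for P Q
    using that half_braiding_center_tensor by (auto simp: center_tensor_def)
  have smc: "strict_monoidal_category (right_center C)"
    unfolding right_center_def
  proof (rule strict_monoidal_structured_category)
    show "center_tensor C P Q \<in> ?objs" if "P \<in> ?objs" "Q \<in> ?objs" for P Q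
      by (rule tens[OF that])
  qed (auto simp: unit ide center_hom_comp center_tensor_assoc center_unit_tensor center_tensor_hom,
      auto simp: center_hom_def center_tensor_def)
  interpret Z: strict_monoidal_category "right_center C" by (rule smc)
  have hom: "center_braiding C P Q \<in> Hom\<^bsub>right_center C\<^esub> (center_tensor C P Q) (center_tensor C Q P)"
    if "P \<in> ?objs" "Q \<in> ?objs" for P Q
    using that tens center_braiding_hom by (auto simp: right_center_def center_braiding_def)
  show ?thesis
  proof
    fix P Q assume "P \<in> Obj (right_center C)" "Q \<in> Obj (right_center C)"
    then have PQ: "P \<in> ?objs" "Q \<in> ?objs" by (auto simp: right_center_def)
    then obtain V c W d where P: "P = (V, c)" "V \<in> Obj C" "half_braiding C V c"
      and Q: "Q = (W, d)" "W \<in> Obj C" "half_braiding C W d" by auto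
    show "center_braiding C P Q \<in> Hom\<^bsub>right_center C\<^esub> (P \<odot>\<^bsub>right_center C\<^esub> Q) (Q \<odot>\<^bsub>right_center C\<^esub> P)"
      using hom[OF PQ] by (simp add: right_center_def)
    obtain g where g: "g \<in> Hom (W \<odot> V) (V \<odot> W)" "g \<cdot> d V = \<iota> (V \<odot> W)" "d V \<cdot> g = \<iota> (W \<odot> V)"
      using is_isoE[of "d V" "V \<odot> W" "W \<odot> V"] half_braidingD[OF Q(3) P(2)] by (auto simp: hom_iff)
    have "g \<in> center_hom C (center_tensor C Q P) (center_tensor C P Q)"
      using center_hom_inverse[OF half_braiding_center_tensor half_braiding_center_tensor, of V c W d W d V c "d V" g]
        center_braiding_hom[OF P(3) Q(3)] P Q g
      by (simp add: center_tensor_def)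
    then show "is_iso (right_center C) (center_braiding C P Q)"
      using center_braiding_hom[OF P(3) Q(3)] P Q g tens[OF PQ] tens[OF PQ(2,1)]
      unfolding right_center_def P Q center_braiding_def prod.case
      by (intro is_iso_structured_category) (auto simp: center_tensor_def)
  next
    fix P Q R
    assume "P \<in> Obj (right_center C)" "Q \<in> Obj (right_center C)" "R \<in> Obj (right_center C)"
    \<comment> \<open>The left hexagon is multiplicativity of the half-braiding of \<open>R\<close>;
      the right one is the definition of the tensor product of half-braidings.\<close>
    then show "center_braiding C (P \<odot>\<^bsub>right_center C\<^esub> Q) R =
        (center_braiding C P R \<otimes>\<^bsub>right_center C\<^esub> \<iota>\<^bsub>right_center C\<^esub> Q) \<cdot>\<^bsub>right_center C\<^esub>
        (\<iota>\<^bsub>right_center C\<^esub> P \<otimes>\<^bsub>right_center C\<^esub> center_braiding C Q R)"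
      "center_braiding C P (Q \<odot>\<^bsub>right_center C\<^esub> R) =
        (\<iota>\<^bsub>right_center C\<^esub> Q \<otimes>\<^bsub>right_center C\<^esub> center_braiding C P R) \<cdot>\<^bsub>right_center C\<^esub>
        (center_braiding C P Q \<otimes>\<^bsub>right_center C\<^esub> \<iota>\<^bsub>right_center C\<^esub> R)"
      by (auto simp: right_center_def center_braiding_def center_tensor_def half_braiding_tensor
          half_braidingD whisker_left whisker_right intro!: restrict_ext)
  next
    fix f P P' g Q Q'
    assume "f \<in> Hom\<^bsub>right_center C\<^esub> P P'" "g \<in> Hom\<^bsub>right_center C\<^esub> Q Q'"
    then obtain V c V' c' u W d W' d' v
      where f: "f = ((V, c), u, (V', c'))" "P = (V, c)" "P' = (V', c')"
        and g: "g = ((W, d), v, (W', d'))" "Q = (W, d)" "Q' = (W', d')"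
        and O [simp]: "V \<in> Obj C" "V' \<in> Obj C" "W \<in> Obj C" "W' \<in> Obj C"
        and u: "u \<in> center_hom C (V, c) (V', c')" and v: "v \<in> center_hom C (W, d) (W', d')"
        and d: "half_braiding C W d" and d': "half_braiding C W' d'"
      by (auto simp: right_center_def)
    note [simp] = center_homD[OF u] center_homD[OF v] half_braidingD[OF d] half_braidingD[OF d']
    \<comment> \<open>Splitting \<open>v \<otimes> u\<close> lets \<open>u\<close> pass by
      naturality of \<open>d\<close>, and then \<open>v\<close> by the condition on morphisms of the
      center.\<close>
    have "(v \<otimes> u) \<cdot> d V = (v \<otimes> \<iota> V') \<cdot> (\<iota> W \<otimes> u) \<cdot> d V"
      by (subst comp_assoc_arr[symmetric]) (simp_all add: comp_tensor del: comp_assoc_arr)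
    also have "\<dots> = d' V' \<cdot> (\<iota> V' \<otimes> v) \<cdot> (u \<otimes> \<iota> W)"
      by (simp add: half_braiding_natural[OF d] comp_reduce[OF center_homD(4)[OF v]])
    finally have "(v \<otimes> u) \<cdot> d V = d' V' \<cdot> (u \<otimes> v)" by (simp add: comp_tensor)
    then show "(g \<otimes>\<^bsub>right_center C\<^esub> f) \<cdot>\<^bsub>right_center C\<^esub> center_braiding C P Q =
        center_braiding C P' Q' \<cdot>\<^bsub>right_center C\<^esub> (f \<otimes>\<^bsub>right_center C\<^esub> g)"
      by (simp add: f g right_center_def center_braiding_def)
  qed
qed

end

section \<open>Full subcategories and transport of structure\<close>

lemma braided_full_subcategory:
  assumes "braided_category C \<Phi>" and S: "S \<subseteq> Obj C" "\<one>\<^bsub>C\<^esub> \<in> S"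
    and tens: "\<And>X Y. \<lbrakk>X \<in> S; Y \<in> S\<rbrakk> \<Longrightarrow> X \<odot>\<^bsub>C\<^esub> Y \<in> S"
  shows "braided_category (full_subcategory C S) \<Phi>"
proof -
  interpret braided_category C \<Phi> by fact
  let ?D = "full_subcategory C S"
  have [simp]: "Obj ?D = S" "Dom ?D = Dom C" "Cod ?D = Cod C" "Ide ?D = Ide C" "Comp ?D = Comp C"
    "TensO ?D = TensO C" "TensA ?D = TensA C" "Unit ?D = Unit C"
    "Arr ?D = {f \<in> Arr C. Dom C f \<in> S \<and> Cod C f \<in> S}"
    by (simp_all add: full_subcategory_def)
  have hom: "f \<in> Hom\<^bsub>?D\<^esub> X Y \<longleftrightarrow> f \<in> Hom\<^bsub>C\<^esub> X Y \<and> X \<in> S \<and> Y \<in> S" for f X Y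
    by (auto simp: Hom_def)
  have O: "X \<in> S \<Longrightarrow> X \<in> Obj C" for X using S by auto
  have iso: "is_iso ?D (\<Phi> X Y)" if "X \<in> S" "Y \<in> S" for X Y
  proof -
    have "is_iso C (\<Phi> X Y)" using that O by (simp add: braid_iso)
    then obtain g where "inverse_arrows C (\<Phi> X Y) g" by (auto simp: is_iso_def)
    \<comment> \<open>Fullness puts the inverse into the subcategory, since its endpoints are tensor
      products of objects of \<open>S\<close>.\<close>
    then have "inverse_arrows ?D (\<Phi> X Y) g"
      using that O by (auto simp: inverse_arrows_def hom tens)
    then show ?thesis by (auto simp: is_iso_def)
  qed
  show ?thesis
  proof
    fix f g X X' Y Y' assume "f \<in> Hom\<^bsub>?D\<^esub> X X'" "g \<in> Hom\<^bsub>?D\<^esub> Y Y'"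
    then show "(g \<otimes>\<^bsub>?D\<^esub> f) \<cdot>\<^bsub>?D\<^esub> \<Phi> X Y = \<Phi> X' Y' \<cdot>\<^bsub>?D\<^esub> (f \<otimes>\<^bsub>?D\<^esub> g)"
      by (simp add: hom braid_natural)
  qed (auto simp: hom O S tens iso hexagon_left hexagon_right hom_iff comp_tensor tensor_ide
      simp del: ide_tensor)
qed

text \<open>Transport of structure along bijections on objects and arrows. Here \<open>D\<close> is
  not yet known to be a category, so \<open>obj\<close> supplies the closure under
  \<open>Dom\<close> and \<open>Cod\<close>; all laws of \<open>D\<close>, and the compatibility of
  the inverse functor with the structure, are consequences.\<close>

lemma isomorphic_braided_categoriesI:
  assumes "braided_category C \<Phi>" and "strict_braided_functor C \<Phi> D \<Psi> Fo Fa"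
    and Go: "\<And>Y. Y \<in> Obj D \<Longrightarrow> Go Y \<in> Obj C"
    and Ga: "\<And>g. g \<in> Arr D \<Longrightarrow> Ga g \<in> Hom\<^bsub>C\<^esub> (Go (Dom D g)) (Go (Cod D g))"
    and GF: "\<And>X. X \<in> Obj C \<Longrightarrow> Go (Fo X) = X" "\<And>f. f \<in> Arr C \<Longrightarrow> Ga (Fa f) = f"
    and FG: "\<And>Y. Y \<in> Obj D \<Longrightarrow> Fo (Go Y) = Y" "\<And>g. g \<in> Arr D \<Longrightarrow> Fa (Ga g) = g"
    and obj: "\<And>g. g \<in> Arr D \<Longrightarrow> Dom D g \<in> Obj D \<and> Cod D g \<in> Obj D"
  shows "isomorphic_braided_categories C \<Phi> D \<Psi>"
proof -
  interpret braided_category C \<Phi> by fact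
  interpret F: strict_braided_functor C \<Phi> D \<Psi> Fo Fa by fact
  have homD: "g \<in> Hom\<^bsub>D\<^esub> X Y \<longleftrightarrow> g \<in> Arr D \<and> Dom D g = X \<and> Cod D g = Y" for g X Y
    by (simp add: Hom_def)
  have Fa: "Fa f \<in> Arr D" "Dom D (Fa f) = Fo (Dom C f)" "Cod D (Fa f) = Fo (Cod C f)" if "f \<in> Arr C" for f
    using F.map_hom[of f "Dom C f" "Cod C f"] that by (auto simp: Hom_def)
  have Ga': "Ga g \<in> Arr C" "Dom C (Ga g) = Go (Dom D g)" "Cod C (Ga g) = Go (Cod D g)" if "g \<in> Arr D" for g
    using Ga[OF that] by (auto simp: hom_iff)
  have unit: "Go \<one>\<^bsub>D\<^esub> = \<one>\<^bsub>C\<^esub>" "\<one>\<^bsub>D\<^esub> \<in> Obj D"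
    using F.map_unit GF(1) F.map_obj unit_obj by metis+
  have tensO: "Go (X \<odot>\<^bsub>D\<^esub> Y) = Go X \<odot>\<^bsub>C\<^esub> Go Y" "X \<odot>\<^bsub>D\<^esub> Y \<in> Obj D" "X \<odot>\<^bsub>D\<^esub> Y = Fo (Go X \<odot>\<^bsub>C\<^esub> Go Y)"
    if "X \<in> Obj D" "Y \<in> Obj D" for X Y
    using F.map_tensor_obj[of "Go X" "Go Y"] that Go FG(1) GF(1) F.map_obj tensor_obj by metis+
  \<comment> \<open>Every operation of \<open>D\<close> is expressed as \<open>Fa\<close> of the
    operation of \<open>C\<close> on preimages. After this rewriting each law of \<open>D\<close> is
    the image of a law of \<open>C\<close>.\<close>
  have comp: "g \<cdot>\<^bsub>D\<^esub> f = Fa (Ga g \<cdot>\<^bsub>C\<^esub> Ga f)" if "f \<in> Arr D" "g \<in> Arr D" "Dom D g = Cod D f" for f g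
    using F.map_comp[of "Ga f" _ _ "Ga g"] that Ga' FG(2) by (auto simp: hom_iff)
  have tensA: "f \<otimes>\<^bsub>D\<^esub> g = Fa (Ga f \<otimes>\<^bsub>C\<^esub> Ga g)" if "f \<in> Arr D" "g \<in> Arr D" for f g
    using F.map_tensor_arr[of "Ga f" "Ga g"] that Ga' FG(2) by auto
  have ide: "\<iota>\<^bsub>D\<^esub> X = Fa (\<iota>\<^bsub>C\<^esub> (Go X))" if "X \<in> Obj D" for X
    using F.map_ide[of "Go X"] that Go FG(1) by auto
  have braid: "\<Psi> X Y = Fa (\<Phi> (Go X) (Go Y))" if "X \<in> Obj D" "Y \<in> Obj D" for X Y
    using F.map_braiding[of "Go X" "Go Y"] that Go FG(1) by auto
  note simps = homD Fa Ga' unit tensO(1,2) Go GF FG comp tensA ide obj F.map_obj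
  have D: "strict_monoidal_category D"
    by unfold_locales
      (auto simp: simps comp_tensor tensO(3) tensor_ide simp del: ide_tensor)
  have iso: "is_iso D (\<Psi> X Y)" if XY: "X \<in> Obj D" "Y \<in> Obj D" for X Y
  proof -
    obtain g where "g \<in> Hom\<^bsub>C\<^esub> (Go Y \<odot>\<^bsub>C\<^esub> Go X) (Go X \<odot>\<^bsub>C\<^esub> Go Y)"
      "g \<cdot>\<^bsub>C\<^esub> \<Phi> (Go X) (Go Y) = \<iota>\<^bsub>C\<^esub> (Go X \<odot>\<^bsub>C\<^esub> Go Y)" "\<Phi> (Go X) (Go Y) \<cdot>\<^bsub>C\<^esub> g = \<iota>\<^bsub>C\<^esub> (Go Y \<odot>\<^bsub>C\<^esub> Go X)"
      using is_isoE[OF braid_iso braid_hom, of "Go X" "Go Y"] XY Go by metis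
    then have "inverse_arrows D (\<Psi> X Y) (Fa g)"
      using that by (simp add: inverse_arrows_def braid simps hom_iff tensO(3)[symmetric] del: ide_tensor)
    then show ?thesis by (auto simp: is_iso_def)
  qed
  interpret D: strict_monoidal_category D by (rule D)
  have braidedD: "braided_category D \<Psi>"
  proof
    fix f g X X' Y Y' assume *: "f \<in> Hom\<^bsub>D\<^esub> X X'" "g \<in> Hom\<^bsub>D\<^esub> Y Y'"
    have "(Ga g \<otimes>\<^bsub>C\<^esub> Ga f) \<cdot>\<^bsub>C\<^esub> \<Phi> (Go X) (Go Y) = \<Phi> (Go X') (Go Y') \<cdot>\<^bsub>C\<^esub> (Ga f \<otimes>\<^bsub>C\<^esub> Ga g)"
      using * by (intro braid_natural) (auto simp: homD Ga' hom_iff)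
    then show "(g \<otimes>\<^bsub>D\<^esub> f) \<cdot>\<^bsub>D\<^esub> \<Psi> X Y = \<Psi> X' Y' \<cdot>\<^bsub>D\<^esub> (f \<otimes>\<^bsub>D\<^esub> g)"
      using * by (auto simp: simps braid tensO(3)[symmetric])
  qed (use iso in \<open>auto simp: braid\<close>, auto simp: simps braid hexagon_left hexagon_right tensO(3)[symmetric])
  have "strict_braided_functor D \<Psi> C \<Phi> Go Ga"
    by unfold_locales (auto simp: simps braid hom_iff)
  then show ?thesis
    unfolding isomorphic_braided_categories_def
    using assms(1,2) braidedD GF FG by blast
qed

section \<open>Modules\<close>

context hopf_algebra
begin

lemmas [simp] = H_obj

lemma structure_simps [simp]:
  "\<nabla> \<in> Arr C" "Dom C \<nabla> = H \<odot> H" "Cod C \<nabla> = H"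
  "\<eta> \<in> Arr C" "Dom C \<eta> = \<one>" "Cod C \<eta> = H"
  "\<Delta> \<in> Arr C" "Dom C \<Delta> = H" "Cod C \<Delta> = H \<odot> H"
  "\<epsilon> \<in> Arr C" "Dom C \<epsilon> = H" "Cod C \<epsilon> = \<one>"
  "S \<in> Arr C" "Dom C S = H" "Cod C S = H"
  using mult_hom unit_hom comult_hom counit_hom antipode_hom by (auto simp: hom_iff)

text \<open>Only the typing of an action. It lets those properties of \<open>lam\<close> that come
  from the comultiplication and from naturality be stated for bare actions.\<close>

definition act :: "'o \<Rightarrow> 'a \<Rightarrow> bool"
  where "act M \<mu> \<longleftrightarrow> M \<in> Obj C \<and> \<mu> \<in> Arr C \<and> Dom C \<mu> = H \<odot> M \<and> Cod C \<mu> = M"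

lemma actD:
  assumes "act M \<mu>"
  shows "M \<in> Obj C" "\<mu> \<in> Arr C" "Dom C \<mu> = H \<odot> M" "Cod C \<mu> = M"
  using assms by (auto simp: act_def)

lemma left_moduleD:
  assumes "left_module C H \<nabla> \<eta> M \<mu>"
  shows "act M \<mu>" "\<mu> \<cdot> (\<iota> H \<otimes> \<mu>) = \<mu> \<cdot> (\<nabla> \<otimes> \<iota> M)" "\<mu> \<cdot> (\<eta> \<otimes> \<iota> M) = \<iota> M"
  using assms by (auto simp: left_module_def act_def hom_iff)

text \<open>The map \<open>h \<otimes> m \<mapsto> h\<^sub>1 m \<otimes> h\<^sub>2\<close>, through which all diagonal actions factor.\<close>

definition lam :: "'o \<Rightarrow> 'a \<Rightarrow> 'a"
  where "lam M \<mu> = (\<mu> \<otimes> \<iota> H) \<cdot> (\<iota> H \<otimes> \<Phi> H M) \<cdot> (\<Delta> \<otimes> \<iota> M)"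

lemma lam_simps [simp]:
  assumes "act M \<mu>"
  shows "lam M \<mu> \<in> Arr C" "Dom C (lam M \<mu>) = H \<odot> M" "Cod C (lam M \<mu>) = M \<odot> H"
  using assms actD[OF assms] by (simp_all add: lam_def)

lemma tensor_action_lam:
  assumes [simp]: "act M \<mu>" "act N \<nu>"
  shows "tensor_action C \<Phi> H \<Delta> M \<mu> N \<nu> = (\<iota> M \<otimes> \<nu>) \<cdot> (lam M \<mu> \<otimes> \<iota> N)"
proof -
  note [simp] = actD[OF assms(1)] actD[OF assms(2)]
  have "(\<iota> M \<otimes> \<nu>) \<cdot> (\<mu> \<otimes> \<iota> H \<otimes> \<iota> N) = \<mu> \<otimes> \<nu>" by (simp add: comp_tensor)
  note comp_reduce[OF this]
  then show ?thesis by (simp add: tensor_action_def lam_def whisker_right)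
qed

lemma act_tensor_action [simp]:
  assumes "act M \<mu>" "act N \<nu>"
  shows "act (M \<odot> N) (tensor_action C \<Phi> H \<Delta> M \<mu> N \<nu>)"
  using assms actD[OF assms(1)] actD[OF assms(2)] by (simp add: act_def[of "M \<odot> N"] tensor_action_lam)

text \<open>Both sides are \<open>h_1 (k_1 m) \<otimes> h_2 k_2\<close>, by multiplicativity of
  \<open>\<Delta>\<close>, naturality of \<open>\<Phi>\<close> and associativity of the action. With
  \<open>lam_unit\<close> this gives the module laws of the diagonal action.\<close>

lemma lam_mult:
  assumes M: "left_module C H \<nabla> \<eta> M \<mu>"
  shows "lam M \<mu> \<cdot> (\<nabla> \<otimes> \<iota> M) = (\<iota> M \<otimes> \<nabla>) \<cdot> (lam M \<mu> \<otimes> \<iota> H) \<cdot> (\<iota> H \<otimes> lam M \<mu>)"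
proof -
  note [simp] = left_moduleD(1)[OF M] actD[OF left_moduleD(1)[OF M]]
  have "\<Phi> H M \<cdot> (\<nabla> \<otimes> \<iota> M) = (\<iota> M \<otimes> \<nabla>) \<cdot> (\<Phi> H M \<otimes> \<iota> H) \<cdot> (\<iota> H \<otimes> \<Phi> H M)"
    using braid_natural_left[of M \<nabla> "H \<odot> H" H] by (simp add: hexagon_left)
  then have 1: "(\<iota> H \<otimes> \<Phi> H M) \<cdot> (\<nabla> \<otimes> \<nabla> \<otimes> \<iota> M) =
      (\<nabla> \<otimes> \<iota> M \<otimes> \<nabla>) \<cdot> (\<iota> H \<otimes> \<iota> H \<otimes> \<Phi> H M \<otimes> \<iota> H) \<cdot> (\<iota> H \<otimes> \<iota> H \<otimes> \<iota> H \<otimes> \<Phi> H M)"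
    and 2: "(\<mu> \<otimes> \<iota> H) \<cdot> (\<nabla> \<otimes> \<iota> M \<otimes> \<nabla>) =
      (\<iota> M \<otimes> \<nabla>) \<cdot> (\<mu> \<otimes> \<iota> H \<otimes> \<iota> H) \<cdot> (\<iota> H \<otimes> \<mu> \<otimes> \<iota> H \<otimes> \<iota> H)"
    by (simp_all add: merge_tensors left_moduleD(2)[OF M])
  have "(\<Delta> \<otimes> \<iota> M) \<cdot> (\<nabla> \<otimes> \<iota> M) =
      (\<nabla> \<otimes> \<nabla> \<otimes> \<iota> M) \<cdot> (\<iota> H \<otimes> \<Phi> H H \<otimes> \<iota> H \<otimes> \<iota> M) \<cdot> (\<Delta> \<otimes> \<Delta> \<otimes> \<iota> M)"
    using arg_cong[OF comult_mult, of "\<lambda>t. t \<otimes> \<iota> M"] by (simp add: whisker_right)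
  \<comment> \<open>Normal form for both sides: comultiplications come first in time, then
    braidings, then actions, and \<open>\<nabla>\<close> last.\<close>
  then have L: "lam M \<mu> \<cdot> (\<nabla> \<otimes> \<iota> M) =
      (\<iota> M \<otimes> \<nabla>) \<cdot> (\<mu> \<otimes> \<iota> H \<otimes> \<iota> H) \<cdot> (\<iota> H \<otimes> \<mu> \<otimes> \<iota> H \<otimes> \<iota> H) \<cdot>
      (\<iota> H \<otimes> \<iota> H \<otimes> \<Phi> H M \<otimes> \<iota> H) \<cdot> (\<iota> H \<otimes> \<iota> H \<otimes> \<iota> H \<otimes> \<Phi> H M) \<cdot>
      (\<iota> H \<otimes> \<Phi> H H \<otimes> \<iota> H \<otimes> \<iota> M) \<cdot> (\<Delta> \<otimes> \<Delta> \<otimes> \<iota> M)"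
    by (simp add: lam_def comp_reduce[OF 1] comp_reduce[OF 2])
  \<comment> \<open>On the right-hand side, \<open>\<Delta>\<close> and \<open>\<Phi>\<close> of the
    \<open>lam\<close> applied second are now moved in front of \<open>\<mu>\<close> of the one
    applied first.\<close>
  have "(\<Delta> \<otimes> \<iota> M \<otimes> \<iota> H) \<cdot> (\<iota> H \<otimes> \<mu> \<otimes> \<iota> H) = (\<iota> H \<otimes> \<iota> H \<otimes> \<mu> \<otimes> \<iota> H) \<cdot> (\<Delta> \<otimes> \<iota> H \<otimes> \<iota> M \<otimes> \<iota> H)"
    by (simp add: merge_tensors)
  note 3 = comp_reduce[OF this]
  have "\<Phi> H M \<cdot> (\<iota> H \<otimes> \<mu>) = (\<mu> \<otimes> \<iota> H) \<cdot> (\<iota> H \<otimes> \<Phi> H M) \<cdot> (\<Phi> H H \<otimes> \<iota> M)"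
    using braid_natural_right[of H \<mu> "H \<odot> M" M] by (simp add: hexagon_right)
  from arg_cong[OF this, of "\<lambda>t. \<iota> H \<otimes> t \<otimes> \<iota> H"]
  have "(\<iota> H \<otimes> \<Phi> H M \<otimes> \<iota> H) \<cdot> (\<iota> H \<otimes> \<iota> H \<otimes> \<mu> \<otimes> \<iota> H) =
      (\<iota> H \<otimes> \<mu> \<otimes> \<iota> H \<otimes> \<iota> H) \<cdot> (\<iota> H \<otimes> \<iota> H \<otimes> \<Phi> H M \<otimes> \<iota> H) \<cdot> (\<iota> H \<otimes> \<Phi> H H \<otimes> \<iota> M \<otimes> \<iota> H)"
    by (simp add: whisker_left whisker_right)
  note 4 = comp_reduce[OF this]
  have "(\<Delta> \<otimes> \<iota> H \<otimes> \<iota> M \<otimes> \<iota> H) \<cdot> (\<iota> H \<otimes> \<iota> H \<otimes> \<Phi> H M) =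
      (\<iota> H \<otimes> \<iota> H \<otimes> \<iota> H \<otimes> \<Phi> H M) \<cdot> (\<Delta> \<otimes> \<iota> H \<otimes> \<iota> H \<otimes> \<iota> M)"
    by (simp add: merge_tensors)
  note 5 = comp_reduce[OF this]
  have 6: "(\<Delta> \<otimes> \<iota> H \<otimes> \<iota> H \<otimes> \<iota> M) \<cdot> (\<iota> H \<otimes> \<Delta> \<otimes> \<iota> M) = \<Delta> \<otimes> \<Delta> \<otimes> \<iota> M"
    by (simp add: merge_tensors)
  have "(\<iota> H \<otimes> \<Phi> H H \<otimes> \<iota> M \<otimes> \<iota> H) \<cdot> (\<iota> H \<otimes> \<iota> H \<otimes> \<iota> H \<otimes> \<Phi> H M) =
      (\<iota> H \<otimes> \<iota> H \<otimes> \<iota> H \<otimes> \<Phi> H M) \<cdot> (\<iota> H \<otimes> \<Phi> H H \<otimes> \<iota> H \<otimes> \<iota> M)"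
    by (simp add: merge_tensors)
  note 7 = comp_reduce[OF this]
  show ?thesis
    unfolding L by (simp add: lam_def whisker_left whisker_right 3 4 5 6 7)
qed

lemma lam_unit:
  assumes M: "left_module C H \<nabla> \<eta> M \<mu>"
  shows "lam M \<mu> \<cdot> (\<eta> \<otimes> \<iota> M) = \<iota> M \<otimes> \<eta>"
proof -
  note [simp] = left_moduleD(1)[OF M] actD[OF left_moduleD(1)[OF M]]
  have "\<Phi> H M \<cdot> (\<eta> \<otimes> \<iota> M) = \<iota> M \<otimes> \<eta>"
    using braid_natural_left[of M \<eta> \<one> H] by simp
  then have 1: "(\<Delta> \<otimes> \<iota> M) \<cdot> (\<eta> \<otimes> \<iota> M) = \<eta> \<otimes> \<eta> \<otimes> \<iota> M"
    and 2: "(\<iota> H \<otimes> \<Phi> H M) \<cdot> (\<eta> \<otimes> \<eta> \<otimes> \<iota> M) = \<eta> \<otimes> \<iota> M \<otimes> \<eta>"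
    and 3: "(\<mu> \<otimes> \<iota> H) \<cdot> (\<eta> \<otimes> \<iota> M \<otimes> \<eta>) = \<iota> M \<otimes> \<eta>"
    by (simp_all add: merge_tensors comult_unit left_moduleD(3)[OF M])
  show ?thesis by (simp add: lam_def 1 2 3)
qed

text \<open>Coassociativity in the form \<open>h_1 m \<otimes> h_2 \<otimes> h_3\<close>; naturality
  of \<open>\<Phi>\<close> in \<open>\<Delta>\<close> carries \<open>M\<close> past both remaining
  legs.\<close>

lemma lam_comult:
  assumes [simp]: "act M \<mu>"
  shows "(\<iota> M \<otimes> \<Delta>) \<cdot> lam M \<mu> = (lam M \<mu> \<otimes> \<iota> H) \<cdot> (\<iota> H \<otimes> \<Phi> H M) \<cdot> (\<Delta> \<otimes> \<iota> M)"
proof -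
  note [simp] = actD[OF assms(1)]
  have "(\<iota> M \<otimes> \<Delta>) \<cdot> (\<mu> \<otimes> \<iota> H) = (\<mu> \<otimes> \<iota> H \<otimes> \<iota> H) \<cdot> (\<iota> H \<otimes> \<iota> M \<otimes> \<Delta>)"
    by (simp add: merge_tensors)
  note 1 = comp_reduce[OF this]
  have "(\<iota> M \<otimes> \<Delta>) \<cdot> \<Phi> H M = (\<Phi> H M \<otimes> \<iota> H) \<cdot> (\<iota> H \<otimes> \<Phi> H M) \<cdot> (\<Delta> \<otimes> \<iota> M)"
    using braid_natural_left[of M \<Delta> H "H \<odot> H"] by (simp add: hexagon_left)
  from arg_cong[OF this, of "\<lambda>t. \<iota> H \<otimes> t"]
  have "(\<iota> H \<otimes> \<iota> M \<otimes> \<Delta>) \<cdot> (\<iota> H \<otimes> \<Phi> H M) =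
      (\<iota> H \<otimes> \<Phi> H M \<otimes> \<iota> H) \<cdot> (\<iota> H \<otimes> \<iota> H \<otimes> \<Phi> H M) \<cdot> (\<iota> H \<otimes> \<Delta> \<otimes> \<iota> M)"
    by (simp add: whisker_left)
  note 2 = comp_reduce[OF this]
  have "(\<Delta> \<otimes> \<iota> M \<otimes> \<iota> H) \<cdot> (\<iota> H \<otimes> \<Phi> H M) = (\<iota> H \<otimes> \<iota> H \<otimes> \<Phi> H M) \<cdot> (\<Delta> \<otimes> \<iota> H \<otimes> \<iota> M)"
    by (simp add: merge_tensors)
  note 3 = comp_reduce[OF this]
  have 4: "(\<iota> H \<otimes> \<Delta> \<otimes> \<iota> M) \<cdot> (\<Delta> \<otimes> \<iota> M) = (\<Delta> \<otimes> \<iota> H \<otimes> \<iota> M) \<cdot> (\<Delta> \<otimes> \<iota> M)"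
    using arg_cong[OF comult_coassoc, of "\<lambda>t. t \<otimes> \<iota> M"] by (simp add: whisker_right)
  show ?thesis by (simp add: lam_def whisker_right 1 2 3 4)
qed

text \<open>\<open>h_1 m \<otimes> h_2 n \<otimes> h_3\<close>, from \<open>lam_comult\<close> for
  \<open>M\<close> and the hexagon for \<open>\<Phi> H (M \<odot> N)\<close>. It makes the diagonal
  action associative on the nose.\<close>

lemma lam_tensor:
  assumes [simp]: "act M \<mu>" "act N \<nu>"
  shows "lam (M \<odot> N) (tensor_action C \<Phi> H \<Delta> M \<mu> N \<nu>) = (\<iota> M \<otimes> lam N \<nu>) \<cdot> (lam M \<mu> \<otimes> \<iota> N)"
proof -
  note [simp] = actD[OF assms(1)] actD[OF assms(2)]
  have "(lam M \<mu> \<otimes> \<iota> N \<otimes> \<iota> H) \<cdot> (\<iota> H \<otimes> \<iota> M \<otimes> \<Phi> H N) =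
      (\<iota> M \<otimes> \<iota> H \<otimes> \<Phi> H N) \<cdot> (lam M \<mu> \<otimes> \<iota> H \<otimes> \<iota> N)"
    by (simp add: merge_tensors)
  note 1 = comp_reduce[OF this]
  have 2: "(\<iota> M \<otimes> \<Delta> \<otimes> \<iota> N) \<cdot> (lam M \<mu> \<otimes> \<iota> N) =
      (lam M \<mu> \<otimes> \<iota> H \<otimes> \<iota> N) \<cdot> (\<iota> H \<otimes> \<Phi> H M \<otimes> \<iota> N) \<cdot> (\<Delta> \<otimes> \<iota> M \<otimes> \<iota> N)"
    using arg_cong[OF lam_comult, of M \<mu> "\<lambda>t. t \<otimes> \<iota> N"] by (simp add: whisker_right)
  show ?thesis
    by (simp add: lam_def[of N] lam_def[of "M \<odot> N"] tensor_action_lam hexagon_right whisker_left whisker_right 1 2)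
qed

text \<open>The counit law removes the leg \<open>h_2\<close>. This is what happens when a trivial
  module is tensored on the right.\<close>

lemma lam_counit:
  assumes [simp]: "act M \<mu>"
  shows "(\<iota> M \<otimes> \<epsilon>) \<cdot> lam M \<mu> = \<mu>"
proof -
  note [simp] = actD[OF assms(1)]
  have "(\<iota> M \<otimes> \<epsilon>) \<cdot> (\<mu> \<otimes> \<iota> H) = \<mu> \<cdot> (\<iota> H \<otimes> \<iota> M \<otimes> \<epsilon>)"
    using slide[of \<mu> \<epsilon> "H \<odot> M" M H \<one>] by simp
  note 1 = comp_reduce[OF this]
  have "(\<iota> M \<otimes> \<epsilon>) \<cdot> \<Phi> H M = \<epsilon> \<otimes> \<iota> M"
    using braid_natural_left[of M \<epsilon> H \<one>] by simp
  then have "(\<iota> H \<otimes> \<iota> M \<otimes> \<epsilon>) \<cdot> (\<iota> H \<otimes> \<Phi> H M) = \<iota> H \<otimes> \<epsilon> \<otimes> \<iota> M"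
    by (simp add: merge_tensors)
  note 2 = comp_reduce[OF this]
  have 3: "(\<iota> H \<otimes> \<epsilon> \<otimes> \<iota> M) \<cdot> (\<Delta> \<otimes> \<iota> M) = \<iota> H \<otimes> \<iota> M"
    using arg_cong[OF comult_counit(2), of "\<lambda>t. t \<otimes> \<iota> M"] by (simp add: whisker_right)
  show ?thesis by (simp add: lam_def 1 2 3)
qed

lemma lam_linear:
  assumes [simp]: "act M \<mu>" "act N \<nu>" "f \<in> Arr C" "Dom C f = M" "Cod C f = N"
    and f: "left_linear C H \<mu> \<nu> f"
  shows "(f \<otimes> \<iota> H) \<cdot> lam M \<mu> = lam N \<nu> \<cdot> (\<iota> H \<otimes> f)"
proof -
  note [simp] = actD[OF assms(1)] actD[OF assms(2)]
  have "(f \<otimes> \<iota> H) \<cdot> (\<mu> \<otimes> \<iota> H) = (\<nu> \<otimes> \<iota> H) \<cdot> (\<iota> H \<otimes> f \<otimes> \<iota> H)"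
    using f by (simp add: merge_tensors left_linear_def)
  note 1 = comp_reduce[OF this]
  have "(\<iota> H \<otimes> f \<otimes> \<iota> H) \<cdot> (\<iota> H \<otimes> \<Phi> H M) = (\<iota> H \<otimes> \<Phi> H N) \<cdot> (\<iota> H \<otimes> \<iota> H \<otimes> f)"
    using braid_natural_right[of H f M N] by (simp add: merge_tensors)
  note 2 = comp_reduce[OF this]
  have 3: "(\<iota> H \<otimes> \<iota> H \<otimes> f) \<cdot> (\<Delta> \<otimes> \<iota> M) = (\<Delta> \<otimes> \<iota> N) \<cdot> (\<iota> H \<otimes> f)"
    by (simp add: merge_tensors)
  show ?thesis by (simp add: lam_def 1 2 3)
qed

section \<open>Trivial modules, tensor products and the monoidal category of modules\<close>

lemma act_trivial [simp]: "X \<in> Obj C \<Longrightarrow> act X (\<epsilon> \<otimes> \<iota> X)"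
  by (simp add: act_def)

text \<open>In \<open>\<epsilon>(h_1) x \<otimes> h_2\<close> the counit law restores
  \<open>h\<close>, so that only the crossing remains. At \<open>X = \<one>\<close> the crossing is
  an identity, which gives the left unit law of the diagonal action.\<close>

lemma lam_trivial:
  assumes [simp]: "X \<in> Obj C"
  shows "lam X (\<epsilon> \<otimes> \<iota> X) = \<Phi> H X"
proof -
  have "(\<epsilon> \<otimes> \<iota> X \<otimes> \<iota> H) \<cdot> (\<iota> H \<otimes> \<Phi> H X) = \<Phi> H X \<cdot> (\<epsilon> \<otimes> \<iota> H \<otimes> \<iota> X)"
    using slide[of \<epsilon> "\<Phi> H X" H \<one> "H \<odot> X" "X \<odot> H"] by simp
  note 1 = comp_reduce[OF this]
  have 2: "(\<epsilon> \<otimes> \<iota> H \<otimes> \<iota> X) \<cdot> (\<Delta> \<otimes> \<iota> X) = \<iota> H \<otimes> \<iota> X"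
    using arg_cong[OF comult_counit(1), of "\<lambda>t. t \<otimes> \<iota> X"] by (simp add: whisker_right)
  show ?thesis by (simp add: lam_def 1 2)
qed

lemma left_module_trivial: "X \<in> Obj C \<Longrightarrow> left_module C H \<nabla> \<eta> X (\<epsilon> \<otimes> \<iota> X)"
proof -
  assume [simp]: "X \<in> Obj C"
  have "(\<epsilon> \<otimes> \<iota> X) \<cdot> (\<iota> H \<otimes> \<epsilon> \<otimes> \<iota> X) = (\<epsilon> \<otimes> \<iota> X) \<cdot> (\<nabla> \<otimes> \<iota> X)"
    using slide[of \<epsilon> "\<epsilon> \<otimes> \<iota> X" H \<one> "H \<odot> X" X] arg_cong[OF counit_mult, of "\<lambda>t. t \<otimes> \<iota> X"]
    by (simp add: comp_tensor)
  moreover have "(\<epsilon> \<otimes> \<iota> X) \<cdot> (\<eta> \<otimes> \<iota> X) = \<iota> X"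
    by (simp add: comp_tensor counit_unit)
  ultimately show ?thesis by (simp add: left_module_def hom_iff)
qed

text \<open>\<open>lam_mult\<close> absorbs the product on the first factor and hands
  \<open>h_2 k_2\<close> to the second, where associativity of \<open>\<nu>\<close> applies.\<close>

lemma left_module_tensor:
  assumes M: "left_module C H \<nabla> \<eta> M \<mu>" and N: "left_module C H \<nabla> \<eta> N \<nu>"
  shows "left_module C H \<nabla> \<eta> (M \<odot> N) (tensor_action C \<Phi> H \<Delta> M \<mu> N \<nu>)" (is "left_module _ _ _ _ _ ?t")
proof -
  note [simp] = left_moduleD(1)[OF M] left_moduleD(1)[OF N]
    actD[OF left_moduleD(1)[OF M]] actD[OF left_moduleD(1)[OF N]]
  have "(lam M \<mu> \<otimes> \<iota> N) \<cdot> (\<iota> H \<otimes> \<iota> M \<otimes> \<nu>) = (\<iota> M \<otimes> \<iota> H \<otimes> \<nu>) \<cdot> (lam M \<mu> \<otimes> \<iota> H \<otimes> \<iota> N)"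
    by (simp add: merge_tensors)
  note 1 = comp_reduce[OF this]
  have "(\<iota> M \<otimes> \<nu>) \<cdot> (\<iota> M \<otimes> \<iota> H \<otimes> \<nu>) = (\<iota> M \<otimes> \<nu>) \<cdot> (\<iota> M \<otimes> \<nabla> \<otimes> \<iota> N)"
    by (simp add: comp_tensor left_moduleD(2)[OF N])
  note 2 = comp_reduce[OF this]
  have 3: "(lam M \<mu> \<otimes> \<iota> N) \<cdot> (\<nabla> \<otimes> \<iota> M \<otimes> \<iota> N) =
      (\<iota> M \<otimes> \<nabla> \<otimes> \<iota> N) \<cdot> (lam M \<mu> \<otimes> \<iota> H \<otimes> \<iota> N) \<cdot> (\<iota> H \<otimes> lam M \<mu> \<otimes> \<iota> N)"
    using arg_cong[OF lam_mult[OF M], of "\<lambda>t. t \<otimes> \<iota> N"] by (simp add: whisker_right)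
  have "?t \<cdot> (\<iota> H \<otimes> ?t) = ?t \<cdot> (\<nabla> \<otimes> \<iota> (M \<odot> N))"
    by (simp add: tensor_action_lam whisker_left 1 2 3)
  moreover have "(lam M \<mu> \<otimes> \<iota> N) \<cdot> (\<eta> \<otimes> \<iota> M \<otimes> \<iota> N) = \<iota> M \<otimes> \<eta> \<otimes> \<iota> N"
    using arg_cong[OF lam_unit[OF M], of "\<lambda>t. t \<otimes> \<iota> N"] by (simp add: whisker_right)
  then have "?t \<cdot> (\<eta> \<otimes> \<iota> (M \<odot> N)) = \<iota> (M \<odot> N)"
    by (simp add: tensor_action_lam comp_tensor left_moduleD(3)[OF N])
  ultimately show ?thesis
    using actD[OF act_tensor_action, of M \<mu> N \<nu>] by (simp add: left_module_def hom_iff)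
qed

lemma tensor_action_assoc:
  assumes [simp]: "act M \<mu>" "act N \<nu>" "act P \<pi>"
  shows "tensor_action C \<Phi> H \<Delta> (M \<odot> N) (tensor_action C \<Phi> H \<Delta> M \<mu> N \<nu>) P \<pi> =
    tensor_action C \<Phi> H \<Delta> M \<mu> (N \<odot> P) (tensor_action C \<Phi> H \<Delta> N \<nu> P \<pi>)"
    (is "tensor_action _ _ _ _ _ ?s _ _ = tensor_action _ _ _ _ _ _ _ ?t")
proof -
  note [simp] = actD[OF assms(1)] actD[OF assms(2)] actD[OF assms(3)]
  have "tensor_action C \<Phi> H \<Delta> (M \<odot> N) ?s P \<pi> = (\<iota> (M \<odot> N) \<otimes> \<pi>) \<cdot> (lam (M \<odot> N) ?s \<otimes> \<iota> P)"
    by (intro tensor_action_lam) simp_all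
  also have "\<dots> = (\<iota> M \<otimes> ?t) \<cdot> (lam M \<mu> \<otimes> \<iota> (N \<odot> P))"
    by (simp add: lam_tensor tensor_action_lam[of N] whisker_left whisker_right)
  also have "\<dots> = tensor_action C \<Phi> H \<Delta> M \<mu> (N \<odot> P) ?t"
    by (intro tensor_action_lam[symmetric]) simp_all
  finally show ?thesis .
qed

lemma tensor_action_unit:
  assumes [simp]: "act M \<mu>"
  shows "tensor_action C \<Phi> H \<Delta> \<one> \<epsilon> M \<mu> = \<mu>" "tensor_action C \<Phi> H \<Delta> M \<mu> \<one> \<epsilon> = \<mu>"
proof -
  note [simp] = actD[OF assms(1)]
  have [simp]: "act \<one> \<epsilon>" using act_trivial[of \<one>] by simp
  have "lam \<one> \<epsilon> = \<iota> H" using lam_trivial[of \<one>] by simp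
  then show "tensor_action C \<Phi> H \<Delta> \<one> \<epsilon> M \<mu> = \<mu>" by (simp add: tensor_action_lam)
  show "tensor_action C \<Phi> H \<Delta> M \<mu> \<one> \<epsilon> = \<mu>" by (simp add: tensor_action_lam lam_counit)
qed

lemma left_linear_tensor:
  assumes [simp]: "act M \<mu>" "act N \<nu>" "f \<in> Arr C" "Dom C f = M" "Cod C f = N"
    and f: "left_linear C H \<mu> \<nu> f"
    and [simp]: "act M' \<mu>'" "act N' \<nu>'" "g \<in> Arr C" "Dom C g = M'" "Cod C g = N'"
    and g: "left_linear C H \<mu>' \<nu>' g"
  shows "left_linear C H (tensor_action C \<Phi> H \<Delta> M \<mu> M' \<mu>') (tensor_action C \<Phi> H \<Delta> N \<nu> N' \<nu>') (f \<otimes> g)"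
proof -
  note [simp] = actD[OF assms(1)] actD[OF assms(2)] actD[OF assms(7)] actD[OF assms(8)]
  have "(f \<otimes> g) \<cdot> (\<iota> M \<otimes> \<mu>') = (\<iota> N \<otimes> \<nu>') \<cdot> (f \<otimes> \<iota> H \<otimes> g)"
    using g by (simp add: merge_tensors left_linear_def)
  note 1 = comp_reduce[OF this]
  have "(f \<otimes> \<iota> H \<otimes> g) \<cdot> (lam M \<mu> \<otimes> \<iota> M') = (lam N \<nu> \<otimes> \<iota> N') \<cdot> (\<iota> H \<otimes> f \<otimes> g)"
    using lam_linear[OF assms(1-5) f] by (simp add: merge_tensors)
  with 1 show ?thesis by (simp add: left_linear_def tensor_action_lam)
qed

lemma left_linear_ide: "act M \<mu> \<Longrightarrow> left_linear C H \<mu> \<mu> (\<iota> M)"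
  using actD[of M \<mu>] by (simp add: left_linear_def)

lemma left_linear_comp:
  assumes [simp]: "act M \<mu>" "act N \<nu>" "act P \<pi>"
    "f \<in> Arr C" "Dom C f = M" "Cod C f = N" "g \<in> Arr C" "Dom C g = N" "Cod C g = P"
    and f: "left_linear C H \<mu> \<nu> f" and g: "left_linear C H \<nu> \<pi> g"
  shows "left_linear C H \<mu> \<pi> (g \<cdot> f)"
proof -
  note [simp] = actD[OF assms(1)] actD[OF assms(2)] actD[OF assms(3)]
  have "g \<cdot> \<nu> = \<pi> \<cdot> (\<iota> H \<otimes> g)" using g by (simp add: left_linear_def)
  note 1 = comp_reduce[OF this]
  show ?thesis using f by (simp add: left_linear_def whisker_left 1)
qed

abbreviation Mods where "Mods \<equiv> module_category C \<Phi> H \<nabla> \<eta> \<Delta> \<epsilon>"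

lemma strict_monoidal_Mods: "strict_monoidal_category Mods"
  unfolding module_category_def
proof (rule strict_monoidal_structured_category)
  fix P Q R f g
  assume "P \<in> {(M, \<mu>). left_module C H \<nabla> \<eta> M \<mu>}" "Q \<in> {(M, \<mu>). left_module C H \<nabla> \<eta> M \<mu>}"
    "R \<in> {(M, \<mu>). left_module C H \<nabla> \<eta> M \<mu>}"
    "f \<in> (case P of (M, \<mu>) \<Rightarrow> \<lambda>(N, \<nu>). {f \<in> Hom M N. left_linear C H \<mu> \<nu> f}) Q"
    "g \<in> (case Q of (M, \<mu>) \<Rightarrow> \<lambda>(N, \<nu>). {f \<in> Hom M N. left_linear C H \<mu> \<nu> f}) R"
  then show "g \<cdot> f \<in> (case P of (M, \<mu>) \<Rightarrow> \<lambda>(N, \<nu>). {f \<in> Hom M N. left_linear C H \<mu> \<nu> f}) R"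
    by (auto simp: hom_iff dest!: left_moduleD(1) intro: left_linear_comp)
qed (auto simp: hom_iff left_module_tensor tensor_action_assoc tensor_action_unit left_moduleD(1)
    left_linear_tensor left_linear_ide actD[OF left_moduleD(1)] left_module_trivial[of \<one>, simplified])

end

section \<open>Yetter-Drinfel'd modules and half-braidings\<close>

text \<open>Transparency: the double braiding of \<open>H\<close> with any object is trivial, that
  is, \<open>H\<close> lies in the symmetric (Mueger) center of \<open>C\<close>. The calculations
  use it as \<open>braid_H_inverse\<close>.\<close>

locale transparent_hopf_algebra = hopf_algebra C \<Phi> H mult \<eta> \<Delta> \<epsilon> S
  for C :: "('o, 'a, 'z) strict_moncat_scheme" (structure) and \<Phi> :: "'o \<Rightarrow> 'o \<Rightarrow> 'a"
    and H :: 'o and mult :: 'a ("\<nabla>") and \<eta> \<Delta> \<epsilon> S :: 'a +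
  assumes braid_H: "X \<in> Obj C \<Longrightarrow> \<Phi> H X = inv_arrow C (\<Phi> X H)"
begin

lemma braid_H_inverse:
  assumes "X \<in> Obj C"
  shows "\<Phi> H X \<cdot> \<Phi> X H = \<iota> X \<otimes> \<iota> H" "\<Phi> X H \<cdot> \<Phi> H X = \<iota> H \<otimes> \<iota> X"
  using inverse_arrows_inv[OF braid_iso, of X H] assms by (auto simp: inverse_arrows_def braid_H[symmetric])

section \<open>Comodules and the half-braidings they induce\<close>

definition coact :: "'o \<Rightarrow> 'a \<Rightarrow> bool"
  where "coact M \<rho> \<longleftrightarrow> M \<in> Obj C \<and> \<rho> \<in> Arr C \<and> Dom C \<rho> = M \<and> Cod C \<rho> = M \<odot> H"

lemma coactD:
  assumes "coact M \<rho>"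
  shows "M \<in> Obj C" "\<rho> \<in> Arr C" "Dom C \<rho> = M" "Cod C \<rho> = M \<odot> H"
  using assms by (auto simp: coact_def)

lemma right_comoduleD:
  assumes "right_comodule C H \<Delta> \<epsilon> M \<rho>"
  shows "coact M \<rho>" "(\<rho> \<otimes> \<iota> H) \<cdot> \<rho> = (\<iota> M \<otimes> \<Delta>) \<cdot> \<rho>" "(\<iota> M \<otimes> \<epsilon>) \<cdot> \<rho> = \<iota> M"
  using assms by (auto simp: right_comodule_def coact_def hom_iff)

text \<open>Transparency replaces the inverse braiding, and \<open>lam\<close> absorbs the action on
  the right: \<open>(h_2 m)_0 \<otimes> (h_2 m)_1 h_1 = h_1 m_0 \<otimes> h_2 m_1\<close>. This is
  the shape that linearity of a half-braiding produces.\<close>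

lemma yetter_drinfeld_module_iff:
  "yetter_drinfeld_module C \<Phi> H \<nabla> \<eta> \<Delta> \<epsilon> M \<mu> \<rho> \<longleftrightarrow>
    left_module C H \<nabla> \<eta> M \<mu> \<and> right_comodule C H \<Delta> \<epsilon> M \<rho> \<and>
    (\<iota> M \<otimes> \<nabla>) \<cdot> (\<rho> \<otimes> \<iota> H) \<cdot> \<Phi> H M \<cdot> (\<iota> H \<otimes> \<mu>) \<cdot> (\<Delta> \<otimes> \<iota> M)
      = (\<iota> M \<otimes> \<nabla>) \<cdot> (lam M \<mu> \<otimes> \<iota> H) \<cdot> (\<iota> H \<otimes> \<rho>)"
proof (cases "left_module C H \<nabla> \<eta> M \<mu> \<and> right_comodule C H \<Delta> \<epsilon> M \<rho>")
  case True
  then have M: "left_module C H \<nabla> \<eta> M \<mu>" and R: "right_comodule C H \<Delta> \<epsilon> M \<rho>" by auto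
  note [simp] = left_moduleD(1)[OF M] actD[OF left_moduleD(1)[OF M]] coactD[OF right_comoduleD(1)[OF R]]
  have "(\<iota> M \<otimes> \<nabla>) \<cdot> (\<mu> \<otimes> \<iota> H \<otimes> \<iota> H) = \<mu> \<otimes> \<nabla>" by (simp add: merge_tensors)
  note 1 = comp_reduce[OF this]
  have 2: "(\<Delta> \<otimes> \<iota> M \<otimes> \<iota> H) \<cdot> (\<iota> H \<otimes> \<rho>) = \<Delta> \<otimes> \<rho>" by (simp add: merge_tensors)
  have "(\<iota> M \<otimes> \<nabla>) \<cdot> (lam M \<mu> \<otimes> \<iota> H) \<cdot> (\<iota> H \<otimes> \<rho>) =
      (\<mu> \<otimes> \<nabla>) \<cdot> (\<iota> H \<otimes> \<Phi> H M \<otimes> \<iota> H) \<cdot> (\<Delta> \<otimes> \<rho>)"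
    by (simp add: lam_def whisker_right 1 2)
  then show ?thesis by (auto simp: yetter_drinfeld_module_def braid_H)
qed (auto simp: yetter_drinfeld_module_def)

text \<open>\<open>x \<otimes> m\<close> goes to \<open>m_0 \<otimes> m_1 x\<close>. Since
  \<open>M\<close> contributes only its coaction and \<open>X\<close> only its action,
  \<open>X\<close> can range over all modules; between Yetter-Drinfel'd modules this is the
  underlying arrow of \<open>yd_braiding\<close>.\<close>

definition ind_braiding :: "'o \<Rightarrow> 'a \<Rightarrow> 'o \<Rightarrow> 'a \<Rightarrow> 'a"
  where "ind_braiding M \<rho> X \<nu> = (\<iota> M \<otimes> \<nu>) \<cdot> (\<rho> \<otimes> \<iota> X) \<cdot> \<Phi> X M"

lemma ind_braiding_simps:
  assumes "coact M \<rho>" "act X \<nu>"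
  shows "ind_braiding M \<rho> X \<nu> \<in> Arr C" "Dom C (ind_braiding M \<rho> X \<nu>) = X \<odot> M" "Cod C (ind_braiding M \<rho> X \<nu>) = M \<odot> X"
  using actD[OF assms(2)] coactD[OF assms(1)] by (simp_all add: ind_braiding_def)

lemma ind_braiding_natural:
  assumes M: "coact M \<rho>" and X: "act X \<nu>" and Y: "act Y \<xi>"
    and [simp]: "f \<in> Arr C" "Dom C f = X" "Cod C f = Y" and f: "left_linear C H \<nu> \<xi> f"
  shows "(\<iota> M \<otimes> f) \<cdot> ind_braiding M \<rho> X \<nu> = ind_braiding M \<rho> Y \<xi> \<cdot> (f \<otimes> \<iota> M)"
proof -
  note [simp] = coactD[OF M] actD[OF X] actD[OF Y]
  have "(\<iota> M \<otimes> f) \<cdot> (\<iota> M \<otimes> \<nu>) = (\<iota> M \<otimes> \<xi>) \<cdot> (\<iota> M \<otimes> \<iota> H \<otimes> f)"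
    using f by (simp add: comp_tensor left_linear_def)
  note 1 = comp_reduce[OF this]
  have "(\<iota> M \<otimes> \<iota> H \<otimes> f) \<cdot> (\<rho> \<otimes> \<iota> X) = (\<rho> \<otimes> \<iota> Y) \<cdot> (\<iota> M \<otimes> f)"
    by (simp add: merge_tensors)
  note 2 = comp_reduce[OF this]
  show ?thesis by (simp add: ind_braiding_def 1 2 braid_natural_left[of M f X Y])
qed

text \<open>Both sides are \<open>m_0 \<otimes> m_1 x \<otimes> m_2 y\<close>: the left one
  comultiplies the coaction leg, the right one coacts twice.\<close>

lemma ind_braiding_tensor:
  assumes R: "right_comodule C H \<Delta> \<epsilon> M \<rho>" and X: "act X \<nu>" and Y: "act Y \<xi>"
  shows "ind_braiding M \<rho> (X \<odot> Y) (tensor_action C \<Phi> H \<Delta> X \<nu> Y \<xi>) =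
    (ind_braiding M \<rho> X \<nu> \<otimes> \<iota> Y) \<cdot> (\<iota> X \<otimes> ind_braiding M \<rho> Y \<xi>)"
proof -
  note [simp] = coactD[OF right_comoduleD(1)[OF R]] actD[OF X] actD[OF Y] X Y
  have "(\<Phi> X M \<otimes> \<iota> Y) \<cdot> (\<iota> X \<otimes> \<iota> M \<otimes> \<xi>) = (\<iota> M \<otimes> \<iota> X \<otimes> \<xi>) \<cdot> (\<Phi> X M \<otimes> \<iota> H \<otimes> \<iota> Y)"
    by (simp add: merge_tensors)
  note 1 = comp_reduce[OF this]
  have "(\<rho> \<otimes> \<iota> X) \<cdot> \<Phi> X M = (\<iota> M \<otimes> \<Phi> X H) \<cdot> (\<Phi> X M \<otimes> \<iota> H) \<cdot> (\<iota> X \<otimes> \<rho>)"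
    using braid_natural_right[of X \<rho> M "M \<odot> H"] by (simp add: hexagon_right)
  \<comment> \<open>Naturality of \<open>\<Phi>\<close> in \<open>\<rho>\<close> produces
    \<open>\<Phi> X H\<close>. Transparency moves it to the other side as \<open>\<Phi> H X\<close>,
    the crossing contained in the diagonal action on \<open>X \<odot> Y\<close>.\<close>
  moreover have "(\<iota> M \<otimes> \<Phi> H X) \<cdot> (\<iota> M \<otimes> \<Phi> X H) = \<iota> M \<otimes> \<iota> X \<otimes> \<iota> H"
    by (simp add: comp_tensor braid_H_inverse)
  note comp_reduce[OF this]
  ultimately have "(\<Phi> X M \<otimes> \<iota> H) \<cdot> (\<iota> X \<otimes> \<rho>) = (\<iota> M \<otimes> \<Phi> H X) \<cdot> (\<rho> \<otimes> \<iota> X) \<cdot> \<Phi> X M"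
    by simp
  from arg_cong[OF this, of "\<lambda>t. t \<otimes> \<iota> Y"]
  have "(\<Phi> X M \<otimes> \<iota> H \<otimes> \<iota> Y) \<cdot> (\<iota> X \<otimes> \<rho> \<otimes> \<iota> Y) =
      (\<iota> M \<otimes> \<Phi> H X \<otimes> \<iota> Y) \<cdot> (\<rho> \<otimes> \<iota> X \<otimes> \<iota> Y) \<cdot> (\<Phi> X M \<otimes> \<iota> Y)"
    by (simp add: whisker_right)
  note 2 = comp_reduce[OF this]
  have "(\<rho> \<otimes> \<iota> X \<otimes> \<iota> Y) \<cdot> (\<iota> M \<otimes> \<iota> X \<otimes> \<xi>) =
      (\<iota> M \<otimes> \<iota> H \<otimes> \<iota> X \<otimes> \<xi>) \<cdot> (\<rho> \<otimes> \<iota> X \<otimes> \<iota> H \<otimes> \<iota> Y)"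
    by (simp add: merge_tensors)
  note 3 = comp_reduce[OF this]
  have "(\<iota> M \<otimes> \<nu> \<otimes> \<iota> Y) \<cdot> (\<iota> M \<otimes> \<iota> H \<otimes> \<iota> X \<otimes> \<xi>) =
      (\<iota> M \<otimes> \<iota> X \<otimes> \<xi>) \<cdot> (\<iota> M \<otimes> \<nu> \<otimes> \<iota> H \<otimes> \<iota> Y)"
    by (simp add: merge_tensors)
  note 4 = comp_reduce[OF this]
  have "(\<rho> \<otimes> \<iota> X \<otimes> \<iota> H \<otimes> \<iota> Y) \<cdot> (\<iota> M \<otimes> \<Phi> H X \<otimes> \<iota> Y) =
      (\<iota> M \<otimes> \<iota> H \<otimes> \<Phi> H X \<otimes> \<iota> Y) \<cdot> (\<rho> \<otimes> \<iota> H \<otimes> \<iota> X \<otimes> \<iota> Y)"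
    by (simp add: merge_tensors)
  note 5 = comp_reduce[OF this]
  have "(\<rho> \<otimes> \<iota> H \<otimes> \<iota> X \<otimes> \<iota> Y) \<cdot> (\<rho> \<otimes> \<iota> X \<otimes> \<iota> Y) =
      (\<iota> M \<otimes> \<Delta> \<otimes> \<iota> X \<otimes> \<iota> Y) \<cdot> (\<rho> \<otimes> \<iota> X \<otimes> \<iota> Y)"
    using arg_cong[OF right_comoduleD(2)[OF R], of "\<lambda>t. (t \<otimes> \<iota> X) \<otimes> \<iota> Y"]
    by (simp add: whisker_right)
  note 6 = comp_reduce[OF this]
  show ?thesis
    by (simp add: ind_braiding_def tensor_action_lam lam_def hexagon_left whisker_left whisker_right 1 2 3 4 5 6)
qed

text \<open>Apart from the invertible \<open>\<Phi> X M\<close>, the arrow is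
  \<open>m \<otimes> x \<mapsto> m_0 \<otimes> m_1 x\<close>, with inverse
  \<open>m \<otimes> x \<mapsto> m_0 \<otimes> S(m_1) x\<close>.\<close>

lemma ind_braiding_iso:
  assumes R: "right_comodule C H \<Delta> \<epsilon> M \<rho>" and X: "left_module C H \<nabla> \<eta> X \<nu>"
  shows "is_iso C (ind_braiding M \<rho> X \<nu>)"
proof -
  note [simp] = coactD[OF right_comoduleD(1)[OF R]] actD[OF left_moduleD(1)[OF X]]
  \<comment> \<open>One computation serves both composites: \<open>p\<close> is
    \<open>S \<otimes> \<iota> H\<close> or \<open>\<iota> H \<otimes> S\<close>, and the antipode
    law enters through the condition on \<open>p\<close>.\<close>
  have cancel: "(\<iota> M \<otimes> \<nu>) \<cdot> (\<iota> M \<otimes> \<iota> H \<otimes> \<nu>) \<cdot> (\<iota> M \<otimes> p \<otimes> \<iota> X) \<cdot> (\<rho> \<otimes> \<iota> H \<otimes> \<iota> X) \<cdot> (\<rho> \<otimes> \<iota> X)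
      = \<iota> M \<otimes> \<iota> X"
    if [simp]: "p \<in> Arr C" "Dom C p = H \<odot> H" "Cod C p = H \<odot> H" and p: "\<nabla> \<cdot> p \<cdot> \<Delta> = \<eta> \<cdot> \<epsilon>" for p
  proof -
    have "(\<iota> M \<otimes> \<nu>) \<cdot> (\<iota> M \<otimes> \<iota> H \<otimes> \<nu>) = (\<iota> M \<otimes> \<nu>) \<cdot> (\<iota> M \<otimes> \<nabla> \<otimes> \<iota> X)"
      by (simp add: comp_tensor left_moduleD(2)[OF X])
    note 1 = comp_reduce[OF this]
    have 2: "(\<rho> \<otimes> \<iota> H \<otimes> \<iota> X) \<cdot> (\<rho> \<otimes> \<iota> X) = (\<iota> M \<otimes> \<Delta> \<otimes> \<iota> X) \<cdot> (\<rho> \<otimes> \<iota> X)"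
      using arg_cong[OF right_comoduleD(2)[OF R], of "\<lambda>t. t \<otimes> \<iota> X"] by (simp add: whisker_right)
    have "(\<iota> M \<otimes> \<nabla> \<otimes> \<iota> X) \<cdot> (\<iota> M \<otimes> p \<otimes> \<iota> X) \<cdot> (\<iota> M \<otimes> \<Delta> \<otimes> \<iota> X) \<cdot> (\<rho> \<otimes> \<iota> X) =
        ((\<iota> M \<otimes> \<nabla> \<otimes> \<iota> X) \<cdot> (\<iota> M \<otimes> p \<otimes> \<iota> X) \<cdot> (\<iota> M \<otimes> \<Delta> \<otimes> \<iota> X)) \<cdot> (\<rho> \<otimes> \<iota> X)"
      by simp
    also have "\<dots> = (\<iota> M \<otimes> \<eta> \<otimes> \<iota> X) \<cdot> (\<iota> M \<otimes> \<epsilon> \<otimes> \<iota> X) \<cdot> (\<rho> \<otimes> \<iota> X)"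
      using arg_cong[OF p, of "\<lambda>t. \<iota> M \<otimes> t \<otimes> \<iota> X"] by (simp add: whisker_left whisker_right)
    also have "(\<iota> M \<otimes> \<epsilon> \<otimes> \<iota> X) \<cdot> (\<rho> \<otimes> \<iota> X) = \<iota> M \<otimes> \<iota> X"
      using arg_cong[OF right_comoduleD(3)[OF R], of "\<lambda>t. t \<otimes> \<iota> X"] by (simp add: whisker_right)
    finally have 3: "(\<iota> M \<otimes> \<nabla> \<otimes> \<iota> X) \<cdot> (\<iota> M \<otimes> p \<otimes> \<iota> X) \<cdot> (\<iota> M \<otimes> \<Delta> \<otimes> \<iota> X) \<cdot> (\<rho> \<otimes> \<iota> X) =
        \<iota> M \<otimes> \<eta> \<otimes> \<iota> X"
      by simp
    have "(\<iota> M \<otimes> \<nu>) \<cdot> (\<iota> M \<otimes> \<eta> \<otimes> \<iota> X) = \<iota> M \<otimes> \<iota> X"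
      by (simp add: comp_tensor left_moduleD(3)[OF X])
    then show ?thesis by (simp add: 1 2 3)
  qed
  have "(\<rho> \<otimes> \<iota> X) \<cdot> (\<iota> M \<otimes> \<nu>) = (\<iota> M \<otimes> \<iota> H \<otimes> \<nu>) \<cdot> (\<rho> \<otimes> \<iota> H \<otimes> \<iota> X)"
    by (simp add: merge_tensors)
  note 1 = comp_reduce[OF this]
  have "(\<rho> \<otimes> \<iota> H \<otimes> \<iota> X) \<cdot> (\<iota> M \<otimes> S \<otimes> \<iota> X) = (\<iota> M \<otimes> \<iota> H \<otimes> S \<otimes> \<iota> X) \<cdot> (\<rho> \<otimes> \<iota> H \<otimes> \<iota> X)"
    by (simp add: merge_tensors)
  note 2 = comp_reduce[OF this]
  have "(\<iota> M \<otimes> S \<otimes> \<iota> X) \<cdot> (\<iota> M \<otimes> \<iota> H \<otimes> \<nu>) = (\<iota> M \<otimes> \<iota> H \<otimes> \<nu>) \<cdot> (\<iota> M \<otimes> S \<otimes> \<iota> H \<otimes> \<iota> X)"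
    by (simp add: merge_tensors)
  note 3 = comp_reduce[OF this]
  have "is_iso C ((\<iota> M \<otimes> \<nu>) \<cdot> (\<rho> \<otimes> \<iota> X))"
    using cancel[of "\<iota> H \<otimes> S"] cancel[of "S \<otimes> \<iota> H"] antipode_left antipode_right
    by (intro is_isoI[of _ "M \<odot> X" "M \<odot> X" "(\<iota> M \<otimes> \<nu>) \<cdot> (\<iota> M \<otimes> S \<otimes> \<iota> X) \<cdot> (\<rho> \<otimes> \<iota> X)"])
      (simp_all add: hom_iff 1 2 3)
  from is_iso_comp[OF braid_iso this, of X M "X \<odot> M" "M \<odot> X"]
  show ?thesis by (simp add: ind_braiding_def hom_iff)
qed

text \<open>On \<open>h \<otimes> x \<otimes> m\<close> the two sides are
  \<open>(h_2 m)_0 \<otimes> (h_2 m)_1 h_1 x\<close> and \<open>h_1 m_0 \<otimes> h_2 m_1 x\<close>,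
  which are the two sides of the Yetter-Drinfel'd condition with their \<open>H\<close>-leg acting
  on \<open>x\<close>.\<close>

lemma ind_braiding_linear:
  assumes YD: "yetter_drinfeld_module C \<Phi> H \<nabla> \<eta> \<Delta> \<epsilon> M \<mu> \<rho>" and X: "left_module C H \<nabla> \<eta> X \<nu>"
  shows "left_linear C H (tensor_action C \<Phi> H \<Delta> X \<nu> M \<mu>) (tensor_action C \<Phi> H \<Delta> M \<mu> X \<nu>) (ind_braiding M \<rho> X \<nu>)"
proof -
  from YD have M: "left_module C H \<nabla> \<eta> M \<mu>" and R: "right_comodule C H \<Delta> \<epsilon> M \<rho>"
    and yd: "(\<iota> M \<otimes> \<nabla>) \<cdot> (\<rho> \<otimes> \<iota> H) \<cdot> \<Phi> H M \<cdot> (\<iota> H \<otimes> \<mu>) \<cdot> (\<Delta> \<otimes> \<iota> M)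
      = (\<iota> M \<otimes> \<nabla>) \<cdot> (lam M \<mu> \<otimes> \<iota> H) \<cdot> (\<iota> H \<otimes> \<rho>)"
    by (auto simp: yetter_drinfeld_module_iff)
  note [simp] = left_moduleD(1)[OF M] actD[OF left_moduleD(1)[OF M]] coactD[OF right_comoduleD(1)[OF R]]
    left_moduleD(1)[OF X] actD[OF left_moduleD(1)[OF X]]
  have "(\<iota> M \<otimes> \<nu>) \<cdot> (\<iota> M \<otimes> \<iota> H \<otimes> \<nu>) = (\<iota> M \<otimes> \<nu>) \<cdot> (\<iota> M \<otimes> \<nabla> \<otimes> \<iota> X)"
    by (simp add: comp_tensor left_moduleD(2)[OF X])
  note nu = comp_reduce[OF this]
  have braid_mu: "\<Phi> Y M \<cdot> (\<iota> Y \<otimes> \<mu>) = (\<mu> \<otimes> \<iota> Y) \<cdot> (\<iota> H \<otimes> \<Phi> Y M) \<cdot> (\<Phi> Y H \<otimes> \<iota> M)"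
    if [simp]: "Y \<in> Obj C" for Y
    using braid_natural_right[of Y \<mu> "H \<odot> M" M] by (simp add: hexagon_right)
  have "(lam M \<mu> \<otimes> \<iota> X) \<cdot> (\<iota> H \<otimes> \<iota> M \<otimes> \<nu>) = (\<iota> M \<otimes> \<iota> H \<otimes> \<nu>) \<cdot> (lam M \<mu> \<otimes> \<iota> H \<otimes> \<iota> X)"
    by (simp add: merge_tensors)
  note 1 = comp_reduce[OF this]
  have "(\<iota> M \<otimes> \<nabla> \<otimes> \<iota> X) \<cdot> (lam M \<mu> \<otimes> \<iota> H \<otimes> \<iota> X) \<cdot> (\<iota> H \<otimes> \<rho> \<otimes> \<iota> X) \<cdot> (\<iota> H \<otimes> \<Phi> X M) =
      ((\<iota> M \<otimes> \<nabla> \<otimes> \<iota> X) \<cdot> (lam M \<mu> \<otimes> \<iota> H \<otimes> \<iota> X) \<cdot> (\<iota> H \<otimes> \<rho> \<otimes> \<iota> X)) \<cdot> (\<iota> H \<otimes> \<Phi> X M)"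
    by simp
  also have "(\<iota> M \<otimes> \<nabla> \<otimes> \<iota> X) \<cdot> (lam M \<mu> \<otimes> \<iota> H \<otimes> \<iota> X) \<cdot> (\<iota> H \<otimes> \<rho> \<otimes> \<iota> X) =
      (\<iota> M \<otimes> \<nabla> \<otimes> \<iota> X) \<cdot> (\<rho> \<otimes> \<iota> H \<otimes> \<iota> X) \<cdot> (\<mu> \<otimes> \<iota> H \<otimes> \<iota> X) \<cdot> (\<iota> H \<otimes> \<Phi> H M \<otimes> \<iota> X) \<cdot>
        (\<Phi> H H \<otimes> \<iota> M \<otimes> \<iota> X) \<cdot> (\<Delta> \<otimes> \<iota> M \<otimes> \<iota> X)"
    using arg_cong[OF yd, of "\<lambda>t. t \<otimes> \<iota> X"] comp_reduce[OF braid_mu[of H]] by (simp add: whisker_right)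
  \<comment> \<open>Normal form for the comparison: after the Yetter-Drinfel'd condition the
    coaction is applied later than the action on \<open>M\<close>.\<close>
  finally have R: "tensor_action C \<Phi> H \<Delta> M \<mu> X \<nu> \<cdot> (\<iota> H \<otimes> ind_braiding M \<rho> X \<nu>) =
      (\<iota> M \<otimes> \<nu>) \<cdot> (\<iota> M \<otimes> \<nabla> \<otimes> \<iota> X) \<cdot> (\<rho> \<otimes> \<iota> H \<otimes> \<iota> X) \<cdot> (\<mu> \<otimes> \<iota> H \<otimes> \<iota> X) \<cdot>
        (\<iota> H \<otimes> \<Phi> H M \<otimes> \<iota> X) \<cdot> (\<Phi> H H \<otimes> \<iota> M \<otimes> \<iota> X) \<cdot> (\<Delta> \<otimes> \<iota> M \<otimes> \<iota> X) \<cdot> (\<iota> H \<otimes> \<Phi> X M)"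
    by (simp add: tensor_action_lam ind_braiding_def whisker_left 1 nu)
  have "\<Phi> X H \<cdot> (\<nu> \<otimes> \<iota> H) = (\<iota> H \<otimes> \<nu>) \<cdot> (\<Phi> H H \<otimes> \<iota> X) \<cdot> (\<iota> H \<otimes> \<Phi> X H)"
    using braid_natural_left[of H \<nu> "H \<odot> X" X] by (simp add: hexagon_left)
  note 2 = comp_reduce[OF this]
  have "(\<iota> H \<otimes> \<Phi> X H) \<cdot> (\<iota> H \<otimes> \<Phi> H X) = \<iota> H \<otimes> \<iota> H \<otimes> \<iota> X"
    by (simp add: comp_tensor braid_H_inverse)
  note 3 = comp_reduce[OF this]
  \<comment> \<open>Transparency removes the double crossing of \<open>H\<close> with
    \<open>X\<close>. What remains is the crossing \<open>\<Phi> H H\<close> of the two legs of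
    \<open>\<Delta>\<close>, which the normal form above contains as well.\<close>
  have "\<Phi> X H \<cdot> lam X \<nu> = (\<iota> H \<otimes> \<nu>) \<cdot> (\<Phi> H H \<otimes> \<iota> X) \<cdot> (\<Delta> \<otimes> \<iota> X)"
    by (simp add: lam_def 2 3)
  from arg_cong[OF this, of "\<lambda>t. t \<otimes> \<iota> M"]
  have 4: "(\<Phi> X H \<otimes> \<iota> M) \<cdot> (lam X \<nu> \<otimes> \<iota> M) =
      (\<iota> H \<otimes> \<nu> \<otimes> \<iota> M) \<cdot> (\<Phi> H H \<otimes> \<iota> X \<otimes> \<iota> M) \<cdot> (\<Delta> \<otimes> \<iota> X \<otimes> \<iota> M)"
    by (simp add: whisker_right)
  have "\<Phi> X M \<cdot> (\<nu> \<otimes> \<iota> M) = (\<iota> M \<otimes> \<nu>) \<cdot> (\<Phi> H M \<otimes> \<iota> X) \<cdot> (\<iota> H \<otimes> \<Phi> X M)"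
    using braid_natural_left[of M \<nu> "H \<odot> X" X] by (simp add: hexagon_left)
  from arg_cong[OF this, of "\<lambda>t. \<iota> H \<otimes> t"]
  have "(\<iota> H \<otimes> \<Phi> X M) \<cdot> (\<iota> H \<otimes> \<nu> \<otimes> \<iota> M) =
      (\<iota> H \<otimes> \<iota> M \<otimes> \<nu>) \<cdot> (\<iota> H \<otimes> \<Phi> H M \<otimes> \<iota> X) \<cdot> (\<iota> H \<otimes> \<iota> H \<otimes> \<Phi> X M)"
    by (simp add: whisker_left)
  note 5 = comp_reduce[OF this]
  have "(\<mu> \<otimes> \<iota> X) \<cdot> (\<iota> H \<otimes> \<iota> M \<otimes> \<nu>) = (\<iota> M \<otimes> \<nu>) \<cdot> (\<mu> \<otimes> \<iota> H \<otimes> \<iota> X)"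
    by (simp add: merge_tensors)
  note 6 = comp_reduce[OF this]
  have "(\<rho> \<otimes> \<iota> X) \<cdot> (\<iota> M \<otimes> \<nu>) = (\<iota> M \<otimes> \<iota> H \<otimes> \<nu>) \<cdot> (\<rho> \<otimes> \<iota> H \<otimes> \<iota> X)"
    by (simp add: merge_tensors)
  note 7 = comp_reduce[OF this]
  have "(\<iota> H \<otimes> \<iota> H \<otimes> \<Phi> X M) \<cdot> (\<Phi> H H \<otimes> \<iota> X \<otimes> \<iota> M) = (\<Phi> H H \<otimes> \<iota> M \<otimes> \<iota> X) \<cdot> (\<iota> H \<otimes> \<iota> H \<otimes> \<Phi> X M)"
    by (simp add: merge_tensors)
  note 8 = comp_reduce[OF this]
  have 9: "(\<iota> H \<otimes> \<iota> H \<otimes> \<Phi> X M) \<cdot> (\<Delta> \<otimes> \<iota> X \<otimes> \<iota> M) = (\<Delta> \<otimes> \<iota> M \<otimes> \<iota> X) \<cdot> (\<iota> H \<otimes> \<Phi> X M)"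
    by (simp add: merge_tensors)
  have "ind_braiding M \<rho> X \<nu> \<cdot> tensor_action C \<Phi> H \<Delta> X \<nu> M \<mu> =
      tensor_action C \<Phi> H \<Delta> M \<mu> X \<nu> \<cdot> (\<iota> H \<otimes> ind_braiding M \<rho> X \<nu>)"
    unfolding R
    by (simp add: tensor_action_lam ind_braiding_def comp_reduce[OF braid_mu[of X]] 4 5 6 7 8 9 nu)
  then show ?thesis by (simp add: left_linear_def)
qed

lemma ind_braiding_trivial:
  assumes R: "right_comodule C H \<Delta> \<epsilon> M \<rho>" and [simp]: "X \<in> Obj C"
  shows "ind_braiding M \<rho> X (\<epsilon> \<otimes> \<iota> X) = \<Phi> X M"
proof -
  note [simp] = coactD[OF right_comoduleD(1)[OF R]]
  have "(\<iota> M \<otimes> \<epsilon> \<otimes> \<iota> X) \<cdot> (\<rho> \<otimes> \<iota> X) = \<iota> M \<otimes> \<iota> X"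
    using arg_cong[OF right_comoduleD(3)[OF R], of "\<lambda>t. t \<otimes> \<iota> X"] by (simp add: whisker_right)
  note 1 = comp_reduce[OF this]
  show ?thesis by (simp add: ind_braiding_def 1)
qed

text \<open>Evaluating \<open>m_0 \<otimes> m_1 h\<close> at \<open>h = 1\<close> returns the
  coaction, so the passage from coactions to half-braidings and back is the identity.\<close>

lemma ind_braiding_regular_unit:
  assumes M: "coact M \<rho>"
  shows "ind_braiding M \<rho> H \<nabla> \<cdot> (\<eta> \<otimes> \<iota> M) = \<rho>"
proof -
  note [simp] = coactD[OF M]
  have 1: "\<Phi> H M \<cdot> (\<eta> \<otimes> \<iota> M) = \<iota> M \<otimes> \<eta>"
    using braid_natural_left[of M \<eta> \<one> H] by simp
  have 2: "(\<rho> \<otimes> \<iota> H) \<cdot> (\<iota> M \<otimes> \<eta>) = (\<iota> M \<otimes> \<iota> H \<otimes> \<eta>) \<cdot> \<rho>"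
    using slide[of \<rho> \<eta> M "M \<odot> H" \<one> H] by simp
  have "(\<iota> M \<otimes> \<nabla>) \<cdot> (\<iota> M \<otimes> \<iota> H \<otimes> \<eta>) = \<iota> M \<otimes> \<iota> H"
    by (simp add: comp_tensor mult_unit)
  note 3 = comp_reduce[OF this]
  show ?thesis by (simp add: ind_braiding_def 1 2 3)
qed

text \<open>The leg of \<open>N\<close> acts on the leg of \<open>M\<close> by left multiplication,
  giving \<open>m_0 \<otimes> n_0 \<otimes> n_1 m_1\<close>. This is the origin of
  \<open>\<nabla> \<cdot> \<Phi> H H\<close> in the tensor coaction.\<close>

lemma ind_braiding_tensor_coaction:
  assumes M: "coact M \<rho>" and N: "coact N \<sigma>"
  shows "(\<iota> M \<otimes> ind_braiding N \<sigma> H \<nabla>) \<cdot> (\<rho> \<otimes> \<iota> N) = tensor_coaction C \<Phi> H \<nabla> M \<rho> N \<sigma>"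
proof -
  note [simp] = coactD[OF M] coactD[OF N]
  have "(\<sigma> \<otimes> \<iota> H) \<cdot> \<Phi> H N = (\<iota> N \<otimes> \<Phi> H H) \<cdot> (\<Phi> H N \<otimes> \<iota> H) \<cdot> (\<iota> H \<otimes> \<sigma>)"
    using braid_natural_right[of H \<sigma> N "N \<odot> H"] by (simp add: hexagon_right)
  moreover have "(\<iota> M \<otimes> \<iota> H \<otimes> \<sigma>) \<cdot> (\<rho> \<otimes> \<iota> N) = \<rho> \<otimes> \<sigma>"
    by (simp add: merge_tensors)
  ultimately show ?thesis
    by (simp add: ind_braiding_def tensor_coaction_def whisker_left)
qed

lemma ind_braiding_colinear:
  assumes M: "coact M \<rho>" and N: "coact N \<sigma>" and X: "act X \<nu>"
    and [simp]: "f \<in> Arr C" "Dom C f = M" "Cod C f = N" and f: "right_colinear C H \<rho> \<sigma> f"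
  shows "(f \<otimes> \<iota> X) \<cdot> ind_braiding M \<rho> X \<nu> = ind_braiding N \<sigma> X \<nu> \<cdot> (\<iota> X \<otimes> f)"
proof -
  note [simp] = coactD[OF M] coactD[OF N] actD[OF X]
  have "(f \<otimes> \<iota> X) \<cdot> (\<iota> M \<otimes> \<nu>) = (\<iota> N \<otimes> \<nu>) \<cdot> (f \<otimes> \<iota> H \<otimes> \<iota> X)"
    by (simp add: merge_tensors)
  note 1 = comp_reduce[OF this]
  have "(f \<otimes> \<iota> H \<otimes> \<iota> X) \<cdot> (\<rho> \<otimes> \<iota> X) = (\<sigma> \<otimes> \<iota> X) \<cdot> (f \<otimes> \<iota> X)"
    using arg_cong[OF f[unfolded right_colinear_def], of "\<lambda>t. t \<otimes> \<iota> X"] by (simp add: whisker_right)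
  note 2 = comp_reduce[OF this]
  show ?thesis by (simp add: ind_braiding_def 1 2 braid_natural_right[of X f M N])
qed

end

section \<open>The relative center\<close>

context hopf_algebra
begin

lemma Mods_simps [simp]:
  "(M, \<mu>) \<in> Obj Mods \<longleftrightarrow> left_module C H \<nabla> \<eta> M \<mu>"
  "\<iota>\<^bsub>Mods\<^esub> P = (P, \<iota> (fst P), P)"
  "(Q', g, R) \<cdot>\<^bsub>Mods\<^esub> (P, f, Q) = (P, g \<cdot> f, R)"
  "(M, \<mu>) \<odot>\<^bsub>Mods\<^esub> (N, \<nu>) = (M \<odot> N, tensor_action C \<Phi> H \<Delta> M \<mu> N \<nu>)"
  "(P, f, Q) \<otimes>\<^bsub>Mods\<^esub> (P', f', Q') = (P \<odot>\<^bsub>Mods\<^esub> P', f \<otimes> f', Q \<odot>\<^bsub>Mods\<^esub> Q')"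
  "\<one>\<^bsub>Mods\<^esub> = (\<one>, \<epsilon>)"
  by (simp_all add: module_category_def)

lemma Hom_Mods:
  "x \<in> Hom\<^bsub>Mods\<^esub> (M, \<mu>) (N, \<nu>) \<longleftrightarrow>
    (\<exists>f. x = ((M, \<mu>), f, (N, \<nu>)) \<and> left_module C H \<nabla> \<eta> M \<mu> \<and> left_module C H \<nabla> \<eta> N \<nu> \<and>
      f \<in> Hom M N \<and> left_linear C H \<mu> \<nu> f)"
  by (auto simp: module_category_def)

lemma left_linear_inverse:
  assumes \<mu>: "act M \<mu>" and \<nu>: "act N \<nu>"
    and f: "f \<in> Hom M N" "left_linear C H \<mu> \<nu> f" and g: "g \<in> Hom N M" "g \<cdot> f = \<iota> M" "f \<cdot> g = \<iota> N"
  shows "left_linear C H \<nu> \<mu> g"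
proof -
  have [simp]: "f \<in> Arr C" "Dom C f = M" "Cod C f = N" "g \<in> Arr C" "Dom C g = N" "Cod C g = M"
    using f g by (auto simp: hom_iff)
  note [simp] = actD[OF \<mu>] actD[OF \<nu>]
  have "g \<cdot> \<nu> = g \<cdot> (\<nu> \<cdot> (\<iota> H \<otimes> f)) \<cdot> (\<iota> H \<otimes> g)"
    by (simp add: comp_tensor g)
  also have "\<dots> = g \<cdot> (f \<cdot> \<mu>) \<cdot> (\<iota> H \<otimes> g)"
    using f(2) by (simp add: left_linear_def del: comp_assoc_arr)
  also have "\<dots> = \<mu> \<cdot> (\<iota> H \<otimes> g)"
    by (simp add: comp_reduce[OF g(2)])
  finally show ?thesis by (simp add: left_linear_def)
qed

text \<open>The inverse in \<open>C\<close> of a linear arrow is linear, so invertibility can be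
  tested on underlying arrows.\<close>

lemma is_iso_Mods:
  assumes M: "left_module C H \<nabla> \<eta> M \<mu>" and N: "left_module C H \<nabla> \<eta> N \<nu>"
    and f: "f \<in> Hom M N" "left_linear C H \<mu> \<nu> f" and iso: "is_iso C f"
  shows "is_iso Mods ((M, \<mu>), f, (N, \<nu>))"
proof -
  obtain g where g: "g \<in> Hom N M" "g \<cdot> f = \<iota> M" "f \<cdot> g = \<iota> N"
    using is_isoE[OF iso f(1)] by blast
  moreover have "left_linear C H \<nu> \<mu> g"
    using left_linear_inverse[OF left_moduleD(1)[OF M] left_moduleD(1)[OF N] f g] .
  ultimately show ?thesis
    unfolding module_category_def using M N f by (intro is_iso_structured_category) auto
qed

section \<open>Underlying arrows of half-braidings over modules\<close>

abbreviation under :: "'p \<times> 'b \<times> 'q \<Rightarrow> 'b" where "under x \<equiv> fst (snd x)"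

text \<open>The endpoints of a component are forced by its type, so the information in a
  half-braiding over modules is its underlying arrows in \<open>C\<close>.\<close>

lemma half_braiding_component:
  assumes c: "half_braiding Mods (M, \<mu>) c" and X: "left_module C H \<nabla> \<eta> X \<nu>"
  obtains u where "c (X, \<nu>) = ((X, \<nu>) \<odot>\<^bsub>Mods\<^esub> (M, \<mu>), u, (M, \<mu>) \<odot>\<^bsub>Mods\<^esub> (X, \<nu>))"
    "u \<in> Hom (X \<odot> M) (M \<odot> X)"
    "left_linear C H (tensor_action C \<Phi> H \<Delta> X \<nu> M \<mu>) (tensor_action C \<Phi> H \<Delta> M \<mu> X \<nu>) u"
proof -
  have "c (X, \<nu>) \<in> Hom\<^bsub>Mods\<^esub> ((X, \<nu>) \<odot>\<^bsub>Mods\<^esub> (M, \<mu>)) ((M, \<mu>) \<odot>\<^bsub>Mods\<^esub> (X, \<nu>))"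
    using c X unfolding half_braiding_def by (metis Mods_simps(1))
  then show ?thesis using that by (auto simp: Hom_Mods)
qed

lemma half_braiding_under_natural:
  assumes c: "half_braiding Mods (M, \<mu>) c"
    and X: "left_module C H \<nabla> \<eta> X \<nu>" and Y: "left_module C H \<nabla> \<eta> Y \<xi>"
    and f: "f \<in> Hom X Y" "left_linear C H \<nu> \<xi> f"
  shows "(\<iota> M \<otimes> f) \<cdot> under (c (X, \<nu>)) = under (c (Y, \<xi>)) \<cdot> (f \<otimes> \<iota> M)"
proof -
  obtain u where u: "c (X, \<nu>) = ((X, \<nu>) \<odot>\<^bsub>Mods\<^esub> (M, \<mu>), u, (M, \<mu>) \<odot>\<^bsub>Mods\<^esub> (X, \<nu>))"
    using half_braiding_component[OF c X] by blast
  obtain v where v: "c (Y, \<xi>) = ((Y, \<xi>) \<odot>\<^bsub>Mods\<^esub> (M, \<mu>), v, (M, \<mu>) \<odot>\<^bsub>Mods\<^esub> (Y, \<xi>))"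
    using half_braiding_component[OF c Y] by blast
  have "((X, \<nu>), f, (Y, \<xi>)) \<in> Hom\<^bsub>Mods\<^esub> (X, \<nu>) (Y, \<xi>)"
    using X Y f by (simp add: Hom_Mods)
  then have "(\<iota>\<^bsub>Mods\<^esub> (M, \<mu>) \<otimes>\<^bsub>Mods\<^esub> ((X, \<nu>), f, (Y, \<xi>))) \<cdot>\<^bsub>Mods\<^esub> c (X, \<nu>) =
      c (Y, \<xi>) \<cdot>\<^bsub>Mods\<^esub> (((X, \<nu>), f, (Y, \<xi>)) \<otimes>\<^bsub>Mods\<^esub> \<iota>\<^bsub>Mods\<^esub> (M, \<mu>))"
    using c X Y unfolding half_braiding_def by (metis Mods_simps(1))
  then show ?thesis by (simp add: u v)
qed

lemma half_braiding_under_tensor: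
  assumes c: "half_braiding Mods (M, \<mu>) c"
    and X: "left_module C H \<nabla> \<eta> X \<nu>" and Y: "left_module C H \<nabla> \<eta> Y \<xi>"
  shows "under (c ((X, \<nu>) \<odot>\<^bsub>Mods\<^esub> (Y, \<xi>))) =
    (under (c (X, \<nu>)) \<otimes> \<iota> Y) \<cdot> (\<iota> X \<otimes> under (c (Y, \<xi>)))"
proof -
  obtain u where u: "c (X, \<nu>) = ((X, \<nu>) \<odot>\<^bsub>Mods\<^esub> (M, \<mu>), u, (M, \<mu>) \<odot>\<^bsub>Mods\<^esub> (X, \<nu>))"
    using half_braiding_component[OF c X] by blast
  obtain v where v: "c (Y, \<xi>) = ((Y, \<xi>) \<odot>\<^bsub>Mods\<^esub> (M, \<mu>), v, (M, \<mu>) \<odot>\<^bsub>Mods\<^esub> (Y, \<xi>))"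
    using half_braiding_component[OF c Y] by blast
  have "c ((X, \<nu>) \<odot>\<^bsub>Mods\<^esub> (Y, \<xi>)) =
      (c (X, \<nu>) \<otimes>\<^bsub>Mods\<^esub> \<iota>\<^bsub>Mods\<^esub> (Y, \<xi>)) \<cdot>\<^bsub>Mods\<^esub> (\<iota>\<^bsub>Mods\<^esub> (X, \<nu>) \<otimes>\<^bsub>Mods\<^esub> c (Y, \<xi>))"
    using strict_monoidal_category.half_braiding_tensor[OF strict_monoidal_Mods c] X Y by (metis Mods_simps(1))
  then show ?thesis by (simp add: u v)
qed

lemma left_module_regular: "left_module C H \<nabla> \<eta> H \<nabla>"
  by (simp add: left_module_def hom_iff mult_assoc mult_unit)

section \<open>The relative center and its braiding\<close>

definition relative_half_braiding where
  "relative_half_braiding M \<mu> c \<longleftrightarrow> left_module C H \<nabla> \<eta> M \<mu> \<and> half_braiding Mods (M, \<mu>) c \<and>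
    (\<forall>X \<in> Obj C. c (trivial_module C \<epsilon> X) =
      (trivial_module C \<epsilon> X \<odot>\<^bsub>Mods\<^esub> (M, \<mu>), \<Phi> X M, (M, \<mu>) \<odot>\<^bsub>Mods\<^esub> trivial_module C \<epsilon> X))"

abbreviation RC where "RC \<equiv> relative_center C \<Phi> H \<nabla> \<eta> \<Delta> \<epsilon>"
abbreviation YD where "YD \<equiv> yd_category C \<Phi> H \<nabla> \<eta> \<Delta> \<epsilon>"
abbreviation yd where "yd \<equiv> yetter_drinfeld_module C \<Phi> H \<nabla> \<eta> \<Delta> \<epsilon>"

lemma relative_center_eq:
  "RC = full_subcategory (right_center Mods) {((M, \<mu>), c). relative_half_braiding M \<mu> c}"
  unfolding relative_center_def relative_half_braiding_def
  by (rule arg_cong[of _ _ "full_subcategory _"]) (auto simp: right_center_def)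

lemma RC_simps:
  "Obj RC = {((M, \<mu>), c). relative_half_braiding M \<mu> c}"
  "\<iota>\<^bsub>RC\<^esub> P = (P, \<iota>\<^bsub>Mods\<^esub> (fst P), P)"
  "(Q', g, R) \<cdot>\<^bsub>RC\<^esub> (P, f, Q) = (P, g \<cdot>\<^bsub>Mods\<^esub> f, R)"
  "P \<odot>\<^bsub>RC\<^esub> Q = center_tensor Mods P Q"
  "(P, f, Q) \<otimes>\<^bsub>RC\<^esub> (P', f', Q') = (center_tensor Mods P P', f \<otimes>\<^bsub>Mods\<^esub> f', center_tensor Mods Q Q')"
  "\<one>\<^bsub>RC\<^esub> = (\<one>\<^bsub>Mods\<^esub>, \<lambda>X \<in> Obj Mods. \<iota>\<^bsub>Mods\<^esub> X)"
  by (simp_all add: relative_center_eq full_subcategory_def right_center_def)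

lemma Arr_RC:
  "x \<in> Arr RC \<longleftrightarrow> (\<exists>M \<mu> c f N \<nu> d. x = (((M, \<mu>), c), ((M, \<mu>), f, (N, \<nu>)), ((N, \<nu>), d)) \<and>
    relative_half_braiding M \<mu> c \<and> relative_half_braiding N \<nu> d \<and>
    f \<in> Hom M N \<and> left_linear C H \<mu> \<nu> f \<and>
    ((M, \<mu>), f, (N, \<nu>)) \<in> center_hom Mods ((M, \<mu>), c) ((N, \<nu>), d))"
  by (auto simp: relative_center_eq full_subcategory_def right_center_def relative_half_braiding_def
      Hom_Mods center_hom_def elim!: Arr_structured_categoryE)

lemma Dom_RC: "Dom RC (P, f, Q) = P" and Cod_RC: "Cod RC (P, f, Q) = Q"
  by (simp_all add: relative_center_eq full_subcategory_def right_center_def)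

lemma braided_RC: "braided_category RC (center_braiding Mods)"
proof -
  interpret Mods: strict_monoidal_category Mods by (rule strict_monoidal_Mods)
  interpret Z: braided_category "right_center Mods" "center_braiding Mods" by (rule Mods.braided_right_center)
  have Obj: "((M, \<mu>), c) \<in> Obj (right_center Mods) \<longleftrightarrow> left_module C H \<nabla> \<eta> M \<mu> \<and> half_braiding Mods (M, \<mu>) c"
    for M \<mu> c by (simp add: right_center_def)
  show ?thesis
    unfolding relative_center_eq
  proof (rule braided_full_subcategory[OF Mods.braided_right_center])
    show "{((M, \<mu>), c). relative_half_braiding M \<mu> c} \<subseteq> Obj (right_center Mods)"
      by (auto simp: Obj relative_half_braiding_def)
    have "\<one>\<^bsub>right_center Mods\<^esub> = ((\<one>, \<epsilon>), \<lambda>X \<in> Obj Mods. \<iota>\<^bsub>Mods\<^esub> X)"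
      by (simp add: right_center_def)
    \<comment> \<open>The condition on trivial modules holds because \<open>\<Phi> X \<one>\<close>
      is an identity; \<open>tensor_action_unit\<close> matches the endpoints.\<close>
    moreover have "relative_half_braiding \<one> \<epsilon> (\<lambda>X \<in> Obj Mods. \<iota>\<^bsub>Mods\<^esub> X)"
      using Z.unit_obj
      by (auto simp: calculation Obj relative_half_braiding_def trivial_module_def left_module_trivial
          tensor_action_unit)
    ultimately show "\<one>\<^bsub>right_center Mods\<^esub> \<in> {((M, \<mu>), c). relative_half_braiding M \<mu> c}"
      by simp
    fix P Q
    assume "P \<in> {((M, \<mu>), c). relative_half_braiding M \<mu> c}"
      "Q \<in> {((M, \<mu>), c). relative_half_braiding M \<mu> c}"
    then obtain M \<mu> c N \<nu> d where P: "P = ((M, \<mu>), c)" and c: "relative_half_braiding M \<mu> c"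
      and Q: "Q = ((N, \<nu>), d)" and d: "relative_half_braiding N \<nu> d" by auto
    have M: "left_module C H \<nabla> \<eta> M \<mu>" and N: "left_module C H \<nabla> \<eta> N \<nu>"
      using c d by (auto simp: relative_half_braiding_def)
    note [simp] = left_moduleD(1)[OF M] left_moduleD(1)[OF N]
      actD[OF left_moduleD(1)[OF M]] actD[OF left_moduleD(1)[OF N]]
    let ?e = "\<lambda>X \<in> Obj Mods. (\<iota>\<^bsub>Mods\<^esub> (M, \<mu>) \<otimes>\<^bsub>Mods\<^esub> d X) \<cdot>\<^bsub>Mods\<^esub> (c X \<otimes>\<^bsub>Mods\<^esub> \<iota>\<^bsub>Mods\<^esub> (N, \<nu>))"
    have PQ: "P \<odot>\<^bsub>right_center Mods\<^esub> Q = ((M, \<mu>) \<odot>\<^bsub>Mods\<^esub> (N, \<nu>), ?e)"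
      by (simp add: P Q right_center_def center_tensor_def)
    have "P \<odot>\<^bsub>right_center Mods\<^esub> Q \<in> Obj (right_center Mods)"
      using c d by (intro Z.tensor_obj) (auto simp: P Q Obj relative_half_braiding_def)
    then have "half_braiding Mods ((M, \<mu>) \<odot>\<^bsub>Mods\<^esub> (N, \<nu>)) ?e"
      unfolding PQ by (simp add: Obj)
    \<comment> \<open>The right hexagon of \<open>\<Phi>\<close> has the shape of the tensor product
      of half-braidings; the endpoints agree by associativity of the diagonal action.\<close>
    moreover have "?e (trivial_module C \<epsilon> X) =
        (trivial_module C \<epsilon> X \<odot>\<^bsub>Mods\<^esub> ((M, \<mu>) \<odot>\<^bsub>Mods\<^esub> (N, \<nu>)), \<Phi> X (M \<odot> N),
         ((M, \<mu>) \<odot>\<^bsub>Mods\<^esub> (N, \<nu>)) \<odot>\<^bsub>Mods\<^esub> trivial_module C \<epsilon> X)" if [simp]: "X \<in> Obj C" for X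
      using c d
      by (simp add: relative_half_braiding_def trivial_module_def left_module_trivial tensor_action_assoc hexagon_right)
    ultimately show "P \<odot>\<^bsub>right_center Mods\<^esub> Q \<in> {((M, \<mu>), c). relative_half_braiding M \<mu> c}"
      unfolding PQ by (simp add: relative_half_braiding_def left_module_tensor[OF M N])
  qed
qed

end

section \<open>From half-braidings to Yetter-Drinfel'd modules\<close>

context transparent_hopf_algebra
begin

text \<open>This is the bialgebra axiom \<open>comult_mult\<close>. It permits naturality of a
  half-braiding at \<open>\<Delta>\<close>, the source of coassociativity of the coaction.\<close>

lemma left_linear_comult: "left_linear C H \<nabla> (tensor_action C \<Phi> H \<Delta> H \<nabla> H \<nabla>) \<Delta>"
proof -
  have "(\<Delta> \<otimes> \<iota> H \<otimes> \<iota> H) \<cdot> (\<iota> H \<otimes> \<Delta>) = \<Delta> \<otimes> \<Delta>"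
    by (simp add: comp_tensor comp_tensor_right2)
  then show ?thesis by (simp add: left_linear_def tensor_action_def comult_mult)
qed

lemma left_linear_counit: "left_linear C H \<nabla> \<epsilon> \<epsilon>"
proof -
  have "\<epsilon> \<cdot> (\<iota> H \<otimes> \<epsilon>) = \<epsilon> \<otimes> \<epsilon>"
    using slide[of \<epsilon> \<epsilon> H \<one> H \<one>] comp_tensor[of "\<iota> H" \<epsilon> \<epsilon> "\<iota> \<one>"] by simp
  then show ?thesis by (simp add: left_linear_def counit_mult)
qed

text \<open>\<open>h_1 k \<otimes> \<epsilon>(h_2) x = h k \<otimes> x\<close>, the action of the
  free module on \<open>X\<close>. For this action, associativity of \<open>\<nu>\<close> says that
  \<open>\<nu>\<close> is linear.\<close>

lemma regular_tensor_trivial: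
  assumes [simp]: "X \<in> Obj C"
  shows "tensor_action C \<Phi> H \<Delta> H \<nabla> X (\<epsilon> \<otimes> \<iota> X) = \<nabla> \<otimes> \<iota> X"
proof -
  have "act H \<nabla>" using left_moduleD(1)[OF left_module_regular] .
  then show ?thesis
    using arg_cong[OF lam_counit, of H \<nabla> "\<lambda>t. t \<otimes> \<iota> X"] by (simp add: tensor_action_lam whisker_right)
qed

definition ind_coaction :: "'o \<Rightarrow> ('o \<times> 'a \<Rightarrow> ('o, 'a) module_arrow) \<Rightarrow> 'a"
  where "ind_coaction M c = under (c (H, \<nabla>)) \<cdot> (\<eta> \<otimes> \<iota> M)"

context
  fixes M \<mu> c
  assumes c: "relative_half_braiding M \<mu> c"
begin

lemma relative_module: "left_module C H \<nabla> \<eta> M \<mu>" and relative_half: "half_braiding Mods (M, \<mu>) c"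
  using c by (auto simp: relative_half_braiding_def)

lemma relative_trivial: "X \<in> Obj C \<Longrightarrow> under (c (X, \<epsilon> \<otimes> \<iota> X)) = \<Phi> X M"
  using c by (auto simp: relative_half_braiding_def trivial_module_def)

lemma relative_under:
  assumes "left_module C H \<nabla> \<eta> X \<nu>"
  shows "under (c (X, \<nu>)) \<in> Arr C" "Dom C (under (c (X, \<nu>))) = X \<odot> M" "Cod C (under (c (X, \<nu>))) = M \<odot> X"
    "left_linear C H (tensor_action C \<Phi> H \<Delta> X \<nu> M \<mu>) (tensor_action C \<Phi> H \<Delta> M \<mu> X \<nu>) (under (c (X, \<nu>)))"
  using half_braiding_component[OF relative_half assms] by (force simp: hom_iff)+

lemma coact_ind_coaction: "coact M (ind_coaction M c)"
  using relative_under[OF left_module_regular] actD[OF left_moduleD(1)[OF relative_module]]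
  by (simp add: coact_def ind_coaction_def)

lemma under_eq_ind_braiding:
  assumes X: "left_module C H \<nabla> \<eta> X \<nu>"
  shows "under (c (X, \<nu>)) = ind_braiding M (ind_coaction M c) X \<nu>"
proof -
  note [simp] = actD[OF left_moduleD(1)[OF relative_module]] actD[OF left_moduleD(1)[OF X]]
    relative_under(1-3)[OF left_module_regular] relative_under(1-3)[OF X] coactD[OF coact_ind_coaction]
  have "left_module C H \<nabla> \<eta> (H \<odot> X) (\<nabla> \<otimes> \<iota> X)"
    using left_module_tensor[OF left_module_regular left_module_trivial, of X]
    by (simp add: regular_tensor_trivial)
  from half_braiding_under_natural[OF relative_half this X, of \<nu>]
  have 1: "under (c (X, \<nu>)) \<cdot> (\<nu> \<otimes> \<iota> M) = (\<iota> M \<otimes> \<nu>) \<cdot> under (c (H \<odot> X, \<nabla> \<otimes> \<iota> X))"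
    by (simp add: hom_iff left_linear_def left_moduleD(2)[OF X])
  \<comment> \<open>Multiplicativity splits the component at the free module; on the trivial factor
    it is \<open>\<Phi>\<close>, so only the component at \<open>H\<close> remains.\<close>
  have 2: "under (c (H \<odot> X, \<nabla> \<otimes> \<iota> X)) = (under (c (H, \<nabla>)) \<otimes> \<iota> X) \<cdot> (\<iota> H \<otimes> \<Phi> X M)"
    using half_braiding_under_tensor[OF relative_half left_module_regular left_module_trivial, of X]
    by (simp add: regular_tensor_trivial relative_trivial)
  have 3: "(\<iota> H \<otimes> \<Phi> X M) \<cdot> (\<eta> \<otimes> \<iota> X \<otimes> \<iota> M) = (\<eta> \<otimes> \<iota> M \<otimes> \<iota> X) \<cdot> \<Phi> X M"
    using slide[of \<eta> "\<Phi> X M" \<one> H "X \<odot> M" "M \<odot> X"] by simp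
  \<comment> \<open>The unit splits the action, so the component at the free module determines the
    one at \<open>X\<close>.\<close>
  have "(\<nu> \<otimes> \<iota> M) \<cdot> (\<eta> \<otimes> \<iota> X \<otimes> \<iota> M) = \<iota> X \<otimes> \<iota> M"
    using arg_cong[OF left_moduleD(3)[OF X], of "\<lambda>t. t \<otimes> \<iota> M"] by (simp add: whisker_right)
  then have "under (c (X, \<nu>)) = under (c (X, \<nu>)) \<cdot> (\<nu> \<otimes> \<iota> M) \<cdot> (\<eta> \<otimes> \<iota> X \<otimes> \<iota> M)" by simp
  also have "\<dots> = (\<iota> M \<otimes> \<nu>) \<cdot> (under (c (H, \<nabla>)) \<otimes> \<iota> X) \<cdot> (\<eta> \<otimes> \<iota> M \<otimes> \<iota> X) \<cdot> \<Phi> X M"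
    by (simp add: comp_reduce[OF 1] 2 3)
  also have "\<dots> = ind_braiding M (ind_coaction M c) X \<nu>"
    by (simp add: ind_braiding_def ind_coaction_def whisker_right)
  finally show ?thesis .
qed

text \<open>Coassociativity combines naturality at \<open>\<Delta>\<close>, multiplicativity at
  \<open>H \<odot> H\<close> and \<open>\<Delta> \<cdot> \<eta> = \<eta> \<otimes> \<eta>\<close>.
  The counit law is naturality at \<open>\<epsilon>\<close>, seen as a map from the regular module
  to the unit module.\<close>

lemma right_comodule_ind_coaction: "right_comodule C H \<Delta> \<epsilon> M (ind_coaction M c)"
proof -
  note reg = left_module_regular
  note [simp] = actD[OF left_moduleD(1)[OF relative_module]] relative_under(1-3)[OF reg] coactD[OF coact_ind_coaction]
  let ?u = "under (c (H, \<nabla>))"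
  have "(\<iota> M \<otimes> \<Delta>) \<cdot> ?u = (?u \<otimes> \<iota> H) \<cdot> (\<iota> H \<otimes> ?u) \<cdot> (\<Delta> \<otimes> \<iota> M)"
    using half_braiding_under_natural[OF relative_half reg left_module_tensor[OF reg reg], of \<Delta>]
      half_braiding_under_tensor[OF relative_half reg reg]
    by (simp add: hom_iff left_linear_comult)
  note 1 = comp_reduce[OF this]
  have 2: "(\<Delta> \<otimes> \<iota> M) \<cdot> (\<eta> \<otimes> \<iota> M) = (\<iota> H \<otimes> \<eta> \<otimes> \<iota> M) \<cdot> (\<eta> \<otimes> \<iota> M)"
    using arg_cong[OF comult_unit, of "\<lambda>t. t \<otimes> \<iota> M"] slide[of \<eta> "\<eta> \<otimes> \<iota> M" \<one> H M "H \<odot> M"]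
      comp_tensor[of \<eta> "\<iota> H" "\<iota> M" "\<eta> \<otimes> \<iota> M"]
    by (simp add: whisker_right)
  have "(\<iota> H \<otimes> ind_coaction M c) \<cdot> (\<eta> \<otimes> \<iota> M) = (\<eta> \<otimes> \<iota> M \<otimes> \<iota> H) \<cdot> ind_coaction M c"
    using slide[of \<eta> "ind_coaction M c" \<one> H M "M \<odot> H"] by simp
  then have 3: "(\<iota> H \<otimes> ?u) \<cdot> (\<iota> H \<otimes> \<eta> \<otimes> \<iota> M) \<cdot> (\<eta> \<otimes> \<iota> M) =
      (\<eta> \<otimes> \<iota> M \<otimes> \<iota> H) \<cdot> ?u \<cdot> (\<eta> \<otimes> \<iota> M)"
    by (simp add: ind_coaction_def whisker_left)
  have "(ind_coaction M c \<otimes> \<iota> H) \<cdot> ind_coaction M c = (\<iota> M \<otimes> \<Delta>) \<cdot> ind_coaction M c"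
    by (simp add: ind_coaction_def whisker_right 1 2 3)
  \<comment> \<open>The unit module is the trivial module on \<open>\<one>\<close>, so its component
    is \<open>\<Phi> \<one> M\<close>, an identity.\<close>
  moreover have "under (c (\<one>, \<epsilon>)) = \<iota> M"
    using relative_trivial[of \<one>] by simp
  then have "(\<iota> M \<otimes> \<epsilon>) \<cdot> ?u = \<epsilon> \<otimes> \<iota> M"
    using half_braiding_under_natural[OF relative_half reg, of \<one> \<epsilon> \<epsilon>] left_module_trivial[of \<one>]
    by (simp add: hom_iff left_linear_counit)
  note comp_reduce[OF this]
  then have "(\<iota> M \<otimes> \<epsilon>) \<cdot> ind_coaction M c = \<iota> M"
    by (simp add: ind_coaction_def comp_tensor counit_unit)
  ultimately show ?thesis by (simp add: right_comodule_def hom_iff)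
qed

text \<open>The condition is linearity of the component at \<open>H\<close>, with the unit inserted
  into the regular factor: \<open>h\<close> acts on \<open>1 \<otimes> m\<close>.\<close>

lemma yetter_drinfeld_ind_coaction: "yd M \<mu> (ind_coaction M c)"
proof -
  note reg = left_module_regular
  note [simp] = left_moduleD(1)[OF relative_module] actD[OF left_moduleD(1)[OF relative_module]] left_moduleD(1)[OF reg]
    relative_under(1-3)[OF reg] coactD[OF coact_ind_coaction]
  let ?u = "under (c (H, \<nabla>))"
  have "(\<Delta> \<otimes> \<iota> H) \<cdot> (\<iota> H \<otimes> \<eta>) = (\<iota> H \<otimes> \<iota> H \<otimes> \<eta>) \<cdot> \<Delta>"
    using slide[of \<Delta> \<eta> H "H \<odot> H" \<one> H] by simp
  moreover have "\<Phi> H H \<cdot> (\<iota> H \<otimes> \<eta>) = \<eta> \<otimes> \<iota> H"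
    using braid_natural_right[of H \<eta> \<one> H] by simp
  then have "(\<iota> H \<otimes> \<Phi> H H) \<cdot> (\<iota> H \<otimes> \<iota> H \<otimes> \<eta>) = \<iota> H \<otimes> \<eta> \<otimes> \<iota> H"
    by (simp add: comp_tensor)
  note comp_reduce[OF this]
  moreover have "(\<nabla> \<otimes> \<iota> H) \<cdot> (\<iota> H \<otimes> \<eta> \<otimes> \<iota> H) = \<iota> H \<otimes> \<iota> H"
    using arg_cong[OF mult_unit(2), of "\<lambda>t. t \<otimes> \<iota> H"] by (simp add: whisker_right)
  note comp_reduce[OF this]
  \<comment> \<open>\<open>h_1 1 \<otimes> h_2\<close> is the bare comultiplication, the form in
    which \<open>h\<close> enters the left-hand side of the Yetter-Drinfel'd condition.\<close>
  ultimately have "lam H \<nabla> \<cdot> (\<iota> H \<otimes> \<eta>) = \<Delta>" by (simp add: lam_def)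
  from arg_cong[OF this, of "\<lambda>t. t \<otimes> \<iota> M"]
  have 1: "(lam H \<nabla> \<otimes> \<iota> M) \<cdot> (\<iota> H \<otimes> \<eta> \<otimes> \<iota> M) = \<Delta> \<otimes> \<iota> M"
    by (simp add: whisker_right)
  have "(?u \<cdot> (\<iota> H \<otimes> \<mu>) \<cdot> (lam H \<nabla> \<otimes> \<iota> M)) \<cdot> (\<iota> H \<otimes> \<eta> \<otimes> \<iota> M) =
      ((\<iota> M \<otimes> \<nabla>) \<cdot> (lam M \<mu> \<otimes> \<iota> H) \<cdot> (\<iota> H \<otimes> ?u)) \<cdot> (\<iota> H \<otimes> \<eta> \<otimes> \<iota> M)"
    using relative_under(4)[OF reg] by (simp add: left_linear_def tensor_action_lam)
  then have "?u \<cdot> (\<iota> H \<otimes> \<mu>) \<cdot> (\<Delta> \<otimes> \<iota> M) =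
      (\<iota> M \<otimes> \<nabla>) \<cdot> (lam M \<mu> \<otimes> \<iota> H) \<cdot> (\<iota> H \<otimes> ind_coaction M c)"
    by (simp add: 1 ind_coaction_def whisker_left)
  \<comment> \<open>Writing the component at \<open>H\<close> as \<open>ind_braiding\<close>
    supplies the coaction, crossing and multiplication still missing on the left.\<close>
  then show ?thesis
    by (simp add: yetter_drinfeld_module_iff relative_module right_comodule_ind_coaction
        under_eq_ind_braiding[OF reg] ind_braiding_def)
qed

end

section \<open>Mutually inverse assignments on objects and arrows\<close>

definition yd_of
  where "yd_of = (\<lambda>((M, \<mu>), c). (M, \<mu>, ind_coaction M c))"

definition yd_arrow_of
  where "yd_arrow_of = (\<lambda>(P, x, Q). (yd_of P, under x, yd_of Q))"

text \<open>Restricted to \<open>Obj Mods\<close> because half-braidings are required to be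
  extensional.\<close>

definition ind_half_braiding
  where "ind_half_braiding M \<mu> \<rho> = (\<lambda>P \<in> Obj Mods.
    (P \<odot>\<^bsub>Mods\<^esub> (M, \<mu>), ind_braiding M \<rho> (fst P) (snd P), (M, \<mu>) \<odot>\<^bsub>Mods\<^esub> P))"

definition center_of
  where "center_of = (\<lambda>(M, \<mu>, \<rho>). ((M, \<mu>), ind_half_braiding M \<mu> \<rho>))"

definition center_arrow_of
  where "center_arrow_of = (\<lambda>(P, f, Q).
    (center_of P, (fst (center_of P), f, fst (center_of Q)), center_of Q))"

lemma ind_half_braiding_apply: "left_module C H \<nabla> \<eta> X \<nu> \<Longrightarrow>
  ind_half_braiding M \<mu> \<rho> (X, \<nu>) = ((X, \<nu>) \<odot>\<^bsub>Mods\<^esub> (M, \<mu>), ind_braiding M \<rho> X \<nu>, (M, \<mu>) \<odot>\<^bsub>Mods\<^esub> (X, \<nu>))"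
  by (simp add: ind_half_braiding_def)

lemma relative_half_braiding_ind_half_braiding:
  assumes YD: "yd M \<mu> \<rho>"
  shows "relative_half_braiding M \<mu> (ind_half_braiding M \<mu> \<rho>)"
proof -
  from YD have M: "left_module C H \<nabla> \<eta> M \<mu>" and R: "right_comodule C H \<Delta> \<epsilon> M \<rho>"
    by (auto simp: yetter_drinfeld_module_iff)
  note [simp] = left_moduleD(1)[OF M] actD[OF left_moduleD(1)[OF M]]
  note co = right_comoduleD(1)[OF R]
  have 1: "ind_half_braiding M \<mu> \<rho> P \<in> Hom\<^bsub>Mods\<^esub> (P \<odot>\<^bsub>Mods\<^esub> (M, \<mu>)) ((M, \<mu>) \<odot>\<^bsub>Mods\<^esub> P) \<and>
      is_iso Mods (ind_half_braiding M \<mu> \<rho> P)"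
    if "P \<in> Obj Mods" for P
  proof -
    obtain X \<nu> where P: "P = (X, \<nu>)" by (cases P)
    with that have X: "left_module C H \<nabla> \<eta> X \<nu>" by simp
    show ?thesis
      using ind_braiding_simps[OF co left_moduleD(1)[OF X]] ind_braiding_linear[OF YD X] ind_braiding_iso[OF R X]
        left_module_tensor[OF M X] left_module_tensor[OF X M]
      by (simp add: P ind_half_braiding_apply[OF X] Hom_Mods is_iso_Mods hom_iff)
  qed
  have 2: "(\<iota>\<^bsub>Mods\<^esub> (M, \<mu>) \<otimes>\<^bsub>Mods\<^esub> x) \<cdot>\<^bsub>Mods\<^esub> ind_half_braiding M \<mu> \<rho> P =
      ind_half_braiding M \<mu> \<rho> Q \<cdot>\<^bsub>Mods\<^esub> (x \<otimes>\<^bsub>Mods\<^esub> \<iota>\<^bsub>Mods\<^esub> (M, \<mu>))"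
    if hom: "x \<in> Hom\<^bsub>Mods\<^esub> P Q" for P Q x
  proof -
    obtain X \<nu> Y \<xi> where P: "P = (X, \<nu>)" "Q = (Y, \<xi>)" by (cases P; cases Q)
    then obtain f where x: "x = ((X, \<nu>), f, (Y, \<xi>))" and X: "left_module C H \<nabla> \<eta> X \<nu>"
      and Y: "left_module C H \<nabla> \<eta> Y \<xi>" and f: "f \<in> Hom X Y" "left_linear C H \<nu> \<xi> f"
      using hom by (auto simp: Hom_Mods)
    show ?thesis
      using ind_braiding_natural[OF co left_moduleD(1)[OF X] left_moduleD(1)[OF Y] _ _ _ f(2)] f(1)
      by (simp add: P x ind_half_braiding_apply[OF X] ind_half_braiding_apply[OF Y] hom_iff)
  qed
  have 3: "ind_half_braiding M \<mu> \<rho> (P \<odot>\<^bsub>Mods\<^esub> Q) =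
      (ind_half_braiding M \<mu> \<rho> P \<otimes>\<^bsub>Mods\<^esub> \<iota>\<^bsub>Mods\<^esub> Q) \<cdot>\<^bsub>Mods\<^esub> (\<iota>\<^bsub>Mods\<^esub> P \<otimes>\<^bsub>Mods\<^esub> ind_half_braiding M \<mu> \<rho> Q)"
    if "P \<in> Obj Mods" "Q \<in> Obj Mods" for P Q
  proof -
    obtain X \<nu> Y \<xi> where P: "P = (X, \<nu>)" "Q = (Y, \<xi>)" by (cases P; cases Q)
    with that have X: "left_module C H \<nabla> \<eta> X \<nu>" and Y: "left_module C H \<nabla> \<eta> Y \<xi>" by auto
    note [simp] = left_moduleD(1)[OF X] left_moduleD(1)[OF Y]
      actD[OF left_moduleD(1)[OF X]] actD[OF left_moduleD(1)[OF Y]]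
    show ?thesis
      by (simp add: P ind_half_braiding_apply X Y left_module_tensor ind_braiding_tensor[OF R] tensor_action_assoc)
  qed
  have ext: "ind_half_braiding M \<mu> \<rho> \<in> extensional (Obj Mods)"
    by (simp add: ind_half_braiding_def)
  have "half_braiding Mods (M, \<mu>) (ind_half_braiding M \<mu> \<rho>)"
    unfolding half_braiding_def using 1 2 3 ext by blast
  then show ?thesis
    by (simp add: relative_half_braiding_def M trivial_module_def ind_half_braiding_apply
        left_module_trivial ind_braiding_trivial[OF R])
qed

lemma yd_of_center_of: "yd M \<mu> \<rho> \<Longrightarrow> yd_of (center_of (M, \<mu>, \<rho>)) = (M, \<mu>, \<rho>)"
  by (simp add: yd_of_def center_of_def ind_coaction_def ind_half_braiding_apply[OF left_module_regular]
      yetter_drinfeld_module_iff right_comoduleD(1) ind_braiding_regular_unit)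

text \<open>Underlying arrows agree by \<open>under_eq_ind_braiding\<close>, endpoints are forced,
  and extensionality settles arguments that are not modules.\<close>

lemma center_of_yd_of:
  assumes c: "relative_half_braiding M \<mu> c"
  shows "center_of (yd_of ((M, \<mu>), c)) = ((M, \<mu>), c)"
proof -
  have "ind_half_braiding M \<mu> (ind_coaction M c) = c"
  proof (rule extensionalityI)
    show "ind_half_braiding M \<mu> (ind_coaction M c) \<in> extensional (Obj Mods)" by (simp add: ind_half_braiding_def)
    show "c \<in> extensional (Obj Mods)" using relative_half[OF c] by (simp add: half_braiding_def)
    fix P assume "P \<in> Obj Mods"
    moreover obtain X \<nu> where P: "P = (X, \<nu>)" by (cases P)
    ultimately have X: "left_module C H \<nabla> \<eta> X \<nu>" by simp
    obtain u where "c (X, \<nu>) = ((X, \<nu>) \<odot>\<^bsub>Mods\<^esub> (M, \<mu>), u, (M, \<mu>) \<odot>\<^bsub>Mods\<^esub> (X, \<nu>))"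
      using half_braiding_component[OF relative_half[OF c] X] by blast
    then show "ind_half_braiding M \<mu> (ind_coaction M c) P = c P"
      using under_eq_ind_braiding[OF c X] by (simp add: P ind_half_braiding_apply[OF X])
  qed
  then show ?thesis by (simp add: yd_of_def center_of_def)
qed

section \<open>Comparison of tensor products, units, morphisms and braidings\<close>

lemma YD_simps:
  "Obj YD = {(M, \<mu>, \<rho>). yd M \<mu> \<rho>}"
  "(P, f, Q) \<in> Arr YD \<longleftrightarrow> (case (P, Q) of ((M, \<mu>, \<rho>), (N, \<nu>, \<sigma>)) \<Rightarrow> yd M \<mu> \<rho> \<and> yd N \<nu> \<sigma> \<and>
    f \<in> Hom M N \<and> left_linear C H \<mu> \<nu> f \<and> right_colinear C H \<rho> \<sigma> f)"
  "Dom YD (P, f, Q) = P" "Cod YD (P, f, Q) = Q"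
  "\<iota>\<^bsub>YD\<^esub> P = (P, \<iota> (fst P), P)"
  "(Q', g, R) \<cdot>\<^bsub>YD\<^esub> (P, f, Q) = (P, g \<cdot> f, R)"
  "P \<odot>\<^bsub>YD\<^esub> Q = yd_tensor C \<Phi> H \<nabla> \<Delta> P Q"
  "(P, f, Q) \<otimes>\<^bsub>YD\<^esub> (P', f', Q') = (P \<odot>\<^bsub>YD\<^esub> P', f \<otimes> f', Q \<odot>\<^bsub>YD\<^esub> Q')"
  "\<one>\<^bsub>YD\<^esub> = (\<one>, \<epsilon>, \<eta>)"
  by (auto simp: yd_category_def)

text \<open>The unit inserted into the tensor half-braiding at \<open>H\<close> turns its first
  factor into the coaction of \<open>M\<close>; the second becomes an \<open>ind_braiding\<close>,
  and \<open>ind_braiding_tensor_coaction\<close> applies.\<close>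

lemma yd_of_tensor:
  assumes c: "relative_half_braiding M \<mu> c" and d: "relative_half_braiding N \<nu> d"
  shows "yd_of (center_tensor Mods ((M, \<mu>), c) ((N, \<nu>), d)) =
    yd_tensor C \<Phi> H \<nabla> \<Delta> (yd_of ((M, \<mu>), c)) (yd_of ((N, \<nu>), d))"
proof -
  note reg = left_module_regular
  note [simp] = actD[OF left_moduleD(1)[OF relative_module[OF c]]] actD[OF left_moduleD(1)[OF relative_module[OF d]]]
    relative_under(1-3)[OF c reg] relative_under(1-3)[OF d reg]
  obtain u where u: "c (H, \<nabla>) = ((H, \<nabla>) \<odot>\<^bsub>Mods\<^esub> (M, \<mu>), u, (M, \<mu>) \<odot>\<^bsub>Mods\<^esub> (H, \<nabla>))"
    using half_braiding_component[OF relative_half[OF c] reg] by blast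
  obtain v where v: "d (H, \<nabla>) = ((H, \<nabla>) \<odot>\<^bsub>Mods\<^esub> (N, \<nu>), v, (N, \<nu>) \<odot>\<^bsub>Mods\<^esub> (H, \<nabla>))"
    using half_braiding_component[OF relative_half[OF d] reg] by blast
  have [simp]: "u \<in> Arr C" "Dom C u = H \<odot> M" "Cod C u = M \<odot> H"
    "v \<in> Arr C" "Dom C v = H \<odot> N" "Cod C v = N \<odot> H"
    using relative_under(1-3)[OF c reg] relative_under(1-3)[OF d reg] by (auto simp: u v)
  have "(\<iota> M \<otimes> v) \<cdot> (u \<otimes> \<iota> N) \<cdot> (\<eta> \<otimes> \<iota> M \<otimes> \<iota> N) =
      (\<iota> M \<otimes> ind_braiding N (ind_coaction N d) H \<nabla>) \<cdot> (ind_coaction M c \<otimes> \<iota> N)"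
    using under_eq_ind_braiding[OF d reg] by (simp add: u v ind_coaction_def whisker_right)
  then show ?thesis
    by (simp add: center_tensor_def yd_of_def yd_tensor_def ind_coaction_def[of "M \<odot> N"] reg u v
        ind_braiding_tensor_coaction[OF coact_ind_coaction[OF c] coact_ind_coaction[OF d]])
qed

lemma yd_of_unit: "yd_of (\<one>\<^bsub>Mods\<^esub>, \<lambda>X \<in> Obj Mods. \<iota>\<^bsub>Mods\<^esub> X) = (\<one>, \<epsilon>, \<eta>)"
  by (simp add: yd_of_def ind_coaction_def left_module_regular)

text \<open>The condition on morphisms of the center is evaluated at the regular module; the
  inserted unit slides past \<open>f\<close> and leaves colinearity.\<close>

lemma yd_arrow_of_hom:
  assumes c: "relative_half_braiding M \<mu> c" and d: "relative_half_braiding N \<nu> d"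
    and f: "f \<in> Hom M N" "((M, \<mu>), f, (N, \<nu>)) \<in> center_hom Mods ((M, \<mu>), c) ((N, \<nu>), d)"
  shows "right_colinear C H (ind_coaction M c) (ind_coaction N d) f"
proof -
  note reg = left_module_regular
  note [simp] = actD[OF left_moduleD(1)[OF relative_module[OF c]]] actD[OF left_moduleD(1)[OF relative_module[OF d]]]
  obtain u where u: "c (H, \<nabla>) = ((H, \<nabla>) \<odot>\<^bsub>Mods\<^esub> (M, \<mu>), u, (M, \<mu>) \<odot>\<^bsub>Mods\<^esub> (H, \<nabla>))"
    using half_braiding_component[OF relative_half[OF c] reg] by blast
  obtain v where v: "d (H, \<nabla>) = ((H, \<nabla>) \<odot>\<^bsub>Mods\<^esub> (N, \<nu>), v, (N, \<nu>) \<odot>\<^bsub>Mods\<^esub> (H, \<nabla>))"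
    using half_braiding_component[OF relative_half[OF d] reg] by blast
  have [simp]: "u \<in> Arr C" "Dom C u = H \<odot> M" "Cod C u = M \<odot> H"
    "v \<in> Arr C" "Dom C v = H \<odot> N" "Cod C v = N \<odot> H" "f \<in> Arr C" "Dom C f = M" "Cod C f = N"
    using relative_under(1-3)[OF c reg] relative_under(1-3)[OF d reg] f(1) by (auto simp: u v hom_iff)
  have "(H, \<nabla>) \<in> Obj Mods" by (simp add: reg)
  then have "(((M, \<mu>), f, (N, \<nu>)) \<otimes>\<^bsub>Mods\<^esub> \<iota>\<^bsub>Mods\<^esub> (H, \<nabla>)) \<cdot>\<^bsub>Mods\<^esub> c (H, \<nabla>) =
      d (H, \<nabla>) \<cdot>\<^bsub>Mods\<^esub> (\<iota>\<^bsub>Mods\<^esub> (H, \<nabla>) \<otimes>\<^bsub>Mods\<^esub> ((M, \<mu>), f, (N, \<nu>)))"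
    using strict_monoidal_category.center_homD(4)[OF strict_monoidal_Mods f(2)] by blast
  then have "(f \<otimes> \<iota> H) \<cdot> u = v \<cdot> (\<iota> H \<otimes> f)"
    by (simp add: u v)
  note 1 = comp_reduce[OF this]
  have "(\<iota> H \<otimes> f) \<cdot> (\<eta> \<otimes> \<iota> M) = (\<eta> \<otimes> \<iota> N) \<cdot> f"
    using slide[of \<eta> f \<one> H M N] by simp
  then show ?thesis by (simp add: right_colinear_def ind_coaction_def u v 1)
qed

text \<open>Each component is built from the coaction, the action of the test module and
  \<open>\<Phi>\<close>, so a colinear arrow passes through it at every module.\<close>

lemma center_arrow_of_hom:
  assumes M: "yd M \<mu> \<rho>" and N: "yd N \<nu> \<sigma>"
    and f: "f \<in> Hom M N" "left_linear C H \<mu> \<nu> f" "right_colinear C H \<rho> \<sigma> f"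
  shows "((M, \<mu>), f, (N, \<nu>)) \<in> center_hom Mods
    ((M, \<mu>), ind_half_braiding M \<mu> \<rho>) ((N, \<nu>), ind_half_braiding N \<nu> \<sigma>)"
proof -
  have co: "coact M \<rho>" "coact N \<sigma>" and mods: "left_module C H \<nabla> \<eta> M \<mu>" "left_module C H \<nabla> \<eta> N \<nu>"
    using M N by (auto simp: yetter_drinfeld_module_iff right_comoduleD(1))
  have "(f \<otimes> \<iota> X) \<cdot> ind_braiding M \<rho> X \<nu>' = ind_braiding N \<sigma> X \<nu>' \<cdot> (\<iota> X \<otimes> f)" if "left_module C H \<nabla> \<eta> X \<nu>'" for X \<nu>'
    using ind_braiding_colinear[OF co left_moduleD(1)[OF that] _ _ _ f(3)] f(1) by (simp add: hom_iff)
  then show ?thesis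
    using f mods by (auto simp: center_hom_def Hom_Mods ind_half_braiding_apply)
qed

lemma strict_braided_functor_F:
  "strict_braided_functor RC (center_braiding Mods) YD (yd_braiding C \<Phi> H \<nabla> \<Delta>) yd_of yd_arrow_of"
proof -
  have yd_of: "yd_of P \<in> Obj YD" if "P \<in> Obj RC" for P
    using that yetter_drinfeld_ind_coaction by (auto simp: RC_simps YD_simps yd_of_def)
  have yd_arrow_of: "yd_arrow_of x \<in> Arr YD \<and> Dom YD (yd_arrow_of x) = yd_of (Dom RC x) \<and>
      Cod YD (yd_arrow_of x) = yd_of (Cod RC x)" if "x \<in> Arr RC" for x
    using that yd_arrow_of_hom yetter_drinfeld_ind_coaction
    by (auto simp: Arr_RC yd_arrow_of_def YD_simps Dom_RC Cod_RC) (auto simp: yd_of_def)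
  show ?thesis
  proof
    show "yd_of P \<in> Obj YD" if "P \<in> Obj RC" for P using yd_of[OF that] .
    show "yd_arrow_of x \<in> Hom\<^bsub>YD\<^esub> (yd_of P) (yd_of Q)" if "x \<in> Hom\<^bsub>RC\<^esub> P Q" for x P Q
      using that yd_arrow_of by (auto simp: Hom_def)
    show "yd_arrow_of (\<iota>\<^bsub>RC\<^esub> P) = \<iota>\<^bsub>YD\<^esub> (yd_of P)" if "P \<in> Obj RC" for P
      by (auto simp: yd_arrow_of_def RC_simps YD_simps yd_of_def split: prod.splits)
    show "yd_arrow_of (y \<cdot>\<^bsub>RC\<^esub> x) = yd_arrow_of y \<cdot>\<^bsub>YD\<^esub> yd_arrow_of x"
      if "x \<in> Hom\<^bsub>RC\<^esub> P Q" "y \<in> Hom\<^bsub>RC\<^esub> Q R" for x y P Q R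
      using that by (auto simp: Hom_def Arr_RC yd_arrow_of_def RC_simps YD_simps)
    show "yd_of \<one>\<^bsub>RC\<^esub> = \<one>\<^bsub>YD\<^esub>" using yd_of_unit by (simp add: RC_simps YD_simps)
    show "yd_of (P \<odot>\<^bsub>RC\<^esub> Q) = yd_of P \<odot>\<^bsub>YD\<^esub> yd_of Q" if "P \<in> Obj RC" "Q \<in> Obj RC" for P Q
      using that yd_of_tensor by (auto simp: RC_simps YD_simps)
    show "yd_arrow_of (x \<otimes>\<^bsub>RC\<^esub> y) = yd_arrow_of x \<otimes>\<^bsub>YD\<^esub> yd_arrow_of y" if "x \<in> Arr RC" "y \<in> Arr RC" for x y
      using that yd_of_tensor by (auto simp: Arr_RC yd_arrow_of_def RC_simps YD_simps)
    show "yd_arrow_of (center_braiding Mods P Q) = yd_braiding C \<Phi> H \<nabla> \<Delta> (yd_of P) (yd_of Q)"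
      if PQ: "P \<in> Obj RC" "Q \<in> Obj RC" for P Q
    proof -
      obtain M \<mu> c N \<nu> d where P: "P = ((M, \<mu>), c)" and c: "relative_half_braiding M \<mu> c"
        and Q: "Q = ((N, \<nu>), d)" and d: "relative_half_braiding N \<nu> d"
        using PQ by (auto simp: RC_simps)
      \<comment> \<open>The braiding of the center is the component at \<open>(M, \<mu>)\<close>, so
        the formula for general components is needed here, not just the one at
        \<open>H\<close>.\<close>
      have "under (d (M, \<mu>)) = ind_braiding N (ind_coaction N d) M \<mu>"
        using under_eq_ind_braiding[OF d relative_module[OF c]] .
      then show ?thesis
        using yd_of_tensor[OF c d] yd_of_tensor[OF d c]
        by (simp add: P Q center_braiding_def yd_arrow_of_def) (simp add: yd_braiding_def yd_of_def ind_braiding_def)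
    qed
  qed
qed

lemma isomorphic_RC_YD:
  "isomorphic_braided_categories RC (center_braiding Mods) YD (yd_braiding C \<Phi> H \<nabla> \<Delta>)"
proof (rule isomorphic_braided_categoriesI[OF braided_RC strict_braided_functor_F])
  have ArrYD: "\<exists>M \<mu> \<rho> f N \<nu> \<sigma>. x = ((M, \<mu>, \<rho>), f, (N, \<nu>, \<sigma>)) \<and> yd M \<mu> \<rho> \<and> yd N \<nu> \<sigma> \<and>
    f \<in> Hom M N \<and> left_linear C H \<mu> \<nu> f \<and> right_colinear C H \<rho> \<sigma> f" if "x \<in> Arr YD" for x
    using that by (cases x) (auto simp: YD_simps)
  show "center_of P \<in> Obj RC" if "P \<in> Obj YD" for P
    using that relative_half_braiding_ind_half_braiding by (auto simp: RC_simps YD_simps center_of_def)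
  show "center_arrow_of x \<in> Hom\<^bsub>RC\<^esub> (center_of (Dom YD x)) (center_of (Cod YD x))" if "x \<in> Arr YD" for x
    using ArrYD[OF that] center_arrow_of_hom relative_half_braiding_ind_half_braiding
    by (auto simp: Hom_def Arr_RC Dom_RC Cod_RC center_arrow_of_def center_of_def YD_simps)
  show "center_of (yd_of P) = P" if "P \<in> Obj RC" for P
    using that center_of_yd_of by (auto simp: RC_simps)
  show "center_arrow_of (yd_arrow_of x) = x" if "x \<in> Arr RC" for x
    using that center_of_yd_of by (auto simp: Arr_RC center_arrow_of_def yd_arrow_of_def)
  show "yd_of (center_of P) = P" if "P \<in> Obj YD" for P
    using that yd_of_center_of by (auto simp: YD_simps)
  show "yd_arrow_of (center_arrow_of x) = x" if "x \<in> Arr YD" for x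
    using ArrYD[OF that] yd_of_center_of by (auto simp: center_arrow_of_def yd_arrow_of_def)
  show "Dom YD x \<in> Obj YD \<and> Cod YD x \<in> Obj YD" if "x \<in> Arr YD" for x
    using ArrYD[OF that] by (auto simp: YD_simps)
qed

end

theorem proposition7p2:
  fixes C :: "('o, 'a, 'z) strict_moncat_scheme"
    and \<Phi> :: "'o \<Rightarrow> 'o \<Rightarrow> 'a"
    and H :: 'o and mult \<eta> \<Delta> \<epsilon> S :: 'a
  assumes "braided_category C \<Phi>"
    and "hopf_algebra C \<Phi> H mult \<eta> \<Delta> \<epsilon> S"
    and "is_iso C S"
    and "\<And>X. X \<in> Obj C \<Longrightarrow> \<Phi> H X = inv_arrow C (\<Phi> X H)"
  shows "isomorphic_braided_categories
    (relative_center C \<Phi> H mult \<eta> \<Delta> \<epsilon>)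
    (center_braiding (module_category C \<Phi> H mult \<eta> \<Delta> \<epsilon>))
    (yd_category C \<Phi> H mult \<eta> \<Delta> \<epsilon>)
    (yd_braiding C \<Phi> H mult \<Delta>)"
proof -
  interpret transparent_hopf_algebra C \<Phi> H mult \<eta> \<Delta> \<epsilon> S
    using assms(2,4) by (simp add: transparent_hopf_algebra_def transparent_hopf_algebra_axioms_def)
  show ?thesis by (rule isomorphic_RC_YD)
qed

end
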